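(* Let $n\ge 99$ be an integer and let $p>64$ be a prime. Then there exists a group $G$ with property $(T)$ such that $G$ is Golod-Shafarevich with respect to $p$ and $d_p(G)=n$, where $d_p(G)$ is the minimal number of (topological) generators of the pro-$p$ completion of $G$.
   Context: Golod-Shafarevich group: let $p$ be a prime and let $\langle X\mid \mathcal R\rangle$ be a group presentation with $|X|<\infty$. The degree of an element $f$ of the free group on $X$ with respect to the Zassenhaus $p$-filtration is the smallest degree of a monomial occurring in $f-1$ under the Magnus embedding $x\mapsto 1+x$ of the free group into the algebra $\mathbb F_p\langle\langle X\rangle\rangle$ of noncommutative power series. Let $r_i$ be the number of relations in $\mathcal R$ of degree $i$. The presentation satisfies the Golod-Shafarevich condition with respect to $p$ if there is a real number $0<t<1$ with $1-|X|t+\sum_{i\ge1}r_it^i<0$. A group is a Golod-Shafarevich group with respect to $p$ if it has a presentation satisfying this condition. Property $(T)$: a discrete group $G$ has property $(T)$ if there are a finite $S\subseteq G$ and $\varepsilon>0$ such that in every unitary representation of $G$ on a complex Hilbert space without nonzero invariant vectors, every nonzero vector $v$ satisfies $\|sv-v\|>\varepsilon\|v\|$ for some $s\in S$. *)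

theory Defs
  imports "HOL-Analysis.Analysis" "HOL-Algebra.Algebra" "HOL-Algebra.Algebraic_Closure_Type"
    "HOL-Number_Theory.Residues"
begin

section \<open>Free groups and presentations\<close>

text \<open>A letter \<open>(x, True)\<close> stands for the generator \<open>x\<close>, and \<open>(x, False)\<close> for its inverse.\<close>

type_synonym 'x letter = "'x \<times> bool"

definition inv_letter :: "'x letter \<Rightarrow> 'x letter" where
  "inv_letter a = (fst a, \<not> snd a)"

definition reduced_word :: "'x letter list \<Rightarrow> bool" where
  "reduced_word = successively (\<lambda>a b. b \<noteq> inv_letter a)"

fun cons_reduce :: "'x letter \<Rightarrow> 'x letter list \<Rightarrow> 'x letter list" where
  "cons_reduce a [] = [a]"
| "cons_reduce a (b # w) = (if b = inv_letter a then w else a # b # w)"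

definition free_group :: "'x set \<Rightarrow> 'x letter list monoid" where
  "free_group A =
    \<lparr>carrier = {w. reduced_word w \<and> set w \<subseteq> A \<times> UNIV},
     mult = (\<lambda>u v. foldr cons_reduce u v),
     one = []\<rparr>"

lemma inv_letter_inv [simp]: "inv_letter (inv_letter a) = a" "inv_letter a \<noteq> a"
  by (auto simp: inv_letter_def prod_eq_iff)

lemma reduced_Nil [simp]: "reduced_word []" by (simp add: reduced_word_def)

lemma reduced_Cons: "reduced_word (a # w) \<longleftrightarrow> reduced_word w \<and> (w = [] \<or> hd w \<noteq> inv_letter a)"
  by (cases w) (auto simp: reduced_word_def)

lemma reduced_cons_reduce [simp]: "reduced_word w \<Longrightarrow> reduced_word (cons_reduce a w)"
  by (cases w) (auto simp: reduced_Cons)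

lemma cons_reduce_reduced: "reduced_word (a # w) \<Longrightarrow> cons_reduce a w = a # w"
  by (cases w) (auto simp: reduced_word_def)

lemma cons_reduce_cancel:
  assumes "reduced_word w" shows "cons_reduce a (cons_reduce (inv_letter a) w) = w"
proof (cases w)
  case (Cons b v)
  show ?thesis
  proof (cases "b = a")
    case True
    then show ?thesis using assms Cons cons_reduce_reduced[of a v] by simp
  qed (use Cons in simp)
qed simp

lemma set_cons_reduce: "set (cons_reduce a w) \<subseteq> insert a (set w)"
  by (cases w) auto

lemma reduced_foldr [simp]: "reduced_word w \<Longrightarrow> reduced_word (foldr cons_reduce u w)"
  by (induction u) auto

lemma set_foldr: "set (foldr cons_reduce u w) \<subseteq> set u \<union> set w"
  by (induction u) (use set_cons_reduce in fastforce)+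

lemma foldr_cons_reduce_cons_reduce:
  assumes "reduced_word v" "reduced_word w"
  shows "foldr cons_reduce (cons_reduce a v) w = cons_reduce a (foldr cons_reduce v w)"
proof (cases v)
  case (Cons b v')
  then show ?thesis using assms cons_reduce_cancel[of "foldr cons_reduce v' w" a] by auto
qed simp

lemma foldr_cons_reduce_assoc:
  assumes "reduced_word v" "reduced_word w"
  shows "foldr cons_reduce (foldr cons_reduce u v) w = foldr cons_reduce u (foldr cons_reduce v w)"
  by (induction u) (simp_all add: assms foldr_cons_reduce_cons_reduce)

lemma foldr_cons_reduce_Nil: "reduced_word u \<Longrightarrow> foldr cons_reduce u [] = u"
  by (induction u) (auto simp: reduced_Cons cons_reduce_reduced)

lemma foldr_cons_reduce_inverse:
  "foldr cons_reduce (map inv_letter (rev u)) u = []"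
proof -
  have "foldr cons_reduce (map inv_letter (rev u)) (u @ w) = w" for w
    by (induction u arbitrary: w) auto
  from this[of "[]"] show ?thesis by simp
qed

lemma reduced_inverse: "reduced_word u \<Longrightarrow> reduced_word (map inv_letter (rev u))"
  unfolding reduced_word_def successively_map successively_rev
  by (elim successively_mono) (metis inv_letter_inv(1))

lemma group_free_group: "group (free_group A)"
proof (rule groupI)
  fix x assume x: "x \<in> carrier (free_group A)"
  show "\<exists>y\<in>carrier (free_group A). y \<otimes>\<^bsub>free_group A\<^esub> x = \<one>\<^bsub>free_group A\<^esub>"
    using x reduced_inverse[of x] foldr_cons_reduce_inverse[of x]
    by (intro bexI[of _ "map inv_letter (rev x)"]) (auto simp: free_group_def inv_letter_def)
qed (use set_foldr in \<open>fastforce simp: free_group_def foldr_cons_reduce_assoc foldr_cons_reduce_Nil\<close>)+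
definition presents :: "'x set \<Rightarrow> 'x letter list set \<Rightarrow> 'g monoid \<Rightarrow> bool" where
  "presents A R G \<longleftrightarrow>
     R \<subseteq> carrier (free_group A) \<and>
     G \<cong> free_group A Mod ((\<lambda>N. N \<lhd> free_group A) hull R)"


section \<open>Magnus embedding and degree\<close>

text \<open>
  A noncommutative power series is its coefficient function, a monomial being the list of its
  variables; coefficients of monomials with a variable outside \<open>A\<close> are required to vanish.
\<close>

definition nc_series :: "'x set \<Rightarrow> ('r, 'm) ring_scheme \<Rightarrow> ('x list \<Rightarrow> 'r) ring" where
  "nc_series A R =
    \<lparr>carrier = {f. \<forall>w. f w \<in> carrier R \<and> (\<not> set w \<subseteq> A \<longrightarrow> f w = \<zero>\<^bsub>R\<^esub>)},
     mult = (\<lambda>f g w. finsum R (\<lambda>k. f (take k w) \<otimes>\<^bsub>R\<^esub> g (drop k w)) {..length w}),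
     one = (\<lambda>w. if w = [] then \<one>\<^bsub>R\<^esub> else \<zero>\<^bsub>R\<^esub>),
     ring.zero = (\<lambda>w. \<zero>\<^bsub>R\<^esub>),
     ring.add = (\<lambda>f g w. f w \<oplus>\<^bsub>R\<^esub> g w)\<rparr>"

definition nc_var :: "('r, 'm) ring_scheme \<Rightarrow> 'x \<Rightarrow> 'x list \<Rightarrow> 'r" where
  "nc_var R x = (\<lambda>w. if w = [x] then \<one>\<^bsub>R\<^esub> else \<zero>\<^bsub>R\<^esub>)"

definition magnus_letter :: "'x set \<Rightarrow> ('r, 'm) ring_scheme \<Rightarrow> 'x letter \<Rightarrow> 'x list \<Rightarrow> 'r" where
  "magnus_letter A R a =
    (let u = \<one>\<^bsub>nc_series A R\<^esub> \<oplus>\<^bsub>nc_series A R\<^esub> nc_var R (fst a)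
     in if snd a then u else inv\<^bsub>nc_series A R\<^esub> u)"

definition magnus :: "'x set \<Rightarrow> ('r, 'm) ring_scheme \<Rightarrow> 'x letter list \<Rightarrow> 'x list \<Rightarrow> 'r" where
  "magnus A R w =
    foldr (\<lambda>a f. magnus_letter A R a \<otimes>\<^bsub>nc_series A R\<^esub> f) w \<one>\<^bsub>nc_series A R\<^esub>"

text \<open>The trivial element gets degree \<open>\<infinity>\<close>, the infimum of the empty set.\<close>

definition zassenhaus_degree :: "nat \<Rightarrow> 'x set \<Rightarrow> 'x letter list \<Rightarrow> enat" where
  "zassenhaus_degree p A f =
    (let R = residue_ring (int p); P = nc_series A R
     in INF m \<in> {m. (magnus A R f \<ominus>\<^bsub>P\<^esub> \<one>\<^bsub>P\<^esub>) m \<noteq> \<zero>\<^bsub>R\<^esub>}. enat (length m))"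

definition relators_of_degree :: "nat \<Rightarrow> 'x set \<Rightarrow> 'x letter list set \<Rightarrow> nat \<Rightarrow> 'x letter list set"
  where "relators_of_degree p A R i = {r \<in> R. zassenhaus_degree p A r = enat i}"

text \<open>
  \<open>R\<close> may be infinite.  If infinitely many relators share a degree, or if the series diverges,
  the condition fails for the given \<open>t\<close>; both must be excluded explicitly because
  \<^const>\<open>card\<close> and \<^const>\<open>suminf\<close> are total.
\<close>

definition golod_shafarevich_condition :: "nat \<Rightarrow> 'x set \<Rightarrow> 'x letter list set \<Rightarrow> bool" where
  "golod_shafarevich_condition p A R \<longleftrightarrow>
    (\<exists>t::real. 0 < t \<and> t < 1 \<and>
       (\<forall>i\<ge>1. finite (relators_of_degree p A R i)) \<and>
       summable (\<lambda>i. real (card (relators_of_degree p A R (Suc i))) * t ^ Suc i) \<and>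
       1 - real (card A) * t +
         suminf (\<lambda>i. real (card (relators_of_degree p A R (Suc i))) * t ^ Suc i) < 0)"

text \<open>As \<open>A\<close> is finite, generators may be taken to be natural numbers.\<close>

definition golod_shafarevich :: "nat \<Rightarrow> 'g monoid \<Rightarrow> bool" where
  "golod_shafarevich p G \<longleftrightarrow>
    (\<exists>(A :: nat set) R. finite A \<and> presents A R G \<and> golod_shafarevich_condition p A R)"


section \<open>Pro-\<open>p\<close> completion\<close>

definition p_power_index_normal :: "nat \<Rightarrow> 'g monoid \<Rightarrow> 'g set set" where
  "p_power_index_normal p G = {N. N \<lhd> G \<and> (\<exists>k. card (rcosets\<^bsub>G\<^esub> N) = p ^ k)}"

text \<open>
  The inverse limit of the quotients \<open>G / N\<close>: for \<open>N \<subseteq> M\<close>, the map \<open>G / N \<rightarrow> G / M\<close> sends a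
  coset of \<open>N\<close> to the coset of \<open>M\<close> containing it.
\<close>

definition pro_p_completion :: "nat \<Rightarrow> 'g monoid \<Rightarrow> ('g set \<Rightarrow> 'g set) monoid" where
  "pro_p_completion p G =
    (let \<N> = p_power_index_normal p G; P = product_group \<N> (\<lambda>N. G Mod N)
     in P\<lparr>carrier := {x \<in> carrier P. \<forall>N\<in>\<N>. \<forall>M\<in>\<N>. N \<subseteq> M \<longrightarrow> x N \<subseteq> x M}\<rparr>)"

definition pro_p_topology :: "nat \<Rightarrow> 'g monoid \<Rightarrow> ('g set \<Rightarrow> 'g set) topology" where
  "pro_p_topology p G =
    subtopology
      (product_topology (\<lambda>N. discrete_topology (carrier (G Mod N))) (p_power_index_normal p G))
      (carrier (pro_p_completion p G))"

text \<open>The value is \<open>\<infinity>\<close> if the completion is not topologically finitely generated.\<close>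

definition d_p :: "nat \<Rightarrow> 'g monoid \<Rightarrow> enat" where
  "d_p p G =
    (INF S \<in> {S. finite S \<and> S \<subseteq> carrier (pro_p_completion p G) \<and>
                 pro_p_topology p G closure_of generate (pro_p_completion p G) S =
                   carrier (pro_p_completion p G)}. enat (card S))"


section \<open>Unitary representations and property (T)\<close>

abbreviation complex_ring :: "complex ring" where
  "complex_ring \<equiv> ring_of_type_algebra"

text \<open>The fields \<^const>\<open>mult\<close> and \<^const>\<open>one\<close> inherited from the module record are not used.\<close>

record 'h inner_module = "(complex, 'h) module" +
  cinner :: "'h \<Rightarrow> 'h \<Rightarrow> complex"

definition hnorm :: "('h, 'm) inner_module_scheme \<Rightarrow> 'h \<Rightarrow> real" where
  "hnorm H x = sqrt (Re (cinner H x x))"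

text \<open>The value outside the carrier is arbitrary; \<^locale>\<open>Metric_space\<close> needs it symmetric and nonnegative.\<close>

definition hdist :: "('h, 'm) inner_module_scheme \<Rightarrow> 'h \<Rightarrow> 'h \<Rightarrow> real" where
  "hdist H x y = (if x \<in> carrier H \<and> y \<in> carrier H then hnorm H (x \<ominus>\<^bsub>H\<^esub> y) else 0)"

locale complex_hilbert = module complex_ring H for H :: "'h inner_module" (structure) +
  assumes cinner_add: "\<lbrakk>x \<in> carrier H; y \<in> carrier H; z \<in> carrier H\<rbrakk> \<Longrightarrow>
      cinner H (x \<oplus> y) z = cinner H x z + cinner H y z"
    and cinner_smult: "\<lbrakk>x \<in> carrier H; y \<in> carrier H\<rbrakk> \<Longrightarrow>
      cinner H (a \<odot> x) y = a * cinner H x y"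
    and cinner_commute: "\<lbrakk>x \<in> carrier H; y \<in> carrier H\<rbrakk> \<Longrightarrow>
      cinner H y x = cnj (cinner H x y)"
    and cinner_pos: "\<lbrakk>x \<in> carrier H; x \<noteq> \<zero>\<rbrakk> \<Longrightarrow> 0 < Re (cinner H x x)"
    and complete: "Metric_space.mcomplete (carrier H) (hdist H)"

text \<open>
  \<^const>\<open>group_action\<close> makes each \<open>\<pi> g\<close> a bijection of the underlying set of \<open>H\<close>, so that a
  linear isometric \<open>\<pi> g\<close> is unitary.
\<close>

definition unitary_rep :: "'g monoid \<Rightarrow> 'h inner_module \<Rightarrow> ('g \<Rightarrow> 'h \<Rightarrow> 'h) \<Rightarrow> bool" where
  "unitary_rep G H \<pi> \<longleftrightarrow> complex_hilbert H \<and> group_action G (carrier H) \<pi> \<and>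
    (\<forall>g\<in>carrier G. \<forall>x\<in>carrier H. \<forall>y\<in>carrier H.
       \<pi> g (x \<oplus>\<^bsub>H\<^esub> y) = \<pi> g x \<oplus>\<^bsub>H\<^esub> \<pi> g y \<and>
       (\<forall>a. \<pi> g (a \<odot>\<^bsub>H\<^esub> x) = a \<odot>\<^bsub>H\<^esub> \<pi> g x) \<and>
       cinner H (\<pi> g x) (\<pi> g y) = cinner H x y)"

text \<open>Quantifies over all Hilbert spaces whose underlying set is a subset of the type \<open>'h\<close>.\<close>

definition kazhdan_pair :: "'h itself \<Rightarrow> 'g monoid \<Rightarrow> 'g set \<Rightarrow> real \<Rightarrow> bool" where
  "kazhdan_pair _ G S \<epsilon> \<longleftrightarrow>
    (\<forall>(H :: 'h inner_module) \<pi>.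
       unitary_rep G H \<pi> \<and>
       (\<forall>v\<in>carrier H. (\<forall>g\<in>carrier G. \<pi> g v = v) \<longrightarrow> v = \<zero>\<^bsub>H\<^esub>) \<longrightarrow>
       (\<forall>v\<in>carrier H. v \<noteq> \<zero>\<^bsub>H\<^esub> \<longrightarrow>
          (\<exists>s\<in>S. hnorm H (\<pi> s v \<ominus>\<^bsub>H\<^esub> v) > \<epsilon> * hnorm H v)))"

text \<open>
  HOL cannot quantify over all types inside a formula.  The type chosen below is large enough:
  it names every limit of linear combinations of vectors in one \<open>G\<close>-orbit, so the condition
  for this type implies the same condition, with the same \<open>S\<close> and \<open>\<epsilon>\<close>, for Hilbert spaces over
  any type whatsoever; this is lemma \<open>kazhdan_pair_any_type\<close>.
\<close>

definition property_T :: "'g monoid \<Rightarrow> bool" where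
  "property_T G \<longleftrightarrow>
    (\<exists>S \<epsilon>. finite S \<and> S \<subseteq> carrier G \<and> 0 < \<epsilon> \<and>
       kazhdan_pair TYPE(nat \<Rightarrow> ('g \<times> complex) list) G S \<epsilon>)"

context complex_hilbert
begin

lemma smult_cl [simp]: "x \<in> carrier H \<Longrightarrow> a \<odot> x \<in> carrier H"
  by (rule smult_closed) (auto simp: ring_of_type_algebra_def)

lemma smult_l: "x \<in> carrier H \<Longrightarrow> (a + b) \<odot> x = a \<odot> x \<oplus> b \<odot> x"
  using smult_l_distr[of a b x] by (auto simp: ring_of_type_algebra_def)

lemma smult_r: "\<lbrakk>x \<in> carrier H; y \<in> carrier H\<rbrakk> \<Longrightarrow> a \<odot> (x \<oplus> y) = a \<odot> x \<oplus> a \<odot> y"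
  using smult_r_distr[of a x y] by (auto simp: ring_of_type_algebra_def)

lemma smult_assoc: "x \<in> carrier H \<Longrightarrow> (a * b) \<odot> x = a \<odot> (b \<odot> x)"
  using smult_assoc1[of a b x] by (auto simp: ring_of_type_algebra_def)

lemma smult_1 [simp]: "x \<in> carrier H \<Longrightarrow> 1 \<odot> x = x"
  using smult_one[of x] by (auto simp: ring_of_type_algebra_def)

lemma smult_zero_l [simp]: "x \<in> carrier H \<Longrightarrow> 0 \<odot> x = \<zero>"
  using smult_l_null[of x] by (auto simp: ring_of_type_algebra_def)

lemma smult_neg1: "x \<in> carrier H \<Longrightarrow> (-1) \<odot> x = \<ominus> x"
proof -
  assume x: "x \<in> carrier H"
  have "(-1) \<odot> x \<oplus> x = \<zero>"
    using smult_l[OF x, of "-1" 1] x by simp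
  then show ?thesis using x by (metis smult_cl minus_equality)
qed

lemma minus_smult: "\<lbrakk>x \<in> carrier H; y \<in> carrier H\<rbrakk> \<Longrightarrow> x \<ominus> y = x \<oplus> (-1) \<odot> y"
  by (simp add: smult_neg1 a_minus_def)

lemma cinner_add_right: "\<lbrakk>x \<in> carrier H; y \<in> carrier H; z \<in> carrier H\<rbrakk> \<Longrightarrow>
   cinner H z (x \<oplus> y) = cinner H z x + cinner H z y"
  by (metis M.a_closed cinner_add cinner_commute complex_cnj_add)

lemma cinner_smult_right: "\<lbrakk>x \<in> carrier H; y \<in> carrier H\<rbrakk> \<Longrightarrow>
   cinner H y (a \<odot> x) = cnj a * cinner H y x"
  by (metis smult_cl cinner_smult cinner_commute complex_cnj_mult)

lemma cinner_zero [simp]: "y \<in> carrier H \<Longrightarrow> cinner H \<zero> y = 0"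
  using cinner_smult[of y y 0] by simp

lemma cinner_self_ge: "x \<in> carrier H \<Longrightarrow> 0 \<le> Re (cinner H x x)"
  by (cases "x = \<zero>") (auto simp: less_imp_le cinner_pos)

lemma cinner_self: "x \<in> carrier H \<Longrightarrow> cinner H x x = complex_of_real ((hnorm H x)\<^sup>2)"
  using cinner_commute[of x x] cinner_self_ge[of x]
  by (auto simp: hnorm_def complex_eq_iff)

lemma hnorm_nonneg [simp]: "x \<in> carrier H \<Longrightarrow> 0 \<le> hnorm H x"
  by (simp add: hnorm_def cinner_self_ge)

lemma hnorm_eq_0 [simp]: "x \<in> carrier H \<Longrightarrow> hnorm H x = 0 \<longleftrightarrow> x = \<zero>"
  using cinner_pos[of x] by (cases "x = \<zero>") (auto simp: hnorm_def)

lemma hnorm_smult: assumes x: "x \<in> carrier H" shows "hnorm H (a \<odot> x) = cmod a * hnorm H x"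
proof -
  have "cinner H (a \<odot> x) (a \<odot> x) = (a * cnj a) * cinner H x x"
    using x by (simp add: cinner_smult cinner_smult_right)
  also have "\<dots> = complex_of_real ((cmod a)\<^sup>2) * cinner H x x"
    by (simp only: complex_norm_square)
  finally have "Re (cinner H (a \<odot> x) (a \<odot> x)) = (cmod a)\<^sup>2 * Re (cinner H x x)"
    by simp
  then show ?thesis by (simp add: hnorm_def real_sqrt_mult)
qed

lemma Cauchy_Schwarz: assumes x: "x \<in> carrier H" and y: "y \<in> carrier H"
  shows "cmod (cinner H x y) \<le> hnorm H x * hnorm H y"
proof (cases "y = \<zero>")
  case True
  have "cinner H x \<zero> = 0" using cinner_commute[of \<zero> x] x by simp
  then show ?thesis using True x by simp
next
  case False
  then have ny: "hnorm H y > 0" using y hnorm_nonneg[OF y] hnorm_eq_0[OF y] by linarith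
  define c where "c = cinner H x y"
  define a where "a = - c / complex_of_real ((hnorm H y)\<^sup>2)"
  have eq: "cinner H (x \<oplus> a \<odot> y) (x \<oplus> a \<odot> y) =
     cinner H x x + cnj a * c + a * cnj c + a * cnj a * cinner H y y"
    using x y by (simp add: cinner_add cinner_add_right cinner_smult cinner_smult_right
      cinner_commute[of x y] c_def algebra_simps)
  have "a * cnj a * cinner H y y = - cnj a * c"
    using ny y by (simp add: a_def cinner_self field_simps power2_eq_square)
  then have "cinner H (x \<oplus> a \<odot> y) (x \<oplus> a \<odot> y) = cinner H x x + a * cnj c"
    unfolding eq by simp
  also have "\<dots> = complex_of_real ((hnorm H x)\<^sup>2 - (cmod c)\<^sup>2 / (hnorm H y)\<^sup>2)"
    using x by (simp add: cinner_self a_def flip: complex_norm_square)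
  finally have "0 \<le> (hnorm H x)\<^sup>2 - (cmod c)\<^sup>2 / (hnorm H y)\<^sup>2"
    using cinner_self_ge[of "x \<oplus> a \<odot> y"] x y by simp
  then have "(cmod c)\<^sup>2 \<le> (hnorm H x * hnorm H y)\<^sup>2"
    using ny by (simp add: field_simps)
  then show ?thesis unfolding c_def using x y
    by (meson abs_le_square_iff hnorm_nonneg mult_nonneg_nonneg norm_ge_zero power2_le_imp_le)
qed

lemma hnorm_triangle: assumes x: "x \<in> carrier H" and y: "y \<in> carrier H"
  shows "hnorm H (x \<oplus> y) \<le> hnorm H x + hnorm H y"
proof -
  have "complex_of_real ((hnorm H (x \<oplus> y))\<^sup>2) =
     complex_of_real ((hnorm H x)\<^sup>2) + complex_of_real ((hnorm H y)\<^sup>2) + (cinner H x y + cnj (cinner H x y))"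
    using x y cinner_self[of "x \<oplus> y"] cinner_self[OF x] cinner_self[OF y]
    by (simp add: cinner_add cinner_add_right cinner_commute[of x y] algebra_simps)
  then have "(hnorm H (x \<oplus> y))\<^sup>2 = (hnorm H x)\<^sup>2 + (hnorm H y)\<^sup>2 + 2 * Re (cinner H x y)"
    by (simp add: complex_eq_iff)
  also have "\<dots> \<le> (hnorm H x)\<^sup>2 + (hnorm H y)\<^sup>2 + 2 * (hnorm H x * hnorm H y)"
    using Cauchy_Schwarz[OF x y] complex_Re_le_cmod[of "cinner H x y"] by linarith
  also have "\<dots> = (hnorm H x + hnorm H y)\<^sup>2" by (simp add: power2_sum)
  finally show ?thesis by (rule power2_le_imp_le) (use x y in simp)
qed

lemma hdist_eq: "\<lbrakk>x \<in> carrier H; y \<in> carrier H\<rbrakk> \<Longrightarrow> hdist H x y = hnorm H (x \<ominus> y)"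
  by (simp add: hdist_def)

lemma hnorm_minus_commute: "\<lbrakk>x \<in> carrier H; y \<in> carrier H\<rbrakk> \<Longrightarrow> hnorm H (x \<ominus> y) = hnorm H (y \<ominus> x)"
proof -
  assume x: "x \<in> carrier H" and y: "y \<in> carrier H"
  have "y \<ominus> x = (-1) \<odot> (x \<ominus> y)"
    using x y by (simp add: minus_smult smult_r M.a_comm flip: smult_assoc)
  then show ?thesis using x y by (simp add: hnorm_smult)
qed

lemma Metric_space_hdist: "Metric_space (carrier H) (hdist H)"
proof (rule Metric_space.intro)
  show "0 \<le> hdist H x y" for x y
    unfolding hdist_def using hnorm_nonneg M.minus_closed by (simp only: split: if_split) simp
  show "hdist H x y = hdist H y x" for x y
    unfolding hdist_def using hnorm_minus_commute[of x y] by auto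
  show "hdist H x y = 0 \<longleftrightarrow> x = y" if "x \<in> carrier H" "y \<in> carrier H" for x y
  proof -
    have "x \<ominus> y = \<zero> \<longleftrightarrow> x = y"
      using that by (metis M.minus_equality M.minus_minus M.a_inv_closed a_minus_def M.r_neg)
    then show ?thesis
      using that hnorm_eq_0[of "x \<ominus> y"] by (simp only: hdist_def M.minus_closed simp_thms if_True)
  qed
  show "hdist H x z \<le> hdist H x y + hdist H y z"
    if xyz: "x \<in> carrier H" "y \<in> carrier H" "z \<in> carrier H" for x y z
  proof -
    have "(x \<ominus> y) \<oplus> (y \<ominus> z) = x \<ominus> z"
      using xyz by (simp only: a_minus_def M.a_assoc M.a_closed M.a_inv_closed M.r_neg1)
    then show ?thesis using hnorm_triangle[of "x \<ominus> y" "y \<ominus> z"] xyz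
      by (simp only: hdist_def M.minus_closed simp_thms if_True)
  qed
qed

sublocale HM: Metric_space "carrier H" "hdist H" by (rule Metric_space_hdist)

end

text \<open>Passing to a closed subspace and renaming its elements.\<close>

locale hilbert_transport = complex_hilbert H for H :: "'h inner_module" (structure) +
  fixes W :: "'h set" and enc :: "'h \<Rightarrow> 'k"
  assumes W_sub: "W \<subseteq> carrier H" and inj: "inj_on enc W"
    and W_zero: "\<zero> \<in> W"
    and W_add: "\<lbrakk>x \<in> W; y \<in> W\<rbrakk> \<Longrightarrow> x \<oplus> y \<in> W"
    and W_smult: "x \<in> W \<Longrightarrow> a \<odot> x \<in> W"
    and W_closed: "\<lbrakk>x \<in> carrier H; \<And>e. e > 0 \<Longrightarrow> \<exists>y\<in>W. hdist H y x < e\<rbrakk> \<Longrightarrow> x \<in> W"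
begin

definition dec :: "'k \<Rightarrow> 'h" where "dec = inv_into W enc"

definition K :: "'k inner_module" where
  "K = \<lparr>carrier = enc ` W, mult = undefined, one = undefined, ring.zero = enc \<zero>,
     ring.add = (\<lambda>x y. enc (dec x \<oplus> dec y)), smult = (\<lambda>a x. enc (a \<odot> dec x)),
     cinner = (\<lambda>x y. cinner H (dec x) (dec y))\<rparr>"

lemma dec_enc [simp]: "x \<in> W \<Longrightarrow> dec (enc x) = x"
  by (simp add: dec_def inj)

lemma WD [simp]: "x \<in> W \<Longrightarrow> x \<in> carrier H" using W_sub by auto

lemma K_simps: "carrier K = enc ` W" "\<zero>\<^bsub>K\<^esub> = enc \<zero>"
  "x \<in> W \<Longrightarrow> y \<in> W \<Longrightarrow> enc x \<oplus>\<^bsub>K\<^esub> enc y = enc (x \<oplus> y)"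
  "x \<in> W \<Longrightarrow> a \<odot>\<^bsub>K\<^esub> enc x = enc (a \<odot> x)"
  "x \<in> W \<Longrightarrow> y \<in> W \<Longrightarrow> cinner K (enc x) (enc y) = cinner H x y"
  by (simp_all add: K_def)

lemma module_K: "module complex_ring K"
proof (rule moduleI)
  show "cring complex_ring" by (rule R.is_cring)
  show "abelian_group K"
  proof (rule abelian_groupI; unfold K_simps)
    show "\<exists>y\<in>enc ` W. y \<oplus>\<^bsub>K\<^esub> x = enc \<zero>" if x: "x \<in> enc ` W" for x
    proof -
      obtain w where w: "w \<in> W" "x = enc w" using x by auto
      have "(-1) \<odot> w \<oplus> w = \<zero>" using smult_l[of w "-1" 1] w by simp
      then show ?thesis using w W_smult by (intro bexI[of _ "enc ((-1) \<odot> w)"]) (auto simp: K_simps)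
    qed
    show "(x \<oplus>\<^bsub>K\<^esub> y) \<oplus>\<^bsub>K\<^esub> z = x \<oplus>\<^bsub>K\<^esub> (y \<oplus>\<^bsub>K\<^esub> z)"
      if "x \<in> enc ` W" "y \<in> enc ` W" "z \<in> enc ` W" for x y z
      using that by (auto simp: K_simps W_add M.a_assoc)
    show "x \<oplus>\<^bsub>K\<^esub> y = y \<oplus>\<^bsub>K\<^esub> x" if "x \<in> enc ` W" "y \<in> enc ` W" for x y
      using that by (auto simp: K_simps M.a_comm)
  qed (auto simp: K_simps W_zero W_add)
qed (auto simp: K_simps W_add W_smult smult_l smult_r smult_assoc ring_of_type_algebra_def)

lemma K_minus: assumes "x \<in> W" "y \<in> W" shows "enc x \<ominus>\<^bsub>K\<^esub> enc y = enc (x \<ominus> y)" "x \<ominus> y \<in> W"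
proof -
  interpret KM: module complex_ring K by (rule module_K)
  have "(-1) \<odot> y \<oplus> y = \<zero>" using smult_l[of y "-1" 1] assms by simp
  then have "enc ((-1) \<odot> y) \<oplus>\<^bsub>K\<^esub> enc y = \<zero>\<^bsub>K\<^esub>" using assms W_smult by (simp add: K_simps)
  then have "\<ominus>\<^bsub>K\<^esub> enc y = enc ((-1) \<odot> y)" using assms W_smult
    by (intro KM.minus_equality) (auto simp: K_simps)
  then show "enc x \<ominus>\<^bsub>K\<^esub> enc y = enc (x \<ominus> y)" "x \<ominus> y \<in> W" using assms W_smult W_add
    by (auto simp: a_minus_def[of K] K_simps minus_smult)
qed

lemma K_norm: "x \<in> W \<Longrightarrow> hnorm K (enc x) = hnorm H x"
  by (simp add: hnorm_def K_simps)

lemma K_dist: "x \<in> W \<Longrightarrow> y \<in> W \<Longrightarrow> hdist K (enc x) (enc y) = hdist H x y"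
  by (simp add: hdist_def K_minus K_norm) (simp add: K_simps)

lemma hilbert_K: "complex_hilbert K"
proof (intro complex_hilbert.intro complex_hilbert_axioms.intro module_K)
  interpret KM: module complex_ring K by (rule module_K)
  have dK: "hdist K x y = hdist H (dec x) (dec y)" if "x \<in> carrier K" "y \<in> carrier K" for x y
    using that K_dist by (auto simp: K_simps)
  interpret KS: Metric_space "carrier K" "hdist K"
  proof
    show "0 \<le> hdist K x y" for x y
      by (metis HM.nonneg dK hdist_def order_refl)
    show "hdist K x y = hdist K y x" for x y
      by (metis HM.commute dK hdist_def)
    show "hdist K x y = 0 \<longleftrightarrow> x = y" if "x \<in> carrier K" "y \<in> carrier K" for x y
      using that by (auto simp: K_simps K_dist)
    show "hdist K x z \<le> hdist K x y + hdist K y z"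
      if "x \<in> carrier K" "y \<in> carrier K" "z \<in> carrier K" for x y z
      using that by (auto simp: K_simps K_dist HM.triangle)
  qed
  show "KS.mcomplete"
    unfolding KS.mcomplete_def
  proof (intro allI impI)
    fix \<sigma> assume c: "KS.MCauchy \<sigma>"
    have s: "\<sigma> n \<in> enc ` W" for n using c unfolding KS.MCauchy_def by (auto simp: K_simps)
    then have sW: "dec (\<sigma> n) \<in> W" and se: "enc (dec (\<sigma> n)) = \<sigma> n" for n
      by (auto simp: dec_def inv_into_into f_inv_into_f)
    have "HM.MCauchy (\<lambda>n. dec (\<sigma> n))"
      using c[unfolded KS.MCauchy_def] sW dK by (auto simp: HM.MCauchy_def image_subset_iff)
    then obtain l where l: "limitin HM.mtopology (\<lambda>n. dec (\<sigma> n)) l sequentially"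
      using complete by (auto simp: HM.mcomplete_def)
    then have lc: "l \<in> carrier H" and ll: "\<And>e. e > 0 \<Longrightarrow> \<exists>N. \<forall>n\<ge>N. hdist H (dec (\<sigma> n)) l < e"
      unfolding HM.limit_metric_sequentially by blast+
    have lW: "l \<in> W"
      by (rule W_closed[OF lc]) (use ll sW in blast)
    have "hdist K (\<sigma> n) (enc l) = hdist H (dec (\<sigma> n)) l" for n
      using K_dist[OF sW lW] by (simp add: se)
    then have "limitin KS.mtopology \<sigma> (enc l) sequentially"
      unfolding KS.limit_metric_sequentially using ll lW s by (auto simp: K_simps(1))
    then show "\<exists>x. limitin KS.mtopology \<sigma> x sequentially" by blast
  qed
  show "cinner K (x \<oplus>\<^bsub>K\<^esub> y) z = cinner K x z + cinner K y z"
    if "x \<in> carrier K" "y \<in> carrier K" "z \<in> carrier K" for x y z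
    using that by (auto simp: K_simps W_add cinner_add)
  show "cinner K (a \<odot>\<^bsub>K\<^esub> x) y = a * cinner K x y"
    if "x \<in> carrier K" "y \<in> carrier K" for a x y
    using that by (auto simp: K_simps W_smult cinner_smult)
  show "cinner K y x = cnj (cinner K x y)"
    if "x \<in> carrier K" "y \<in> carrier K" for x y
    using that by (auto simp: K_simps intro!: cinner_commute WD)
  show "0 < Re (cinner K x x)" if "x \<in> carrier K" "x \<noteq> \<zero>\<^bsub>K\<^esub>" for x
    using that by (auto simp: K_simps intro!: cinner_pos WD)
qed


lemma unitary_K:
  assumes U: "unitary_rep G H \<pi>" and inv: "\<And>g x. \<lbrakk>g \<in> carrier G; x \<in> W\<rbrakk> \<Longrightarrow> \<pi> g x \<in> W"
  shows "unitary_rep G K (\<lambda>g. \<lambda>x\<in>enc ` W. enc (\<pi> g (dec x)))"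
proof -
  define \<rho> where "\<rho> = (\<lambda>g. \<lambda>x\<in>enc ` W. enc (\<pi> g (dec x)))"
  interpret act: group_action G "carrier H" \<pi> using U by (simp add: unitary_rep_def)
  interpret G: group G using act.group_hom by (simp add: group_hom_def)
  have \<rho>: "\<rho> g (enc x) = enc (\<pi> g x)" if "x \<in> W" for g x using that by (simp add: \<rho>_def)
  have comp: "\<pi> (g \<otimes>\<^bsub>G\<^esub> h) x = \<pi> g (\<pi> h x)" if "g \<in> carrier G" "h \<in> carrier G" "x \<in> W" for g h x
    using act.composition_rule[of x g h] that by simp
  have one: "\<pi> \<one>\<^bsub>G\<^esub> x = x" if "x \<in> W" for x
    using act.id_eq_one that by (metis WD restrict_apply')
  have lin: "\<pi> g (x \<oplus> y) = \<pi> g x \<oplus> \<pi> g y" "\<pi> g (a \<odot> x) = a \<odot> \<pi> g x"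
      "cinner H (\<pi> g x) (\<pi> g y) = cinner H x y"
    if "g \<in> carrier G" "x \<in> W" "y \<in> W" for g x y a
    using U that WD unfolding unitary_rep_def by blast+
  have bij: "\<rho> g \<in> Bij (enc ` W)" if g: "g \<in> carrier G" for g
  proof -
    have ig: "inv\<^bsub>G\<^esub> g \<in> carrier G" using g by simp
    have "bij_betw (\<rho> g) (enc ` W) (enc ` W)"
    proof (rule bij_betw_byWitness[where f' = "\<rho> (inv\<^bsub>G\<^esub> g)"])
      show "\<forall>a\<in>enc ` W. \<rho> (inv\<^bsub>G\<^esub> g) (\<rho> g a) = a"
        using g ig comp[OF ig g] one by (auto simp: \<rho> inv)
      show "\<forall>a\<in>enc ` W. \<rho> g (\<rho> (inv\<^bsub>G\<^esub> g) a) = a"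
        using g ig comp[OF g ig] one by (auto simp: \<rho> inv)
    qed (use g ig inv \<rho> in auto)
    then show ?thesis by (simp add: Bij_def \<rho>_def)
  qed
  have "group_action G (carrier K) \<rho>"
  proof (rule group_action.intro, rule group_hom.intro)
    show "group G" ..
    show "group (BijGroup (carrier K))" by (rule group_BijGroup)
    show "group_hom_axioms G (BijGroup (carrier K)) \<rho>"
    proof (rule group_hom_axioms.intro, rule homI)
      show "\<rho> g \<in> carrier (BijGroup (carrier K))" if "g \<in> carrier G" for g
        using bij[OF that] by (simp add: BijGroup_def K_simps)
      show "\<rho> (g \<otimes>\<^bsub>G\<^esub> h) = \<rho> g \<otimes>\<^bsub>BijGroup (carrier K)\<^esub> \<rho> h"
        if gh: "g \<in> carrier G" "h \<in> carrier G" for g h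
      proof -
        have "\<rho> (g \<otimes>\<^bsub>G\<^esub> h) x = compose (enc ` W) (\<rho> g) (\<rho> h) x" for x
        proof (cases "x \<in> enc ` W")
          case True
          then show ?thesis using gh by (auto simp: compose_def \<rho> comp inv)
        next
          case False
          then show ?thesis by (simp add: compose_def \<rho>_def)
        qed
        then show ?thesis using bij gh by (auto simp: BijGroup_def K_simps)
      qed
    qed
  qed
  moreover have "\<rho> g (x \<oplus>\<^bsub>K\<^esub> y) = \<rho> g x \<oplus>\<^bsub>K\<^esub> \<rho> g y \<and>
       (\<forall>a. \<rho> g (a \<odot>\<^bsub>K\<^esub> x) = a \<odot>\<^bsub>K\<^esub> \<rho> g x) \<and>
       cinner K (\<rho> g x) (\<rho> g y) = cinner K x y"
    if "g \<in> carrier G" "x \<in> carrier K" "y \<in> carrier K" for g x y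
    using that by (auto simp: K_simps \<rho> inv W_add W_smult lin)
  ultimately show ?thesis using hilbert_K unfolding unitary_rep_def \<rho>_def by blast
qed

end

lemma kazhdan_pair_any_type:
  fixes G :: "'g monoid"
  assumes kp: "kazhdan_pair TYPE(nat \<Rightarrow> ('g \<times> complex) list) G S \<epsilon>" and SG: "S \<subseteq> carrier G"
  shows "kazhdan_pair TYPE('h) G S \<epsilon>"
  unfolding kazhdan_pair_def
proof (intro allI impI ballI, elim conjE)
  fix H :: "'h inner_module" and \<pi> v
  assume U: "unitary_rep G H \<pi>"
    and noinv: "\<forall>v\<in>carrier H. (\<forall>g\<in>carrier G. \<pi> g v = v) \<longrightarrow> v = \<zero>\<^bsub>H\<^esub>"
    and v: "v \<in> carrier H" and v0: "v \<noteq> \<zero>\<^bsub>H\<^esub>"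
  interpret complex_hilbert H using U by (simp add: unitary_rep_def)
  interpret act: group_action G "carrier H" \<pi> using U by (simp add: unitary_rep_def)
  interpret G: group G using act.group_hom by (simp add: group_hom_def)
  have pc [simp]: "\<pi> g x \<in> carrier H" if "g \<in> carrier G" "x \<in> carrier H" for g x
    using act.element_image that by blast
  have padd: "\<pi> g (x \<oplus>\<^bsub>H\<^esub> y) = \<pi> g x \<oplus>\<^bsub>H\<^esub> \<pi> g y"
    and psm: "\<pi> g (a \<odot>\<^bsub>H\<^esub> x) = a \<odot>\<^bsub>H\<^esub> \<pi> g x"
    and pin: "cinner H (\<pi> g x) (\<pi> g y) = cinner H x y"
    if "g \<in> carrier G" "x \<in> carrier H" "y \<in> carrier H" for g x y a
    using U that by (auto simp: unitary_rep_def)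
  have p0: "\<pi> g \<zero>\<^bsub>H\<^esub> = \<zero>\<^bsub>H\<^esub>" if "g \<in> carrier G" for g
    using psm[OF that v v, of 0] that v by simp
  have comp: "\<pi> (g \<otimes>\<^bsub>G\<^esub> h) x = \<pi> g (\<pi> h x)" if "g \<in> carrier G" "h \<in> carrier G" "x \<in> carrier H" for g h x
    using act.composition_rule[of x g h] that by simp
  have one: "\<pi> \<one>\<^bsub>G\<^esub> x = x" if "x \<in> carrier H" for x
    using act.id_eq_one that by (metis restrict_apply')
  have dadd: "hdist H (x \<oplus>\<^bsub>H\<^esub> y) (x' \<oplus>\<^bsub>H\<^esub> y') \<le> hdist H x x' + hdist H y y'"
    if c: "x \<in> carrier H" "y \<in> carrier H" "x' \<in> carrier H" "y' \<in> carrier H" for x y x' y'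
  proof -
    have "(x \<oplus>\<^bsub>H\<^esub> y) \<ominus>\<^bsub>H\<^esub> (x' \<oplus>\<^bsub>H\<^esub> y') = (x \<ominus>\<^bsub>H\<^esub> x') \<oplus>\<^bsub>H\<^esub> (y \<ominus>\<^bsub>H\<^esub> y')"
      using c by (simp add: minus_smult smult_r M.a_ac)
    then show ?thesis using hnorm_triangle[of "x \<ominus>\<^bsub>H\<^esub> x'" "y \<ominus>\<^bsub>H\<^esub> y'"] c
      by (simp only: hdist_eq M.a_closed M.minus_closed)
  qed
  have dsm: "hdist H (a \<odot>\<^bsub>H\<^esub> x) (a \<odot>\<^bsub>H\<^esub> y) = cmod a * hdist H x y"
    if c: "x \<in> carrier H" "y \<in> carrier H" for a x y
  proof -
    have "(a \<odot>\<^bsub>H\<^esub> x) \<ominus>\<^bsub>H\<^esub> (a \<odot>\<^bsub>H\<^esub> y) = a \<odot>\<^bsub>H\<^esub> (x \<ominus>\<^bsub>H\<^esub> y)"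
      using c by (simp add: minus_smult smult_r flip: smult_assoc)
    then show ?thesis using c hnorm_smult[of "x \<ominus>\<^bsub>H\<^esub> y" a]
      by (simp only: hdist_eq smult_cl M.minus_closed)
  qed
  have dp: "hdist H (\<pi> g x) (\<pi> g y) = hdist H x y"
    if c: "g \<in> carrier G" "x \<in> carrier H" "y \<in> carrier H" for g x y
  proof -
    have "\<pi> g x \<ominus>\<^bsub>H\<^esub> \<pi> g y = \<pi> g (x \<ominus>\<^bsub>H\<^esub> y)"
      using c by (simp add: minus_smult padd psm)
    then show ?thesis using c by (simp add: hdist_eq hnorm_def pin)
  qed
  define L where "L = {l :: ('g \<times> complex) list. set l \<subseteq> carrier G \<times> UNIV}"
  define comb where "comb = (\<lambda>l. foldr (\<lambda>p x. snd p \<odot>\<^bsub>H\<^esub> \<pi> (fst p) v \<oplus>\<^bsub>H\<^esub> x) l \<zero>\<^bsub>H\<^esub>)"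
  have comb_Nil: "comb [] = \<zero>\<^bsub>H\<^esub>"
    and comb_Cons: "comb (p # l) = snd p \<odot>\<^bsub>H\<^esub> \<pi> (fst p) v \<oplus>\<^bsub>H\<^esub> comb l" for p l
    by (simp_all add: comb_def)
  have comb_in: "comb l \<in> carrier H" if "l \<in> L" for l
    using that by (induction l) (auto simp: comb_Nil comb_Cons L_def v)
  have comb_app: "comb (l @ m) = comb l \<oplus>\<^bsub>H\<^esub> comb m" "l @ m \<in> L" if "l \<in> L" "m \<in> L" for l m
  proof -
    show "l @ m \<in> L" using that by (auto simp: L_def)
    show "comb (l @ m) = comb l \<oplus>\<^bsub>H\<^esub> comb m"
      using that
    proof (induction l)
      case Nil
      then show ?case by (simp add: comb_Nil comb_in)
    next
      case (Cons p l)
      then have "l \<in> L" "fst p \<in> carrier G" by (auto simp: L_def)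
      then show ?case using Cons comb_in[of l] comb_in[of m] v by (simp add: comb_Cons M.a_assoc)
    qed
  qed
  have comb_sm: "\<exists>m\<in>L. comb m = a \<odot>\<^bsub>H\<^esub> comb l" if "l \<in> L" for l a
  proof (intro bexI)
    show "map (\<lambda>p. (fst p, a * snd p)) l \<in> L" using that by (auto simp: L_def)
    show "comb (map (\<lambda>p. (fst p, a * snd p)) l) = a \<odot>\<^bsub>H\<^esub> comb l" using that
    proof (induction l)
      case Nil
      have "a \<odot>\<^bsub>H\<^esub> \<zero>\<^bsub>H\<^esub> = \<zero>\<^bsub>H\<^esub>" by (metis M.zero_closed mult_zero_right smult_assoc smult_zero_l)
      then show ?case by (simp add: comb_Nil)
    next
      case (Cons p l)
      then have "l \<in> L" "fst p \<in> carrier G" by (auto simp: L_def)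
      then show ?case using Cons comb_in[of l] v by (simp add: comb_Cons smult_r smult_assoc)
    qed
  qed
  have comb_p: "\<exists>m\<in>L. comb m = \<pi> g (comb l)" if "l \<in> L" and g: "g \<in> carrier G" for l g
  proof (intro bexI)
    show "map (\<lambda>p. (g \<otimes>\<^bsub>G\<^esub> fst p, snd p)) l \<in> L" using that by (auto simp: L_def)
    show "comb (map (\<lambda>p. (g \<otimes>\<^bsub>G\<^esub> fst p, snd p)) l) = \<pi> g (comb l)" using that(1)
    proof (induction l)
      case Nil
      then show ?case using g by (simp add: comb_Nil p0)
    next
      case (Cons p l)
      then have "l \<in> L" "fst p \<in> carrier G" by (auto simp: L_def)
      then show ?case using Cons comb_in[of l] v g by (simp add: comb_Cons padd psm comp)
    qed
  qed
  define W where "W = {x \<in> carrier H. \<forall>e>0. \<exists>l\<in>L. hdist H (comb l) x < e}"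
  define enc where "enc = (\<lambda>x n. SOME l. l \<in> L \<and> hdist H (comb l) x < 1 / (real n + 1))"
  have enc: "enc x n \<in> L \<and> hdist H (comb (enc x n)) x < 1 / (real n + 1)" if "x \<in> W" for x n
  proof -
    have "\<exists>l. l \<in> L \<and> hdist H (comb l) x < 1 / (real n + 1)"
      using that by (auto simp: W_def dest!: spec[of _ "1 / (real n + 1)"])
    then show ?thesis unfolding enc_def by (rule someI_ex)
  qed
  have Wc: "x \<in> carrier H" if "x \<in> W" for x using that by (simp add: W_def)
  have comb_W: "comb l \<in> W" if "l \<in> L" for l
    using comb_in[OF that] that by (auto simp: W_def intro!: bexI[of _ l])
  have W_p: "\<pi> g x \<in> W" if g: "g \<in> carrier G" and x: "x \<in> W" for g x
  proof -
    have "\<exists>m\<in>L. hdist H (comb m) (\<pi> g x) < e" if e: "e > 0" for e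
    proof -
      obtain l where l: "l \<in> L" "hdist H (comb l) x < e" using x e by (auto simp: W_def)
      then show ?thesis using comb_p[OF l(1) g] dp[OF g comb_in[OF l(1)] Wc[OF x]] by force
    qed
    then show ?thesis using g Wc[OF x] by (simp add: W_def)
  qed
  interpret T: hilbert_transport H W enc
  proof unfold_locales
    show "W \<subseteq> carrier H" by (auto simp: W_def)
    show "inj_on enc W"
    proof (rule inj_onI, rule ccontr)
      fix x y assume x: "x \<in> W" and y: "y \<in> W" and eq: "enc x = enc y" and ne: "x \<noteq> y"
      have "hdist H x y > 0" using ne Wc[OF x] Wc[OF y] HM.nonneg[of x y] HM.zero[of x y] by linarith
      then obtain n where n: "1 / (real n + 1) < hdist H x y / 2"
        by (metis half_gt_zero nat_approx_posE of_nat_Suc add.commute)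
      have "hdist H x y \<le> hdist H x (comb (enc x n)) + hdist H (comb (enc x n)) y"
        using HM.triangle Wc x y comb_in enc by blast
      then show False
        using enc[OF x, of n] enc[OF y, of n] n HM.commute[of x "comb (enc x n)"] by (simp add: eq)
    qed
    show "\<zero>\<^bsub>H\<^esub> \<in> W" using comb_W[of "[]"] by (simp add: comb_Nil L_def)
    show "x \<oplus>\<^bsub>H\<^esub> y \<in> W" if x: "x \<in> W" and y: "y \<in> W" for x y
    proof -
      have "\<exists>m\<in>L. hdist H (comb m) (x \<oplus>\<^bsub>H\<^esub> y) < e" if e: "e > 0" for e
      proof -
        obtain l where l: "l \<in> L" "hdist H (comb l) x < e / 2" using x half_gt_zero[OF e] by (auto simp only: W_def)
        obtain m where m: "m \<in> L" "hdist H (comb m) y < e / 2" using y half_gt_zero[OF e] by (auto simp only: W_def)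
        have "hdist H (comb (l @ m)) (x \<oplus>\<^bsub>H\<^esub> y) < e"
          using dadd[OF comb_in[OF l(1)] comb_in[OF m(1)] Wc[OF x] Wc[OF y]] l m
          by (simp add: comb_app)
        then show ?thesis using comb_app(2)[OF l(1) m(1)] by blast
      qed
      then show ?thesis using Wc x y by (simp add: W_def)
    qed
    show "a \<odot>\<^bsub>H\<^esub> x \<in> W" if x: "x \<in> W" for x a
    proof -
      have "\<exists>m\<in>L. hdist H (comb m) (a \<odot>\<^bsub>H\<^esub> x) < e" if e: "e > 0" for e
      proof -
        have ca: "cmod a + 1 > 0" by (simp add: add_nonneg_pos)
        obtain l where l: "l \<in> L" "hdist H (comb l) x < e / (cmod a + 1)"
          using x divide_pos_pos[OF e ca] by (auto simp only: W_def)
        have "cmod a * hdist H (comb l) x \<le> (cmod a + 1) * hdist H (comb l) x"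
          by (intro mult_right_mono) auto
        also have "\<dots> < e" using l ca by (simp add: pos_less_divide_eq mult.commute)
        finally show ?thesis using comb_sm[OF l(1), of a] dsm[OF comb_in[OF l(1)] Wc[OF x], of a] by force
      qed
      then show ?thesis using Wc[OF x] by (simp add: W_def)
    qed
    show "x \<in> W" if x: "x \<in> carrier H" and cl: "\<And>e. e > 0 \<Longrightarrow> \<exists>y\<in>W. hdist H y x < e" for x
    proof -
      have "\<exists>m\<in>L. hdist H (comb m) x < e" if e: "e > 0" for e
      proof -
        obtain y where y: "y \<in> W" "hdist H y x < e / 2" using cl[OF half_gt_zero[OF e]] by blast
        obtain l where l: "l \<in> L" "hdist H (comb l) y < e / 2" using y(1) half_gt_zero[OF e] by (auto simp only: W_def)
        have "hdist H (comb l) x < e"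
          using HM.triangle[OF comb_in[OF l(1)] Wc[OF y(1)] x] l y by linarith
        then show ?thesis using l by blast
      qed
      then show ?thesis using x by (simp add: W_def)
    qed
  qed
  have vW: "v \<in> W"
    using comb_W[of "[(\<one>\<^bsub>G\<^esub>, 1)]"] v by (simp add: comb_Nil comb_Cons L_def one)
  let ?\<rho> = "\<lambda>g. \<lambda>x\<in>enc ` W. enc (\<pi> g (T.dec x))"
  have UK: "unitary_rep G T.K ?\<rho>" by (rule T.unitary_K[OF U W_p])
  have ninv: "\<forall>w\<in>carrier T.K. (\<forall>g\<in>carrier G. ?\<rho> g w = w) \<longrightarrow> w = \<zero>\<^bsub>T.K\<^esub>"
  proof (intro ballI impI)
    fix w assume w: "w \<in> carrier T.K" and fix': "\<forall>g\<in>carrier G. ?\<rho> g w = w"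
    obtain x where x: "x \<in> W" "w = enc x" using w by (auto simp: T.K_simps)
    have "\<pi> g x = x" if g: "g \<in> carrier G" for g
    proof -
      have "enc (\<pi> g x) = enc x" using fix' g x by auto
      then show ?thesis using T.inj x W_p[OF g] by (meson inj_onD)
    qed
    then have "x = \<zero>\<^bsub>H\<^esub>" using noinv Wc[OF x(1)] by blast
    then show "w = \<zero>\<^bsub>T.K\<^esub>" using x by (simp add: T.K_simps)
  qed
  have ev: "enc v \<in> carrier T.K" using vW by (simp add: T.K_simps)
  have "enc v \<noteq> \<zero>\<^bsub>T.K\<^esub>" using v0 vW T.inj T.W_zero by (auto simp: T.K_simps dest: inj_onD)
  then obtain s where s: "s \<in> S" "hnorm T.K (?\<rho> s (enc v) \<ominus>\<^bsub>T.K\<^esub> enc v) > \<epsilon> * hnorm T.K (enc v)"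
    using kp UK ninv ev unfolding kazhdan_pair_def by blast
  have "\<pi> s v \<in> W" using s SG W_p vW by blast
  then have "hnorm H (\<pi> s v \<ominus>\<^bsub>H\<^esub> v) > \<epsilon> * hnorm H v"
    using s vW by (simp add: T.K_norm T.K_minus)
  then show "\<exists>s\<in>S. \<epsilon> * hnorm H v < hnorm H (\<pi> s v \<ominus>\<^bsub>H\<^esub> v)" using s by blast
qed

end

theory Submission
  imports Defs
begin

text \<open>
  Sort the indices \<open>a < n\<close> into nine classes by their residue modulo 9, and let \<open>G\<close> have generators
  \<open>x\<^sub>a\<close> and relators \<open>x\<^sub>a\<^sup>p\<close>; \<open>[x\<^sub>a, x\<^sub>b]\<close> for \<open>a\<close>, \<open>b\<close> in one class; and \<open>[[x\<^sub>a, x\<^sub>b], x\<^sub>c]\<close> for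
  \<open>a\<close>, \<open>b\<close> in different classes and \<open>c\<close> in the class of \<open>a\<close>. Each class generates a finite
  elementary abelian \<open>p\<close>-group \<open>B\<^sub>i\<close>, and the commutators between \<open>B\<^sub>i\<close> and \<open>B\<^sub>j\<close> commute with both.

  \<^bold>\<open>Property (T).\<close> In a unitary representation let \<open>P\<^sub>i\<close> be the orthogonal projection onto the
  complement of the \<open>B\<^sub>i\<close>-invariant vectors, and \<open>\<Delta> = \<Sum>\<^sub>i P\<^sub>i\<close>. In an irreducible representation of
  the class-two group generated by \<open>B\<^sub>i\<close> and \<open>B\<^sub>j\<close> in which these do not commute, the spaces of
  \<open>B\<^sub>i\<close>- and \<open>B\<^sub>j\<close>-invariant vectors meet at an angle of cosine at most \<open>1 / \<surd>p\<close>; where they do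
  commute, so do the projections. Either way \<open>P\<^sub>i P\<^sub>j + P\<^sub>j P\<^sub>i \<ge> - (P\<^sub>i + P\<^sub>j) / \<surd>p\<close>. This is lemma
  \<open>drift_angle\<close>; its proof replaces irreducible representations by splitting off, one commutator \<open>z\<close>
  at a time, the \<open>z\<close>-invariant vectors. Summing over all pairs gives
  \<open>\<Delta>\<^sup>2 \<ge> (1 - 8 / \<surd>p) \<Delta>\<close>, and \<open>8 / \<surd>p < 1\<close> is exactly \<open>p > 64\<close>. So \<open>\<Delta>\<close> has a spectral gap at 0
  (\<open>projections_gap\<close>), its kernel consists of the \<open>G\<close>-invariant vectors, and the finite set
  \<open>\<Union>\<^sub>i B\<^sub>i\<close> is a Kazhdan set (\<open>property_T_from_small_angles\<close>).

  \<^bold>\<open>Golod-Shafarevich condition.\<close> The relators have degrees at least \<open>p\<close>, 2 and 3, because the Magnus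
  embedding turns \<open>x\<^sup>p - 1\<close> into a \<open>p\<close>-th power and \<open>[u, v] - 1\<close> into a multiple of
  \<open>u v - v u = (u - 1) (v - 1) - (v - 1) (u - 1)\<close>.
  A class has at most \<open>(n + 8) / 9\<close> elements, which bounds the numbers of relators of each kind, and
  \<open>t = 1.62 / n\<close> then makes the Golod-Shafarevich polynomial negative for \<open>n \<ge> 99\<close>
  (\<open>golod_shafarevich_inequality\<close>).

  \<^bold>\<open>Number of generators.\<close> The \<open>n\<close> generators have dense image in the pro-\<open>p\<close> completion. Conversely all
  relators die in \<open>(\<int> / p)\<^sup>n\<close>, a discrete quotient of the completion that needs \<open>n\<close> generators (\<open>d_p_eq\<close>).
\<close>

section \<open>Conjugation and centralizers\<close>

text \<open>
  As \<open>z\<close> commutes with both, conjugating \<open>y\<^sup>j\<close> by the powers of \<open>x\<close> moves it through the translates of \<open>y\<^sup>j\<close>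
  by the powers of \<open>z\<^sup>j\<close>. When \<open>z\<close> has prime order not dividing \<open>j\<close>, the latter are all the powers of
  \<open>z\<close>. In a representation without \<open>z\<close>-invariant vectors this makes the translates of an \<open>x\<close>-invariant vector by
  powers of \<open>y\<close> orthogonal.
\<close>

lemma (in group) conj_pow_central:
  assumes xyz: "x \<in> carrier G" "y \<in> carrier G" "z \<in> carrier G"
    and comm: "x \<otimes> z = z \<otimes> x" "y \<otimes> z = z \<otimes> y" and rel: "inv x \<otimes> y \<otimes> x = y \<otimes> z"
  shows "inv (x [^] k) \<otimes> y [^] (j::nat) \<otimes> x [^] (k::nat) = y [^] j \<otimes> z [^] (j * k)"
proof -
  have cancel: "x \<otimes> (inv x \<otimes> t) = t" if "t \<in> carrier G" for t
    using xyz that by (simp add: m_assoc[symmetric])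
  have zy: "z [^] m \<otimes> y = y \<otimes> z [^] m" and zx: "z [^] m \<otimes> x = x \<otimes> z [^] m" for m :: nat
    using group_commutes_pow[OF comm(2)[symmetric] xyz(3,2)] group_commutes_pow[OF comm(1)[symmetric] xyz(3,1)]
    by auto
  have one: "inv x \<otimes> y [^] j \<otimes> x = y [^] j \<otimes> z [^] j"
  proof (induction j)
    case (Suc j)
    have "inv x \<otimes> y [^] Suc j \<otimes> x = (inv x \<otimes> y [^] j \<otimes> x) \<otimes> (inv x \<otimes> y \<otimes> x)"
      using xyz by (simp add: m_assoc cancel)
    also have "\<dots> = y [^] j \<otimes> (z [^] j \<otimes> y) \<otimes> z" unfolding Suc rel using xyz by (simp add: m_assoc)
    also have "\<dots> = y [^] Suc j \<otimes> z [^] Suc j" unfolding zy using xyz by (simp add: m_assoc)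
    finally show ?case .
  qed (use xyz in simp)
  show ?thesis
  proof (induction k)
    case (Suc k)
    have "inv (x [^] Suc k) \<otimes> y [^] j \<otimes> x [^] Suc k = inv x \<otimes> (inv (x [^] k) \<otimes> y [^] j \<otimes> x [^] k) \<otimes> x"
      using xyz by (simp add: m_assoc inv_mult_group)
    also have "\<dots> = inv x \<otimes> y [^] j \<otimes> (z [^] (j * k) \<otimes> x)" unfolding Suc using xyz by (simp add: m_assoc)
    also have "\<dots> = (inv x \<otimes> y [^] j \<otimes> x) \<otimes> z [^] (j * k)" unfolding zx using xyz by (simp add: m_assoc)
    also have "\<dots> = y [^] j \<otimes> z [^] (j * Suc k)" unfolding one using xyz by (simp add: m_assoc nat_pow_mult)
    finally show ?case .
  qed (use xyz in simp)
qed

lemma (in group) subgroup_centralizer: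
  assumes z: "z \<in> carrier G" shows "subgroup {g \<in> carrier G. g \<otimes> z = z \<otimes> g} G"
proof (rule subgroupI)
  fix g assume "g \<in> {g \<in> carrier G. g \<otimes> z = z \<otimes> g}"
  then have g: "g \<in> carrier G" "g \<otimes> z = z \<otimes> g" by auto
  have "inv g \<otimes> z = inv g \<otimes> (z \<otimes> g) \<otimes> inv g" using g(1) z by (simp add: m_assoc)
  also have "\<dots> = z \<otimes> inv g" unfolding g(2)[symmetric] using g(1) z by (simp add: m_assoc[symmetric])
  finally show "inv g \<in> {g \<in> carrier G. g \<otimes> z = z \<otimes> g}" using g by simp
next
  fix g h assume "g \<in> {g \<in> carrier G. g \<otimes> z = z \<otimes> g}" "h \<in> {g \<in> carrier G. g \<otimes> z = z \<otimes> g}"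
  then have gh: "g \<in> carrier G" "h \<in> carrier G" "g \<otimes> z = z \<otimes> g" "h \<otimes> z = z \<otimes> h" by auto
  have "g \<otimes> h \<otimes> z = g \<otimes> (h \<otimes> z)" using gh(1,2) z by (simp add: m_assoc)
  also have "\<dots> = (g \<otimes> z) \<otimes> h" unfolding gh(4) using gh(1,2) z by (simp add: m_assoc)
  also have "\<dots> = z \<otimes> (g \<otimes> h)" unfolding gh(3) using gh(1,2) z by (simp add: m_assoc)
  finally show "g \<otimes> h \<in> {g \<in> carrier G. g \<otimes> z = z \<otimes> g}" using gh by simp
qed (use z in auto)

section \<open>Orthogonal projections\<close>

context complex_hilbert
begin

text \<open>
  Angles, projections and norms only see the real part of the inner product.
\<close>

definition ip :: "'h \<Rightarrow> 'h \<Rightarrow> real" where "ip x y = Re (cinner H x y)"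

lemma ip_add_left: "\<lbrakk>x \<in> carrier H; y \<in> carrier H; z \<in> carrier H\<rbrakk> \<Longrightarrow> ip (x \<oplus> y) z = ip x z + ip y z"
  by (simp add: ip_def cinner_add)

lemma ip_add_right: "\<lbrakk>x \<in> carrier H; y \<in> carrier H; z \<in> carrier H\<rbrakk> \<Longrightarrow> ip z (x \<oplus> y) = ip z x + ip z y"
  by (simp add: ip_def cinner_add_right)

lemma ip_scale_left: "\<lbrakk>x \<in> carrier H; y \<in> carrier H\<rbrakk> \<Longrightarrow> ip (complex_of_real a \<odot> x) y = a * ip x y"
  by (simp add: ip_def cinner_smult)

lemma ip_scale_right: "\<lbrakk>x \<in> carrier H; y \<in> carrier H\<rbrakk> \<Longrightarrow> ip y (complex_of_real a \<odot> x) = a * ip y x"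
  by (simp add: ip_def cinner_smult_right)

lemma ip_neg: "\<lbrakk>x \<in> carrier H; y \<in> carrier H\<rbrakk> \<Longrightarrow> ip ((-1) \<odot> x) y = - ip x y"
    "\<lbrakk>x \<in> carrier H; y \<in> carrier H\<rbrakk> \<Longrightarrow> ip y ((-1) \<odot> x) = - ip y x"
  by (simp_all add: ip_def cinner_smult cinner_smult_right)

lemma ip_minus_left: "\<lbrakk>x \<in> carrier H; y \<in> carrier H; z \<in> carrier H\<rbrakk> \<Longrightarrow> ip (x \<ominus> y) z = ip x z - ip y z"
  by (simp add: minus_smult ip_add_left ip_neg)

lemma ip_minus_right: "\<lbrakk>x \<in> carrier H; y \<in> carrier H; z \<in> carrier H\<rbrakk> \<Longrightarrow> ip z (x \<ominus> y) = ip z x - ip z y"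
  by (simp add: minus_smult ip_add_right ip_neg)

lemmas ip_simps = ip_add_left ip_add_right ip_scale_left ip_scale_right ip_minus_left ip_minus_right

lemma ip_commute: "\<lbrakk>x \<in> carrier H; y \<in> carrier H\<rbrakk> \<Longrightarrow> ip x y = ip y x"
  by (simp add: ip_def cinner_commute[of x y])

lemma ip_nonneg [simp]: "x \<in> carrier H \<Longrightarrow> 0 \<le> ip x x"
  by (simp add: ip_def cinner_self_ge)

lemma hnorm_eq_sqrt_ip: "hnorm H x = sqrt (ip x x)" by (simp add: hnorm_def ip_def)

lemma hnorm_square: "x \<in> carrier H \<Longrightarrow> (hnorm H x)\<^sup>2 = ip x x"
  by (simp add: hnorm_eq_sqrt_ip)

lemma ip_self_eq_0: "x \<in> carrier H \<Longrightarrow> ip x x = 0 \<longleftrightarrow> x = \<zero>"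
  using hnorm_eq_0[of x] by (simp add: hnorm_eq_sqrt_ip)

lemma ip_zero [simp]: "y \<in> carrier H \<Longrightarrow> ip \<zero> y = 0" "y \<in> carrier H \<Longrightarrow> ip y \<zero> = 0"
  using ip_commute[of y \<zero>] by (simp_all add: ip_def)

lemma minus_eq_zero_iff: "\<lbrakk>x \<in> carrier H; y \<in> carrier H\<rbrakk> \<Longrightarrow> x \<ominus> y = \<zero> \<longleftrightarrow> x = y"
  by (metis M.minus_equality M.minus_minus M.a_inv_closed a_minus_def M.r_neg)

lemma ip_eqI:
  assumes "x \<in> carrier H" "y \<in> carrier H" "\<And>z. z \<in> carrier H \<Longrightarrow> ip x z = ip y z"
  shows "x = y"
proof -
  have "ip (x \<ominus> y) (x \<ominus> y) = 0" using assms(3)[of "x \<ominus> y"] assms(1,2) by (simp add: ip_minus_left)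
  then have "x \<ominus> y = \<zero>" using assms ip_self_eq_0[of "x \<ominus> y"] by simp
  then show ?thesis using assms by (simp add: minus_eq_zero_iff)
qed

lemma ip_finsum_left:
  assumes "finite I" "f \<in> I \<rightarrow> carrier H" "y \<in> carrier H"
  shows "ip (finsum H f I) y = (\<Sum>i\<in>I. ip (f i) y)"
  using assms by (induction I) (auto simp: ip_add_left Pi_iff)

lemma ip_finsum_right:
  assumes "finite I" "f \<in> I \<rightarrow> carrier H" "y \<in> carrier H"
  shows "ip y (finsum H f I) = (\<Sum>i\<in>I. ip y (f i))"
  using assms by (induction I) (auto simp: ip_add_right Pi_iff)

lemma ip_twice_le: "\<lbrakk>x \<in> carrier H; y \<in> carrier H\<rbrakk> \<Longrightarrow> 2 * ip x y \<le> ip x x + ip y y"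
  using ip_nonneg[of "x \<ominus> y"] ip_commute[of x y] by (simp add: ip_simps)

text \<open>
  Symmetry forces linearity, as the inner product separates points.
\<close>

definition orth_proj :: "('h \<Rightarrow> 'h) \<Rightarrow> bool" where
  "orth_proj E \<longleftrightarrow> E \<in> carrier H \<rightarrow> carrier H \<and>
     (\<forall>x\<in>carrier H. \<forall>y\<in>carrier H. ip (E x) y = ip x (E y)) \<and> (\<forall>x\<in>carrier H. E (E x) = E x)"

lemma orth_projD:
  assumes "orth_proj E"
  shows orth_proj_closed: "x \<in> carrier H \<Longrightarrow> E x \<in> carrier H"
    and orth_proj_sym: "\<lbrakk>x \<in> carrier H; y \<in> carrier H\<rbrakk> \<Longrightarrow> ip (E x) y = ip x (E y)"
    and orth_proj_idem: "x \<in> carrier H \<Longrightarrow> E (E x) = E x"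
    and orth_proj_self: "x \<in> carrier H \<Longrightarrow> ip (E x) (E x) = ip (E x) x"
  using assms unfolding orth_proj_def by (auto simp: Pi_iff)

lemma orth_proj_complement:
  assumes "orth_proj E" shows "orth_proj (\<lambda>x. x \<ominus> E x)"
proof -
  note E = orth_projD[OF assms]
  have lin: "E (x \<ominus> E x) = \<zero>" if "x \<in> carrier H" for x
    using that by (intro ip_eqI) (auto simp: E ip_minus_left)
  have idem: "x \<ominus> E x \<ominus> E (x \<ominus> E x) = x \<ominus> E x" if "x \<in> carrier H" for x
    unfolding lin[OF that] using that E by (intro ip_eqI) (auto simp: ip_minus_left)
  have sym: "ip (x \<ominus> E x) y = ip x (y \<ominus> E y)" if "x \<in> carrier H" "y \<in> carrier H" for x y
    using that by (simp add: E ip_minus_left ip_minus_right)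
  show ?thesis unfolding orth_proj_def
    using idem sym by (auto intro: E)
qed

lemma orth_proj_add:
  assumes "orth_proj E" "x \<in> carrier H" "y \<in> carrier H" shows "E (x \<oplus> y) = E x \<oplus> E y"
  using assms(2,3) orth_projD[OF assms(1)] by (intro ip_eqI) (auto simp: ip_add_left)

lemma orth_proj_minus:
  assumes "orth_proj E" "x \<in> carrier H" "y \<in> carrier H" shows "E (x \<ominus> y) = E x \<ominus> E y"
  using assms(2,3) orth_projD[OF assms(1)] by (intro ip_eqI) (auto simp: ip_minus_left)

lemma orth_proj_scale:
  assumes "orth_proj E" "x \<in> carrier H" shows "E (complex_of_real a \<odot> x) = complex_of_real a \<odot> E x"
  using assms(2) orth_projD[OF assms(1)] by (intro ip_eqI) (auto simp: ip_scale_left)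

lemma orth_proj_zero: "orth_proj E \<Longrightarrow> E \<zero> = \<zero>"
  by (intro ip_eqI) (auto simp: orth_proj_closed orth_proj_sym)

lemma orth_proj_le:
  assumes "orth_proj E" "x \<in> carrier H" shows "ip (E x) (E x) \<le> ip x x"
  using orth_proj_closed[OF assms] orth_proj_self[OF assms] ip_nonneg[of "x \<ominus> E x"] assms(2)
    ip_commute[of x "E x"]
  by (simp add: ip_simps)

text \<open>
  Two subspaces at an angle of cosine \<open>\<epsilon>\<close> have complements whose projections \<open>P\<close>, \<open>Q\<close> satisfy
  \<open>P Q + Q P \<ge> - \<epsilon> (P + Q)\<close>: on the plane spanned by \<open>E v\<close> and \<open>F v\<close> the eigenvalues of \<open>P + Q\<close> are
  \<open>1 \<plusminus> \<epsilon>\<close>. The inequality is linear in the squared norm of \<open>v\<close>, so it suffices to bound that norm from below.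
\<close>

lemma complementary_projections_angle:
  assumes E: "orth_proj E" and F: "orth_proj F" and v: "v \<in> carrier H" and \<epsilon>: "0 \<le> \<epsilon>" "\<epsilon> \<le> 1"
    and angle: "2 * ip (E v) (F v) \<le> \<epsilon> * (ip (E v) (E v) + ip (F v) (F v))"
  shows "- \<epsilon> * (ip (v \<ominus> E v) (v \<ominus> E v) + ip (v \<ominus> F v) (v \<ominus> F v)) \<le> 2 * ip (v \<ominus> E v) (v \<ominus> F v)"
proof -
  define N A B g where "N = ip v v" and "A = ip (E v) (E v)" and "B = ip (F v) (F v)" and "g = ip (E v) (F v)"
  note cl = v orth_proj_closed[OF E v] orth_proj_closed[OF F v]
  have A': "ip v (E v) = A" "ip (E v) v = A" and B': "ip v (F v) = B" "ip (F v) v = B"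
    using cl orth_proj_self[OF E v] orth_proj_self[OF F v] ip_commute[of v "E v"] ip_commute[of v "F v"]
    by (auto simp: A_def B_def)
  have g': "ip (F v) (E v) = g" using cl ip_commute by (simp add: g_def)
  have ang: "2 * g \<le> \<epsilon> * (A + B)" using angle by (simp add: g_def A_def B_def)
  define c where "c = 1 / (1 + \<epsilon>)"
  have c: "c * (1 + \<epsilon>) = 1" using \<epsilon> by (simp add: c_def)
  \<comment> \<open>The vector \<open>E v + F v\<close> is the extremal direction; \<open>c\<close> is the coefficient of the projection of \<open>v\<close>
    onto it when the two subspaces meet exactly at the angle \<open>\<epsilon>\<close>.\<close>
  have "0 \<le> ip (v \<ominus> complex_of_real c \<odot> (E v \<oplus> F v)) (v \<ominus> complex_of_real c \<odot> (E v \<oplus> F v))"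
    using cl by simp
  also have "\<dots> = N - 2 * c * (A + B) + c\<^sup>2 * (A + B + 2 * g)"
    using cl by (simp add: ip_simps A' B' g' flip: N_def A_def B_def g_def) (simp add: algebra_simps power2_eq_square)
  finally have "0 \<le> (1 + \<epsilon>)\<^sup>2 * (N - 2 * c * (A + B) + c\<^sup>2 * (A + B + 2 * g))" by simp
  also have "\<dots> = (1 + \<epsilon>)\<^sup>2 * N - 2 * (c * (1 + \<epsilon>)) * (1 + \<epsilon>) * (A + B) + (c * (1 + \<epsilon>))\<^sup>2 * (A + B + 2 * g)"
    by (simp add: algebra_simps power2_eq_square)
  finally have N: "0 \<le> (1 + \<epsilon>)\<^sup>2 * N - 2 * (1 + \<epsilon>) * (A + B) + (A + B + 2 * g)" by (simp add: c)
  have "0 \<le> (1 - \<epsilon>) * (\<epsilon> * (A + B) - 2 * g)" using ang \<epsilon> by simp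
  with N have "0 \<le> (1 + \<epsilon>) * (2 * (N - A - B + g) + \<epsilon> * (2 * N - A - B))"
    by (simp add: algebra_simps power2_eq_square)
  then have "0 \<le> 2 * (N - A - B + g) + \<epsilon> * (2 * N - A - B)"
    using \<epsilon> by (simp add: zero_le_mult_iff)
  moreover have "ip (v \<ominus> E v) (v \<ominus> F v) = N - A - B + g" "ip (v \<ominus> E v) (v \<ominus> E v) = N - A"
    "ip (v \<ominus> F v) (v \<ominus> F v) = N - B"
    using cl by (simp_all add: ip_simps A' B' g' flip: N_def A_def B_def g_def)
  ultimately show ?thesis by (simp only:) (simp add: algebra_simps)
qed

end

lemma (in Metric_space) geometric_steps_converge:
  assumes "mcomplete" and s: "\<And>k. s k \<in> M" and step: "\<And>k. d (s k) (s (Suc k)) \<le> C * \<rho> ^ k"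
    and \<rho>: "0 \<le> \<rho>" "\<rho> < 1"
  obtains u where "u \<in> M" "(\<lambda>k. d (s k) u) \<longlonglongrightarrow> 0" "d (s 0) u \<le> C / (1 - \<rho>)"
proof -
  have C: "0 \<le> C" using order_trans[OF nonneg step[of 0]] by simp
  have tail: "d (s k) (s (k + j)) \<le> C * \<rho> ^ k * ((1 - \<rho> ^ j) / (1 - \<rho>))" for k j
  proof (induction j)
    case 0
    then show ?case using s by simp
  next
    case (Suc j)
    have "d (s k) (s (k + Suc j)) \<le> d (s k) (s (k + j)) + d (s (k + j)) (s (Suc (k + j)))"
      using triangle[OF s s s] by simp
    also have "\<dots> \<le> C * \<rho> ^ k * ((1 - \<rho> ^ j) / (1 - \<rho>)) + C * \<rho> ^ (k + j)"
      by (intro add_mono Suc step)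
    also have "\<dots> = C * \<rho> ^ k * ((1 - \<rho> ^ Suc j) / (1 - \<rho>))"
      using \<rho> by (simp add: field_simps power_add)
    finally show ?case .
  qed
  have tail': "d (s k) (s l) \<le> C / (1 - \<rho>) * \<rho> ^ k" if "k \<le> l" for k l
  proof -
    have "d (s k) (s l) \<le> C * \<rho> ^ k * ((1 - \<rho> ^ (l - k)) / (1 - \<rho>))" using tail[of k "l - k"] that by simp
    also have "\<dots> \<le> C * \<rho> ^ k * (1 / (1 - \<rho>))"
      using C \<rho> by (intro mult_left_mono divide_right_mono) auto
    finally show ?thesis by simp
  qed
  have lim0: "(\<lambda>k. C / (1 - \<rho>) * \<rho> ^ k) \<longlonglongrightarrow> 0"
    using \<rho> by (intro tendsto_mult_right_zero LIMSEQ_realpow_zero) auto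
  have "MCauchy s" unfolding MCauchy_def
  proof (intro conjI allI impI)
    fix e :: real assume e: "e > 0"
    obtain N where N: "\<And>k. k \<ge> N \<Longrightarrow> C / (1 - \<rho>) * \<rho> ^ k < e"
      using order_tendstoD(2)[OF lim0 e] unfolding eventually_sequentially by blast
    have "d (s k) (s l) < e" if "N \<le> k" "N \<le> l" for k l
    proof (cases "k \<le> l")
      case True
      then show ?thesis using tail'[of k l] N[of k] that by linarith
    next
      case False
      then show ?thesis using tail'[of l k] N[of l] that commute[of "s k" "s l"] by linarith
    qed
    then show "\<exists>N. \<forall>k l. N \<le> k \<longrightarrow> N \<le> l \<longrightarrow> d (s k) (s l) < e" by blast
  qed (use s in auto)
  then obtain u where "limitin mtopology s u sequentially" using assms(1) by (auto simp: mcomplete_def)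
  then have u: "u \<in> M" and lu: "\<And>e. e > 0 \<Longrightarrow> \<exists>N. \<forall>n\<ge>N. d (s n) u < e"
    unfolding limit_metric_sequentially by blast+
  have lim: "(\<lambda>k. d (s k) u) \<longlonglongrightarrow> 0"
    unfolding LIMSEQ_iff using lu by (simp add: real_norm_def)
  have "d (s 0) u \<le> C / (1 - \<rho>)"
  proof (rule LIMSEQ_le_const)
    show "(\<lambda>k. C / (1 - \<rho>) + d (s k) u) \<longlonglongrightarrow> C / (1 - \<rho>)"
      using tendsto_add[OF tendsto_const lim, of "C / (1 - \<rho>)"] by simp
    have "d (s 0) u \<le> C / (1 - \<rho>) + d (s k) u" for k
      using triangle[OF s[of 0] s[of k] u] tail'[of 0 k] by simp
    then show "\<exists>N. \<forall>n\<ge>N. d (s 0) u \<le> C / (1 - \<rho>) + d (s n) u" by blast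
  qed
  then show ?thesis using that u lim by blast
qed

context complex_hilbert
begin

text \<open>
  Write \<open>D\<close> for the sum of the \<open>m\<close> projections and \<open>f v = \<langle>D v, v\<rangle>\<close>. Expanding the square of \<open>D\<close> and using the
  pairwise bound gives \<open>D\<^sup>2 \<ge> c D\<close> with \<open>c = 1 - (m - 1) \<epsilon>\<close>. Instead of the spectral theorem, iterate
  \<open>v \<mapsto> v - D v / m\<close>: each step multiplies \<open>f\<close> by at most \<open>\<rho>\<^sup>2 = 1 - c / m\<close> and has length at most the
  square root of \<open>f\<close>. The iterates converge geometrically to a vector killed by all the projections, and the
  sum of the step lengths bounds its distance from \<open>v\<close>.
\<close>

lemma projections_gap:
  assumes I: "finite I" "I \<noteq> {}" and P: "\<And>i. i \<in> I \<Longrightarrow> orth_proj (P i)"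
    and \<epsilon>: "0 \<le> \<epsilon>" "(real (card I) - 1) * \<epsilon> < 1"
    and pair: "\<And>i j v. \<lbrakk>i \<in> I; j \<in> I; i \<noteq> j; v \<in> carrier H\<rbrakk> \<Longrightarrow>
      - \<epsilon> * (ip (P i v) (P i v) + ip (P j v) (P j v)) \<le> 2 * ip (P i v) (P j v)"
    and v: "v \<in> carrier H"
  defines "\<rho> \<equiv> sqrt (1 - (1 - (real (card I) - 1) * \<epsilon>) / real (card I))"
  obtains u where "u \<in> carrier H" "\<And>i. i \<in> I \<Longrightarrow> P i u = \<zero>"
    "hnorm H (v \<ominus> u) \<le> sqrt (\<Sum>i\<in>I. ip (P i v) (P i v)) / (1 - \<rho>)"
proof -
  define m where "m = real (card I)"
  have m: "m \<ge> 1" using I by (simp add: m_def Suc_le_eq card_gt_0_iff)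
  define c where "c = 1 - (m - 1) * \<epsilon>"
  have c: "0 < c" "c \<le> 1" using \<epsilon> m by (auto simp: c_def m_def)
  have \<rho>_eq: "\<rho> = sqrt (1 - c / m)" by (simp add: \<rho>_def c_def m_def)
  have cm: "0 < c / m" "c / m \<le> 1" using c m by auto
  have \<rho>: "0 \<le> \<rho>" "\<rho> < 1" "\<rho>\<^sup>2 = 1 - c / m"
    unfolding \<rho>_eq using cm by auto
  note Pc = orth_proj_closed[OF P]
  define f where "f w = (\<Sum>i\<in>I. ip (P i w) (P i w))" for w
  define D where "D w = finsum H (\<lambda>i. P i w) I" for w
  have Dc [simp]: "D w \<in> carrier H" if "w \<in> carrier H" for w
    unfolding D_def using Pc that by (intro M.finsum_closed) auto
  have ipD: "ip (D w) y = (\<Sum>i\<in>I. ip (P i w) y)" if "w \<in> carrier H" "y \<in> carrier H" for w y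
    unfolding D_def using Pc that I by (intro ip_finsum_left) auto
  have ipDD: "ip (D w) (D w) = (\<Sum>i\<in>I. \<Sum>j\<in>I. ip (P i w) (P j w))" if "w \<in> carrier H" for w
    unfolding ipD[OF that Dc[OF that]] using Pc that I
    by (intro sum.cong refl) (auto simp: D_def ip_finsum_right Pi_iff)
  have f0: "0 \<le> f w" if "w \<in> carrier H" for w unfolding f_def using Pc that by (intro sum_nonneg) auto
  have lower: "c * f w \<le> ip (D w) (D w)" if w: "w \<in> carrier H" for w
  proof -
    define a where "a i = ip (P i w) (P i w)" for i
    have "(\<Sum>i\<in>I. \<Sum>j\<in>I. a i + a j) = 2 * m * f w"
      by (simp add: sum.distrib f_def m_def sum_distrib_left[symmetric] flip: a_def)
    then have s1: "(\<Sum>i\<in>I. \<Sum>j\<in>I. - \<epsilon> / 2 * (a i + a j)) = - \<epsilon> * m * f w"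
      by (simp only: sum_distrib_left[symmetric])
    have "(\<Sum>i\<in>I. \<Sum>j\<in>I. if i = j then (1 + \<epsilon>) * a i else 0) = (1 + \<epsilon>) * f w"
      using I by (simp add: f_def sum_distrib_left flip: a_def)
    with s1 have "c * f w = (\<Sum>i\<in>I. \<Sum>j\<in>I. - \<epsilon> / 2 * (a i + a j) + (if i = j then (1 + \<epsilon>) * a i else 0))"
      unfolding sum.distrib by (simp add: c_def algebra_simps)
    also have "\<dots> \<le> (\<Sum>i\<in>I. \<Sum>j\<in>I. ip (P i w) (P j w))"
    proof (intro sum_mono)
      fix i j assume "i \<in> I" "j \<in> I"
      then show "- \<epsilon> / 2 * (a i + a j) + (if i = j then (1 + \<epsilon>) * a i else 0) \<le> ip (P i w) (P j w)"
        using pair[of i j w] w by (auto simp: a_def algebra_simps)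
    qed
    finally show ?thesis using ipDD[OF w] by simp
  qed
  have upper: "ip (D w) (D w) \<le> m * f w" if w: "w \<in> carrier H" for w
  proof -
    define a where "a i = ip (P i w) (P i w)" for i
    have "(\<Sum>i\<in>I. \<Sum>j\<in>I. ip (P i w) (P j w)) \<le> (\<Sum>i\<in>I. \<Sum>j\<in>I. (a i + a j) / 2)"
    proof (intro sum_mono)
      fix i j assume "i \<in> I" "j \<in> I"
      then show "ip (P i w) (P j w) \<le> (a i + a j) / 2"
        using ip_twice_le[OF Pc[of i w] Pc[of j w]] w by (simp add: a_def)
    qed
    also have "\<dots> = m * f w"
      by (simp add: sum.distrib f_def m_def sum_distrib_left[symmetric] sum_divide_distrib[symmetric]
        flip: a_def)
    finally show ?thesis using ipDD[OF w] by simp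
  qed
  have fle: "f w \<le> m * ip w w" if w: "w \<in> carrier H" for w
    unfolding f_def m_def using sum_bounded_above[of I "\<lambda>i. ip (P i w) (P i w)" "ip w w"]
      orth_proj_le[OF P w] by auto
  define T where "T w = w \<ominus> complex_of_real (1 / m) \<odot> D w" for w
  have Tc [simp]: "T w \<in> carrier H" if "w \<in> carrier H" for w using that by (simp add: T_def)
  have fT: "f (T w) \<le> \<rho>\<^sup>2 * f w" if w: "w \<in> carrier H" for w
  proof -
    have "ip (P i (T w)) (P i (T w)) =
        ip (P i w) (P i w) - 2 / m * ip (P i w) (D w) + 1 / m\<^sup>2 * ip (P i (D w)) (P i (D w))"
      if i: "i \<in> I" for i
    proof -
      note cl = w Dc[OF w] Pc[OF i w] Pc[OF i Dc[OF w]]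
      have "P i (T w) = P i w \<ominus> complex_of_real (1 / m) \<odot> P i (D w)"
        unfolding T_def orth_proj_minus[OF P[OF i] w smult_cl[OF Dc[OF w]]] orth_proj_scale[OF P[OF i] Dc[OF w]] ..
      moreover have "ip (P i w) (P i (D w)) = ip (P i w) (D w)"
        using orth_proj_sym[OF P[OF i], of "P i w" "D w"] orth_proj_idem[OF P[OF i] w] cl by simp
      ultimately show ?thesis
        using cl ip_commute[of "P i (D w)" "P i w"]
        by (simp only: ip_simps smult_cl M.minus_closed) (simp add: diff_divide_distrib power2_eq_square)
    qed
    then have "f (T w) = f w - 2 / m * ip (D w) (D w) + 1 / m\<^sup>2 * f (D w)"
      using ipD[OF w Dc[OF w]] unfolding f_def by (simp add: sum.distrib sum_subtractf sum_distrib_left)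
    also have "\<dots> \<le> f w - 2 / m * ip (D w) (D w) + 1 / m\<^sup>2 * (m * ip (D w) (D w))"
      using fle[OF Dc[OF w]] m by (intro add_left_mono mult_left_mono) auto
    also have "\<dots> = f w - 1 / m * ip (D w) (D w)" using m by (simp add: field_simps power2_eq_square)
    also have "\<dots> \<le> f w - 1 / m * (c * f w)"
      using lower[OF w] m by (intro diff_left_mono mult_left_mono) auto
    also have "\<dots> = \<rho>\<^sup>2 * f w" by (simp add: \<rho>(3) algebra_simps)
    finally show ?thesis .
  qed
  have step: "hdist H w (T w) \<le> sqrt (f w)" if w: "w \<in> carrier H" for w
  proof -
    have "w \<ominus> T w = complex_of_real (1 / m) \<odot> D w"
      using w unfolding T_def by (intro ip_eqI) (auto simp: ip_simps)
    then have "hdist H w (T w) = 1 / m * sqrt (ip (D w) (D w))"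
      using w m hnorm_smult[OF Dc[OF w], of "complex_of_real (1 / m)"] by (simp add: hdist_eq hnorm_eq_sqrt_ip norm_divide)
    also have "\<dots> \<le> 1 / m * sqrt (m * f w)"
      using upper[OF w] m by (intro mult_left_mono) auto
    also have "\<dots> \<le> 1 / m * (m * sqrt (f w))"
    proof (intro mult_left_mono)
      have "sqrt m \<le> m" using m by (smt (verit) real_sqrt_le_iff real_sqrt_pow2 power2_eq_square real_le_lsqrt mult_le_cancel_left1)
      then show "sqrt (m * f w) \<le> m * sqrt (f w)" using f0[OF w] by (simp add: real_sqrt_mult mult_right_mono)
    qed (use m in auto)
    also have "\<dots> = sqrt (f w)" using m by simp
    finally show ?thesis .
  qed
  define s where "s k = (T ^^ k) v" for k
  have sc [simp]: "s k \<in> carrier H" for k unfolding s_def using v by (induction k) auto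
  have s_Suc: "s (Suc k) = T (s k)" for k by (simp add: s_def)
  have fs: "sqrt (f (s k)) \<le> sqrt (f v) * \<rho> ^ k" for k
  proof (induction k)
    case (Suc k)
    have "sqrt (f (s (Suc k))) \<le> sqrt (\<rho>\<^sup>2 * f (s k))" using fT[of "s k"] by (simp add: s_Suc)
    also have "\<dots> = \<rho> * sqrt (f (s k))" using \<rho>(1) by (simp add: real_sqrt_mult)
    also have "\<dots> \<le> \<rho> * (sqrt (f v) * \<rho> ^ k)" using Suc \<rho> by (intro mult_left_mono)
    finally show ?case by (simp add: algebra_simps)
  qed (simp add: s_def)
  have "hdist H (s k) (s (Suc k)) \<le> sqrt (f v) * \<rho> ^ k" for k
    using step[of "s k"] fs[of k] by (simp add: s_Suc)
  then obtain u where u: "u \<in> carrier H" and lim: "(\<lambda>k. hdist H (s k) u) \<longlonglongrightarrow> 0"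
    and du: "hdist H (s 0) u \<le> sqrt (f v) / (1 - \<rho>)"
    using HM.geometric_steps_converge[OF complete, of s, OF sc _ \<rho>(1,2)] by metis
  have "P i u = \<zero>" if i: "i \<in> I" for i
  proof -
    have "hnorm H (P i u) \<le> hdist H (s k) u + sqrt (f v) * \<rho> ^ k" for k
    proof -
      have "P i u = P i (u \<ominus> s k) \<oplus> P i (s k)"
        using u Pc[OF i] unfolding orth_proj_minus[OF P[OF i] u sc] by (intro ip_eqI) (auto simp: ip_simps)
      then have "hnorm H (P i u) \<le> hnorm H (P i (u \<ominus> s k)) + hnorm H (P i (s k))"
        using hnorm_triangle[of "P i (u \<ominus> s k)" "P i (s k)"] u Pc[OF i] by simp
      also have "hnorm H (P i (u \<ominus> s k)) \<le> hdist H (s k) u"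
        using u orth_proj_le[OF P[OF i], of "u \<ominus> s k"] hnorm_minus_commute[OF sc[of k] u]
          by (simp add: hdist_eq) (simp add: hnorm_eq_sqrt_ip)
      also have "hnorm H (P i (s k)) \<le> sqrt (f (s k))"
        unfolding f_def hnorm_eq_sqrt_ip using i I Pc
          member_le_sum[of i I "\<lambda>i. ip (P i (s k)) (P i (s k))"] by (simp add: ip_nonneg)
      also have "\<dots> \<le> sqrt (f v) * \<rho> ^ k" by (rule fs)
      finally show ?thesis by simp
    qed
    moreover have "(\<lambda>k. hdist H (s k) u + sqrt (f v) * \<rho> ^ k) \<longlonglongrightarrow> 0 + sqrt (f v) * 0"
      using \<rho> lim by (intro tendsto_intros LIMSEQ_realpow_zero) auto
    ultimately have "hnorm H (P i u) \<le> 0 + sqrt (f v) * 0" by (intro LIMSEQ_le_const) auto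
    then show ?thesis using hnorm_nonneg[OF Pc[OF i u]] hnorm_eq_0[OF Pc[OF i u]] by linarith
  qed
  then show ?thesis using that u du v by (auto simp: f_def s_def hdist_eq)
qed

end

section \<open>Unitary representations and property (T)\<close>

locale unitary_representation =
  fixes G :: "'g monoid" and H :: "'h inner_module" (structure) and \<pi> :: "'g \<Rightarrow> 'h \<Rightarrow> 'h"
  assumes unitary: "unitary_rep G H \<pi>"
begin

sublocale complex_hilbert H using unitary by (simp add: unitary_rep_def)
sublocale act: group_action G "carrier H" \<pi> using unitary by (simp add: unitary_rep_def)
sublocale G: group G using act.group_hom by (simp add: group_hom_def)

lemma rep_closed [simp]: "\<lbrakk>g \<in> carrier G; x \<in> carrier H\<rbrakk> \<Longrightarrow> \<pi> g x \<in> carrier H"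
  using act.element_image by blast

lemma rep_mult: "\<lbrakk>g \<in> carrier G; h \<in> carrier G; x \<in> carrier H\<rbrakk> \<Longrightarrow> \<pi> (g \<otimes>\<^bsub>G\<^esub> h) x = \<pi> g (\<pi> h x)"
  using act.composition_rule[of x g h] by simp

lemma rep_one [simp]: "x \<in> carrier H \<Longrightarrow> \<pi> \<one>\<^bsub>G\<^esub> x = x"
  using act.id_eq_one by (metis restrict_apply')

lemma ip_rep: "\<lbrakk>g \<in> carrier G; x \<in> carrier H; y \<in> carrier H\<rbrakk> \<Longrightarrow> ip (\<pi> g x) (\<pi> g y) = ip x y"
  using unitary by (simp add: unitary_rep_def ip_def)

lemma rep_inv: "\<lbrakk>g \<in> carrier G; x \<in> carrier H\<rbrakk> \<Longrightarrow> \<pi> g (\<pi> (inv\<^bsub>G\<^esub> g) x) = x"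
  by (simp flip: rep_mult)

lemma ip_rep_left: "\<lbrakk>g \<in> carrier G; x \<in> carrier H; y \<in> carrier H\<rbrakk> \<Longrightarrow> ip (\<pi> g x) y = ip x (\<pi> (inv\<^bsub>G\<^esub> g) y)"
  using ip_rep[of g x "\<pi> (inv\<^bsub>G\<^esub> g) y"] by (simp add: rep_inv)

definition avg :: "'g set \<Rightarrow> 'h \<Rightarrow> 'h" where
  "avg A v = complex_of_real (1 / real (card A)) \<odot> finsum H (\<lambda>x. \<pi> x v) A"

lemma avg_closed [simp]: "\<lbrakk>A \<subseteq> carrier G; v \<in> carrier H\<rbrakk> \<Longrightarrow> avg A v \<in> carrier H"
  unfolding avg_def by (intro smult_cl M.finsum_closed) auto

lemma ip_avg:
  assumes "finite A" "A \<subseteq> carrier G" "v \<in> carrier H" "w \<in> carrier H"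
  shows "ip (avg A v) w = (\<Sum>x\<in>A. ip (\<pi> x v) w) / real (card A)"
proof -
  have c: "(\<lambda>x. \<pi> x v) \<in> A \<rightarrow> carrier H" using assms by auto
  show ?thesis unfolding avg_def ip_scale_left[OF M.finsum_closed[OF c] assms(4)]
    ip_finsum_left[OF assms(1) c assms(4)] by simp
qed

lemma rep_avg:
  assumes A: "subgroup A G" "finite A" and x: "x \<in> A" and v: "v \<in> carrier H"
  shows "\<pi> x (avg A v) = avg A v"
proof (rule ip_eqI)
  interpret subgroup A G by fact
  have xG: "x \<in> carrier G" using x by auto
  show "\<pi> x (avg A v) \<in> carrier H" "avg A v \<in> carrier H" using xG v subset by auto
  fix w assume w: "w \<in> carrier H"
  have "ip (\<pi> x (avg A v)) w = ip (avg A v) (\<pi> (inv\<^bsub>G\<^esub> x) w)"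
    using xG v w subset by (intro ip_rep_left) auto
  also have "\<dots> = (\<Sum>y\<in>A. ip (\<pi> y v) (\<pi> (inv\<^bsub>G\<^esub> x) w)) / real (card A)"
    using A xG v w subset by (intro ip_avg) auto
  also have "(\<Sum>y\<in>A. ip (\<pi> y v) (\<pi> (inv\<^bsub>G\<^esub> x) w)) = (\<Sum>y\<in>A. ip (\<pi> (x \<otimes>\<^bsub>G\<^esub> y) v) w)"
    using xG v w by (intro sum.cong refl) (simp add: rep_mult ip_rep_left[of x])
  also have "\<dots> = (\<Sum>y\<in>A. ip (\<pi> y v) w)"
  proof (rule sum.reindex_bij_witness[where i = "\<lambda>y. inv\<^bsub>G\<^esub> x \<otimes>\<^bsub>G\<^esub> y" and j = "\<lambda>y. x \<otimes>\<^bsub>G\<^esub> y"])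
  qed (use x xG in \<open>auto simp: G.m_assoc[symmetric]\<close>)
  also have "\<dots> / real (card A) = ip (avg A v) w" using A v w subset by (simp add: ip_avg)
  finally show "ip (\<pi> x (avg A v)) w = ip (avg A v) w" .
qed

lemma avg_fixed:
  assumes "finite A" "A \<noteq> {}" "A \<subseteq> carrier G" "v \<in> carrier H" "\<And>x. x \<in> A \<Longrightarrow> \<pi> x v = v"
  shows "avg A v = v"
  using assms by (intro ip_eqI) (auto simp: ip_avg)

lemma orth_proj_avg:
  assumes A: "subgroup A G" "finite A" shows "orth_proj (avg A)"
  unfolding orth_proj_def
proof (intro conjI ballI)
  interpret subgroup A G by fact
  show "avg A \<in> carrier H \<rightarrow> carrier H" using subset by auto
  fix v assume v: "v \<in> carrier H"
  show "avg A (avg A v) = avg A v"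
    using A v subset rep_avg[OF A _ v] subgroup_nonempty by (intro avg_fixed) auto
  fix w assume w: "w \<in> carrier H"
  have "(\<Sum>x\<in>A. ip (\<pi> x v) w) = (\<Sum>x\<in>A. ip v (\<pi> (inv\<^bsub>G\<^esub> x) w))"
    using v w subset by (intro sum.cong refl ip_rep_left) auto
  also have "\<dots> = (\<Sum>x\<in>A. ip v (\<pi> x w))"
    by (rule sum.reindex_bij_witness[where i = "m_inv G" and j = "m_inv G"]) auto
  also have "\<dots> = (\<Sum>x\<in>A. ip (\<pi> x w) v)"
    using v w subset by (intro sum.cong refl ip_commute) auto
  finally show "ip (avg A v) w = ip v (avg A w)"
    using A v w subset ip_commute[of v "avg A w"] by (simp add: ip_avg)
qed

lemma avg_avg_commute:
  assumes A: "finite A" "A \<subseteq> carrier G" and B: "finite B" "B \<subseteq> carrier G" and v: "v \<in> carrier H"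
    and comm: "\<And>x y. \<lbrakk>x \<in> A; y \<in> B\<rbrakk> \<Longrightarrow> \<pi> x (\<pi> y v) = \<pi> y (\<pi> x v)"
  shows "avg A (avg B v) = avg B (avg A v)"
proof (rule ip_eqI)
  have expand: "ip (avg A (avg B v)) w = (\<Sum>x\<in>A. \<Sum>y\<in>B. ip (\<pi> x (\<pi> y v)) w) / (real (card B) * real (card A))"
    if A: "finite A" "A \<subseteq> carrier G" and B: "finite B" "B \<subseteq> carrier G" and w: "w \<in> carrier H" for A B w
  proof -
    have "ip (\<pi> x (avg B v)) w = (\<Sum>y\<in>B. ip (\<pi> x (\<pi> y v)) w) / real (card B)" if x: "x \<in> A" for x
    proof -
      have xG: "x \<in> carrier G" using A x by auto
      have "ip (\<pi> x (avg B v)) w = (\<Sum>y\<in>B. ip (\<pi> y v) (\<pi> (inv\<^bsub>G\<^esub> x) w)) / real (card B)"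
        using xG w v B by (simp add: ip_rep_left ip_avg)
      also have "(\<Sum>y\<in>B. ip (\<pi> y v) (\<pi> (inv\<^bsub>G\<^esub> x) w)) = (\<Sum>y\<in>B. ip (\<pi> x (\<pi> y v)) w)"
        using xG w v B by (intro sum.cong refl ip_rep_left[symmetric]) auto
      finally show ?thesis .
    qed
    then show ?thesis using A B v w by (simp add: ip_avg sum_divide_distrib[symmetric])
  qed
  fix w assume w: "w \<in> carrier H"
  have "(\<Sum>x\<in>A. \<Sum>y\<in>B. ip (\<pi> x (\<pi> y v)) w) = (\<Sum>x\<in>A. \<Sum>y\<in>B. ip (\<pi> y (\<pi> x v)) w)"
    by (intro sum.cong refl) (metis comm)
  also have "\<dots> = (\<Sum>y\<in>B. \<Sum>x\<in>A. ip (\<pi> y (\<pi> x v)) w)" by (rule sum.swap)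
  finally show "ip (avg A (avg B v)) w = ip (avg B (avg A v)) w"
    using A B w by (simp add: expand mult.commute)
qed (use assms in auto)

lemma avg_rep_commute:
  assumes A: "finite A" "A \<subseteq> carrier G" and v: "v \<in> carrier H" and g: "g \<in> carrier G"
    and comm: "\<And>x. x \<in> A \<Longrightarrow> g \<otimes>\<^bsub>G\<^esub> x = x \<otimes>\<^bsub>G\<^esub> g"
  shows "avg A (\<pi> g v) = \<pi> g (avg A v)"
proof -
  have [simp]: "avg {g} w = \<pi> g w" if "w \<in> carrier H" for w
    using that g by (intro ip_eqI) (auto simp: ip_avg)
  have "avg A (avg {g} v) = avg {g} (avg A v)"
    using assms by (intro avg_avg_commute) (auto simp: comm simp flip: rep_mult)
  then show ?thesis using A v by simp
qed

text \<open>
  Conjugating \<open>d\<close> by elements that fix \<open>a\<close> does not change the matrix coefficient of \<open>d\<close> at \<open>a\<close>. If the conjugates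
  include the whole coset \<open>d C\<close>, the coefficient is its own mean over that coset, which is a coefficient
  of the vanishing vector \<open>avg C a\<close>.
\<close>

lemma ip_translate_eq_0:
  assumes A: "A \<subseteq> carrier G" and C: "finite C" "C \<subseteq> carrier G" "C \<noteq> {}" and d: "d \<in> carrier G"
    and a: "a \<in> carrier H" and inv: "\<And>x. x \<in> A \<Longrightarrow> \<pi> x a = a" and zero: "avg C a = \<zero>"
    and conj: "\<And>c. c \<in> C \<Longrightarrow> \<exists>x\<in>A. inv\<^bsub>G\<^esub> x \<otimes>\<^bsub>G\<^esub> d \<otimes>\<^bsub>G\<^esub> x = d \<otimes>\<^bsub>G\<^esub> c"
  shows "ip (\<pi> d a) a = 0"
proof -
  have eq: "ip (\<pi> c a) (\<pi> (inv\<^bsub>G\<^esub> d) a) = ip (\<pi> d a) a" if c: "c \<in> C" for c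
  proof -
    obtain x where x: "x \<in> A" "inv\<^bsub>G\<^esub> x \<otimes>\<^bsub>G\<^esub> d \<otimes>\<^bsub>G\<^esub> x = d \<otimes>\<^bsub>G\<^esub> c" using conj[OF c] by blast
    have G: "x \<in> carrier G" "c \<in> carrier G" using x A c C by auto
    have "ip (\<pi> c a) (\<pi> (inv\<^bsub>G\<^esub> d) a) = ip (\<pi> (d \<otimes>\<^bsub>G\<^esub> c) a) a"
      using d a G by (simp add: rep_mult ip_rep_left[of d])
    also have "\<dots> = ip (\<pi> d (\<pi> x a)) (\<pi> x a)"
      using d a G ip_rep_left[of "inv\<^bsub>G\<^esub> x" "\<pi> d (\<pi> x a)" a] by (simp add: x(2)[symmetric] rep_mult)
    finally show ?thesis using inv x by simp
  qed
  have "(\<Sum>c\<in>C. ip (\<pi> c a) (\<pi> (inv\<^bsub>G\<^esub> d) a)) = real (card C) * ip (avg C a) (\<pi> (inv\<^bsub>G\<^esub> d) a)"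
    using C d a by (simp add: ip_avg)
  then have "real (card C) * ip (\<pi> d a) a = 0" using eq zero d a by simp
  then show ?thesis using C by simp
qed

lemma avg_absorb:
  assumes B: "subgroup B G" "finite B" and D: "D \<subseteq> B" "D \<noteq> {}" and a: "a \<in> carrier H"
  shows "avg B (avg D a) = avg B a"
proof (rule ip_eqI)
  interpret B: subgroup B G by fact
  have fD: "finite D" "D \<subseteq> carrier G" using D B finite_subset B.subset by auto
  show "avg B (avg D a) \<in> carrier H" "avg B a \<in> carrier H" using fD a B.subset by auto
  fix w assume w: "w \<in> carrier H"
  have "ip (\<pi> d a) (avg B w) = ip a (avg B w)" if d: "d \<in> D" for d
    using rep_avg[OF B, of "inv\<^bsub>G\<^esub> d" w] d fD D a w B.subset by (subst ip_rep_left) auto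
  then have "ip (avg D a) (avg B w) = ip a (avg B w)"
    using fD a w D B.subset by (simp add: ip_avg)
  then show "ip (avg B (avg D a)) w = ip (avg B a) w"
    using orth_proj_sym[OF orth_proj_avg[OF B]] fD a w by simp
qed

text \<open>
  The projection onto the \<open>B\<close>-invariant vectors is at most as long as the one onto the \<open>D\<close>-invariant vectors, and
  the latter is the mean of \<open>card D\<close> orthogonal vectors of the length of \<open>a\<close>.
\<close>

lemma avg_orthogonal_translates:
  assumes B: "subgroup B G" "finite B" and D: "subgroup D G" "D \<subseteq> B" and a: "a \<in> carrier H"
    and orth: "\<And>d. \<lbrakk>d \<in> D; d \<noteq> \<one>\<^bsub>G\<^esub>\<rbrakk> \<Longrightarrow> ip (\<pi> d a) a = 0"
  shows "real (card D) * ip (avg B a) (avg B a) \<le> ip a a"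
proof -
  interpret D: subgroup D G by fact
  have fD: "finite D" using D B finite_subset by auto
  have cD: "card D > 0" using fD D.one_closed card_gt_0_iff by blast
  have "ip (avg B a) (avg B a) = ip (avg B (avg D a)) (avg B (avg D a))"
  proof -
    have "D \<noteq> {}" using D.one_closed by blast
    then show ?thesis using avg_absorb[OF B D(2) _ a] by simp
  qed
  also have "\<dots> \<le> ip (avg D a) (avg D a)"
    using a D.subset by (intro orth_proj_le orth_proj_avg B) auto
  also have "\<dots> = ip (avg D a) a"
    using orth_proj_self[OF orth_proj_avg[OF D(1) fD] a] .
  also have "\<dots> = (\<Sum>d\<in>D. ip (\<pi> d a) a) / real (card D)" using fD a D.subset by (simp add: ip_avg)
  also have "(\<Sum>d\<in>D. ip (\<pi> d a) a) = (\<Sum>d\<in>{\<one>\<^bsub>G\<^esub>}. ip (\<pi> d a) a)"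
    using orth by (intro sum.mono_neutral_right fD) (auto)
  finally show ?thesis using a cD by (simp add: field_simps)
qed

end

context unitary_representation
begin

text \<open>
  The projection onto the orthogonal complement of the \<open>A\<close>-invariant vectors, the \<open>P\<^sub>i\<close> of the introduction.
\<close>

definition drift :: "'g set \<Rightarrow> 'h \<Rightarrow> 'h" where "drift A v = v \<ominus> avg A v"

lemma
  assumes A: "subgroup A G" "finite A"
  shows orth_proj_drift: "orth_proj (drift A)"
    and drift_closed: "v \<in> carrier H \<Longrightarrow> drift A v \<in> carrier H"
  using orth_proj_complement[OF orth_proj_avg[OF A]] unfolding drift_def
  by (auto intro: orth_proj_closed)

text \<open>
  The part of the representation without \<open>z\<close>-invariant vectors, where \<open>z\<close> is the commutator of a single pair
  \<open>x \<in> A\<close>, \<open>y \<in> B\<close>. There the \<open>p\<close> translates of an \<open>A\<close>-invariant vector \<open>a\<close> by the powers of \<open>y\<close> are orthogonal, so the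
  projection of \<open>a\<close> onto the \<open>B\<close>-invariant vectors has at most \<open>1 / \<surd>p\<close> of its length.
\<close>

lemma drift_angle_moved:
  fixes p :: nat
  assumes A: "subgroup A G" "finite A" and B: "subgroup B G" "finite B"
    and p: "Factorial_Ring.prime p" and xA: "x \<in> A" and yB: "y \<in> B" and z: "z \<in> carrier G"
    and xp: "x [^]\<^bsub>G\<^esub> p = \<one>\<^bsub>G\<^esub>" and yp: "y [^]\<^bsub>G\<^esub> p = \<one>\<^bsub>G\<^esub>"
    and rel: "inv\<^bsub>G\<^esub> x \<otimes>\<^bsub>G\<^esub> y \<otimes>\<^bsub>G\<^esub> x = y \<otimes>\<^bsub>G\<^esub> z"
    and comm: "\<And>g. g \<in> A \<union> B \<Longrightarrow> g \<otimes>\<^bsub>G\<^esub> z = z \<otimes>\<^bsub>G\<^esub> g"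
    and u: "u \<in> carrier H" and zero: "avg (generate G {z}) u = \<zero>"
  shows "- (1 / sqrt p) * (ip (drift A u) (drift A u) + ip (drift B u) (drift B u)) \<le> 2 * ip (drift A u) (drift B u)"
proof -
  interpret A: subgroup A G by fact
  interpret B: subgroup B G by fact
  have xyG: "x \<in> carrier G" "y \<in> carrier G" using xA yB by auto
  have p0: "p > 0" "p > 1" using p prime_gt_1_nat prime_gt_0_nat by auto
  define a where "a = avg A u"
  have a: "a \<in> carrier H" using u A.subset by (simp add: a_def)
  have bc: "avg B a \<in> carrier H" "avg B u \<in> carrier H" using a u B.subset by auto
  have conj: "inv\<^bsub>G\<^esub> (x [^]\<^bsub>G\<^esub> k) \<otimes>\<^bsub>G\<^esub> y [^]\<^bsub>G\<^esub> j \<otimes>\<^bsub>G\<^esub> x [^]\<^bsub>G\<^esub> k = y [^]\<^bsub>G\<^esub> j \<otimes>\<^bsub>G\<^esub> z [^]\<^bsub>G\<^esub> (j * k)" for j k :: nat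
    using G.conj_pow_central[OF xyG z _ _ rel] comm xA yB by auto
  have zp: "z [^]\<^bsub>G\<^esub> p = \<one>\<^bsub>G\<^esub>"
    using conj[of p 1] xyG z xp by simp
  have key: "real p * ip (avg B a) (avg B a) \<le> ip a a"
  proof (cases "z = \<one>\<^bsub>G\<^esub>")
    case True
    have "avg (generate G {z}) u = u"
      unfolding True G.generate_one using u by (intro avg_fixed) auto
    then have "u = \<zero>" using zero by simp
    then have "a = \<zero>" using orth_proj_zero[OF orth_proj_avg[OF A]] by (simp add: a_def)
    then have "ip (avg B a) (avg B a) \<le> 0" using orth_proj_le[OF orth_proj_avg[OF B] a] by simp
    then show ?thesis using a p0 by (smt (verit) ip_nonneg bc(1) mult_nonneg_nonpos of_nat_0_le_iff)
  next
    case False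
    then have y1: "y \<noteq> \<one>\<^bsub>G\<^esub>" using rel xyG z by auto
    have ord: "G.ord w = p" if w: "w \<in> carrier G" "w \<noteq> \<one>\<^bsub>G\<^esub>" "w [^]\<^bsub>G\<^esub> p = \<one>\<^bsub>G\<^esub>" for w
      using w p G.pow_eq_id[of w p] G.ord_eq_1[of w] by (auto simp: prime_nat_iff)
    have gen: "generate G {w} = {w [^]\<^bsub>G\<^esub> k | k. k \<in> (UNIV :: nat set)}" "finite (generate G {w})" "card (generate G {w}) = p"
      if w: "w \<in> carrier G" "w \<noteq> \<one>\<^bsub>G\<^esub>" "w [^]\<^bsub>G\<^esub> p = \<one>\<^bsub>G\<^esub>" for w
    proof -
      show "generate G {w} = {w [^]\<^bsub>G\<^esub> k | k. k \<in> (UNIV :: nat set)}"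
        using ord[OF w] p0 w by (intro G.generate_pow_nat) auto
      show "card (generate G {w}) = p" using ord[OF w] G.generate_pow_card[of w] w by simp
      then show "finite (generate G {w})" using p0 card_ge_0_finite by metis
    qed
    note gz = gen[OF z False zp] and gy = gen[OF xyG(2) y1 yp]
    let ?C = "generate G {z}" and ?D = "generate G {y}"
    have subD: "subgroup ?D G" "?D \<subseteq> B" and subC: "subgroup ?C G"
      using G.generate_is_subgroup[of "{y}"] G.generate_is_subgroup[of "{z}"]
        G.generate_subgroup_incl[OF _ B(1), of "{y}"] xyG z yB by simp_all
    have "avg ?C (avg A u) = avg A (avg ?C u)"
    proof (rule avg_avg_commute)
      fix c g assume c: "c \<in> ?C" and g: "g \<in> A"
      then obtain k :: nat where k: "c = z [^]\<^bsub>G\<^esub> k" using gz by blast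
      have "c \<otimes>\<^bsub>G\<^esub> g = g \<otimes>\<^bsub>G\<^esub> c" unfolding k
        by (rule G.group_commutes_pow) (use comm[of g] g z in auto)
      then show "\<pi> c (\<pi> g u) = \<pi> g (\<pi> c u)" using k g u z by (simp flip: rep_mult)
    qed (use A A.subset subC gz u subgroup.subset[OF subC] in auto)
    then have Ca: "avg ?C a = \<zero>"
      using zero orth_proj_zero[OF orth_proj_avg[OF A]] by (simp add: a_def)
    have "real (card ?D) * ip (avg B a) (avg B a) \<le> ip a a"
    proof (rule avg_orthogonal_translates[OF B subD a])
      fix d assume d: "d \<in> ?D" "d \<noteq> \<one>\<^bsub>G\<^esub>"
      then obtain j :: nat where j: "d = y [^]\<^bsub>G\<^esub> j" using gy by blast
      have "\<not> p dvd j" using d j xyG G.pow_eq_id[of y j] ord[OF xyG(2) y1 yp] by auto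
      then have "coprime j p" using p by (metis coprime_commute prime_imp_coprime)
      then obtain j' where j': "[j * j' = 1] (mod p)" using cong_solve_coprime_nat unfolding One_nat_def by blast
      show "ip (\<pi> d a) a = 0"
      proof (rule ip_translate_eq_0[where A = A and C = ?C])
        fix c assume "c \<in> ?C"
        then obtain k :: nat where k: "c = z [^]\<^bsub>G\<^esub> k" using gz by blast
        have "[j * (j' * k) = k] (mod p)" using cong_scalar_right[OF j', of k] by (simp add: mult.assoc)
        moreover have "z [^]\<^bsub>G\<^esub> i = z [^]\<^bsub>G\<^esub> (i mod p)" for i :: nat
        proof -
          have "z [^]\<^bsub>G\<^esub> i = (z [^]\<^bsub>G\<^esub> p) [^]\<^bsub>G\<^esub> (i div p) \<otimes>\<^bsub>G\<^esub> z [^]\<^bsub>G\<^esub> (i mod p)"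
            unfolding G.nat_pow_pow[OF z] G.nat_pow_mult[OF z] by simp
          then show ?thesis using z zp by simp
        qed
        ultimately have "z [^]\<^bsub>G\<^esub> (j * (j' * k)) = c" unfolding k cong_def by metis
        then have "inv\<^bsub>G\<^esub> (x [^]\<^bsub>G\<^esub> (j' * k)) \<otimes>\<^bsub>G\<^esub> d \<otimes>\<^bsub>G\<^esub> x [^]\<^bsub>G\<^esub> (j' * k) = d \<otimes>\<^bsub>G\<^esub> c"
          using conj[of "j' * k" j] j by simp
        moreover have "x [^]\<^bsub>G\<^esub> i \<in> A" for i :: nat using xA by (induction i) auto
        ultimately show "\<exists>x\<in>A. inv\<^bsub>G\<^esub> x \<otimes>\<^bsub>G\<^esub> d \<otimes>\<^bsub>G\<^esub> x = d \<otimes>\<^bsub>G\<^esub> c" by blast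
      qed (use A.subset gz a Ca subgroup.subset[OF subC] j xyG rep_avg[OF A _ u] p0 in \<open>auto simp: a_def\<close>)
    qed
    then show ?thesis using gy by simp
  qed
  \<comment> \<open>From here on, the bound on the projection of \<open>a = avg A u\<close> becomes the bound on the angle to \<open>avg B u\<close>,
    by the arithmetic-geometric mean inequality with weight \<open>q\<close>.\<close>
  define q where "q = 1 / sqrt p"
  have q: "0 < q" "q \<le> 1" "q\<^sup>2 * real p = 1" using p0 by (auto simp: q_def field_simps)
  have "ip a (avg B u) = ip (avg B a) (avg B u)"
    using orth_proj_sym[OF orth_proj_avg[OF B], of a "avg B u"] orth_proj_idem[OF orth_proj_avg[OF B] u] a bc by simp
  moreover have "0 \<le> ip (avg B a \<ominus> complex_of_real q \<odot> avg B u) (avg B a \<ominus> complex_of_real q \<odot> avg B u)"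
    using bc by simp
  moreover have "ip (avg B a \<ominus> complex_of_real q \<odot> avg B u) (avg B a \<ominus> complex_of_real q \<odot> avg B u) =
    ip (avg B a) (avg B a) - 2 * q * ip (avg B a) (avg B u) + q\<^sup>2 * ip (avg B u) (avg B u)"
    using bc ip_commute[OF bc(2,1)] by (simp add: ip_simps) (simp add: algebra_simps power2_eq_square)
  ultimately have "2 * q * ip a (avg B u) \<le> q\<^sup>2 * (real p * ip (avg B a) (avg B a)) + q\<^sup>2 * ip (avg B u) (avg B u)"
    using q(3) by (simp add: mult.assoc[symmetric])
  also have "\<dots> \<le> q\<^sup>2 * ip a a + q\<^sup>2 * ip (avg B u) (avg B u)"
    using key by (intro add_right_mono mult_left_mono) auto
  finally have "q * (2 * ip a (avg B u)) \<le> q * (q * (ip a a + ip (avg B u) (avg B u)))"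
    by (simp add: algebra_simps power2_eq_square)
  then have "2 * ip a (avg B u) \<le> q * (ip a a + ip (avg B u) (avg B u))" using q by simp
  then show ?thesis
    using complementary_projections_angle[OF orth_proj_avg[OF A] orth_proj_avg[OF B] u, of q] q
    by (simp add: drift_def a_def q_def)
qed

text \<open>
  For a commutator \<open>z\<close>, the mean over the group generated by \<open>z\<close> commutes with everything in \<open>A\<close> and \<open>B\<close>, so \<open>v\<close>
  splits into its \<open>z\<close>-invariant part and a part covered by the previous lemma, and all terms of the inequality
  split accordingly. Doing this for all pairs in turn leaves a vector fixed by every commutator, on which
  \<open>drift A\<close> and \<open>drift B\<close> commute and the right-hand side is twice a squared norm.
\<close>

lemma drift_angle:
  fixes p :: nat
  assumes A: "subgroup A G" "finite A" and B: "subgroup B G" "finite B"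
    and p: "Factorial_Ring.prime p"
    and expo: "\<And>g. g \<in> A \<union> B \<Longrightarrow> g [^]\<^bsub>G\<^esub> p = \<one>\<^bsub>G\<^esub>"
    and rel: "\<And>x y. \<lbrakk>x \<in> A; y \<in> B\<rbrakk> \<Longrightarrow> z x y \<in> carrier G"
      "\<And>x y. \<lbrakk>x \<in> A; y \<in> B\<rbrakk> \<Longrightarrow> inv\<^bsub>G\<^esub> x \<otimes>\<^bsub>G\<^esub> y \<otimes>\<^bsub>G\<^esub> x = y \<otimes>\<^bsub>G\<^esub> z x y"
    and comm: "\<And>x y g. \<lbrakk>x \<in> A; y \<in> B; g \<in> A \<union> B\<rbrakk> \<Longrightarrow> g \<otimes>\<^bsub>G\<^esub> z x y = z x y \<otimes>\<^bsub>G\<^esub> g"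
    and v: "v \<in> carrier H"
  shows "- (1 / sqrt p) * (ip (drift A v) (drift A v) + ip (drift B v) (drift B v)) \<le> 2 * ip (drift A v) (drift B v)"
proof -
  interpret A: subgroup A G by fact
  interpret B: subgroup B G by fact
  note EA = orth_proj_avg[OF A] and EB = orth_proj_avg[OF B]
  note PA = orth_proj_drift[OF A] and PB = orth_proj_drift[OF B]
  note PAc = drift_closed[OF A] and PBc = drift_closed[OF B]
  have p0: "p > 0" using p prime_gt_0_nat by auto
  define good where "good v \<longleftrightarrow>
    - (1 / sqrt p) * (ip (drift A v) (drift A v) + ip (drift B v) (drift B v)) \<le> 2 * ip (drift A v) (drift B v)" for v
  have "\<forall>v\<in>carrier H. (\<forall>(x, y)\<in>A \<times> B - S. \<pi> (z x y) v = v) \<longrightarrow> good v"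
    if "finite S" "S \<subseteq> A \<times> B" for S
    using that
  proof (induction S)
    case empty
    show ?case
    proof (intro ballI impI)
      fix v assume v: "v \<in> carrier H" and fixed: "\<forall>(x, y)\<in>A \<times> B - {}. \<pi> (z x y) v = v"
      have comm': "\<pi> x (\<pi> y v) = \<pi> y (\<pi> x v)" if xy: "x \<in> A" "y \<in> B" for x y
      proof -
        have G: "x \<in> carrier G" "y \<in> carrier G" "z x y \<in> carrier G" using xy rel by auto
        have "y \<otimes>\<^bsub>G\<^esub> x = x \<otimes>\<^bsub>G\<^esub> (inv\<^bsub>G\<^esub> x \<otimes>\<^bsub>G\<^esub> y \<otimes>\<^bsub>G\<^esub> x)"
          using G by (simp add: G.m_assoc[symmetric])
        also have "\<dots> = x \<otimes>\<^bsub>G\<^esub> (y \<otimes>\<^bsub>G\<^esub> z x y)" using rel(2)[OF xy] by simp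
        finally have "\<pi> (y \<otimes>\<^bsub>G\<^esub> x) v = \<pi> (x \<otimes>\<^bsub>G\<^esub> (y \<otimes>\<^bsub>G\<^esub> z x y)) v" by simp
        also have "\<dots> = \<pi> x (\<pi> y v)" using G v fixed xy by (simp add: rep_mult)
        finally show ?thesis using G v by (simp add: rep_mult)
      qed
      have AB: "avg A (avg B v) = avg B (avg A v)"
        using A B A.subset B.subset v comm' by (intro avg_avg_commute) auto
      have "drift A (drift B v) = drift B (drift A v)"
      proof (rule ip_eqI)
        fix w assume w: "w \<in> carrier H"
        have cl: "avg A v \<in> carrier H" "avg B v \<in> carrier H" "avg A (avg B v) \<in> carrier H" "avg B (avg A v) \<in> carrier H"
          using A.subset B.subset v by auto
        show "ip (drift A (drift B v)) w = ip (drift B (drift A v)) w"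
          unfolding drift_def orth_proj_minus[OF EA v cl(2)] orth_proj_minus[OF EB v cl(1)]
          using cl v w AB by (simp add: ip_minus_left)
      qed (use PAc PBc v in auto)
      then have "ip (drift A (drift B v)) (drift A (drift B v)) = ip (drift A (drift B v)) (drift B v)"
        using orth_proj_self[OF PA PBc[OF v]] by simp
      also have "\<dots> = ip (drift A v) (drift B v)"
        using \<open>drift A (drift B v) = drift B (drift A v)\<close> orth_proj_sym[OF PB PAc[OF v] PBc[OF v]]
          orth_proj_idem[OF PB v] by simp
      finally have "0 \<le> ip (drift A v) (drift B v)" using ip_nonneg[OF PAc[OF PBc[OF v]]] by simp
      moreover have "0 \<le> (1 / sqrt p) * (ip (drift A v) (drift A v) + ip (drift B v) (drift B v))"
        using PAc[OF v] PBc[OF v] by simp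
      ultimately show "good v" unfolding good_def by linarith
    qed
  next
    case (insert s S)
    obtain x y where s: "s = (x, y)" and xy: "x \<in> A" "y \<in> B" using insert by auto
    have G: "x \<in> carrier G" "y \<in> carrier G" "z x y \<in> carrier G" using xy rel by auto
    let ?C = "generate G {z x y}"
    have subC: "subgroup ?C G" using G by (intro G.generate_is_subgroup) auto
    have zc: "g \<otimes>\<^bsub>G\<^esub> z x y = z x y \<otimes>\<^bsub>G\<^esub> g" if "g \<in> A \<union> B" for g using comm[OF xy that] .
    have zp: "z x y [^]\<^bsub>G\<^esub> p = \<one>\<^bsub>G\<^esub>"
      using G.conj_pow_central[OF G zc zc rel(2)[OF xy], of p 1] xy G expo by simp
    have genC: "?C = {z x y [^]\<^bsub>G\<^esub> k | k. k \<in> (UNIV :: nat set)}" "finite ?C"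
    proof -
      have o: "G.ord (z x y) \<noteq> 0" using zp G G.pow_eq_id[of "z x y" p] p0 by auto
      then show "?C = {z x y [^]\<^bsub>G\<^esub> k | k. k \<in> (UNIV :: nat set)}" using G by (intro G.generate_pow_nat) auto
      show "finite ?C" using o G.generate_pow_card[OF G(3)] card_ge_0_finite by (metis gr0I)
    qed
    have Ccomm: "g \<otimes>\<^bsub>G\<^esub> c = c \<otimes>\<^bsub>G\<^esub> g" if g: "g \<in> carrier G" "g \<otimes>\<^bsub>G\<^esub> z x y = z x y \<otimes>\<^bsub>G\<^esub> g" and c: "c \<in> ?C" for g c
    proof -
      obtain k :: nat where k: "c = z x y [^]\<^bsub>G\<^esub> k" using c genC by blast
      show ?thesis unfolding k using g G by (intro G.group_commutes_pow[symmetric]) auto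
    qed
    note EC = orth_proj_avg[OF subC genC(2)]
    note Cs = subgroup.subset[OF subC]
    show ?case
    proof (intro ballI impI)
      fix v assume v: "v \<in> carrier H" and fixed: "\<forall>(x, y)\<in>A \<times> B - insert s S. \<pi> (z x y) v = v"
      define v1 where "v1 = avg ?C v"
      define v2 where "v2 = v \<ominus> avg ?C v"
      have v12: "v1 \<in> carrier H" "v2 \<in> carrier H" using v Cs by (auto simp: v1_def v2_def)
      have vsum: "v = v1 \<oplus> v2" using v12 v unfolding v1_def v2_def by (intro ip_eqI) (auto simp: ip_simps)
      have "\<pi> (z x' y') v1 = v1" if xy': "(x', y') \<in> A \<times> B - S" for x' y'
      proof (cases "(x', y') = s")
        case True
        then show ?thesis unfolding v1_def using rep_avg[OF subC genC(2) _ v] s by (simp add: generate.incl)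
      next
        case False
        have m: "x' \<in> A" "y' \<in> B" using xy' by auto
        have G': "x' \<in> carrier G" "y' \<in> carrier G" "z x' y' \<in> carrier G" using m rel by auto
        have zeq: "z x' y' = inv\<^bsub>G\<^esub> y' \<otimes>\<^bsub>G\<^esub> (inv\<^bsub>G\<^esub> x' \<otimes>\<^bsub>G\<^esub> y' \<otimes>\<^bsub>G\<^esub> x')"
          unfolding rel(2)[OF m] using G' by (simp add: G.m_assoc[symmetric])
        note Z = G.subgroup_centralizer[OF G(3)]
        have xz: "x' \<in> {g \<in> carrier G. g \<otimes>\<^bsub>G\<^esub> z x y = z x y \<otimes>\<^bsub>G\<^esub> g}" "y' \<in> {g \<in> carrier G. g \<otimes>\<^bsub>G\<^esub> z x y = z x y \<otimes>\<^bsub>G\<^esub> g}"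
          using zc m G' by blast+
        have "z x' y' \<in> {g \<in> carrier G. g \<otimes>\<^bsub>G\<^esub> z x y = z x y \<otimes>\<^bsub>G\<^esub> g}"
          unfolding zeq by (intro subgroup.m_closed[OF Z] subgroup.m_inv_closed[OF Z] xz)
        then have "z x' y' \<otimes>\<^bsub>G\<^esub> z x y = z x y \<otimes>\<^bsub>G\<^esub> z x' y'" by blast
        then have "avg ?C (\<pi> (z x' y') v) = \<pi> (z x' y') (avg ?C v)"
          using Ccomm[OF G'(3)] by (intro avg_rep_commute genC Cs v G')
        moreover have "\<pi> (z x' y') v = v" using fixed xy' False by auto
        ultimately show ?thesis by (simp add: v1_def)
      qed
      then have g1: "good v1" using insert v12 by auto
      have "avg ?C v2 = \<zero>"
        unfolding v2_def orth_proj_minus[OF EC v orth_proj_closed[OF EC v]] orth_proj_idem[OF EC v]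
        using orth_proj_closed[OF EC v] by (simp add: minus_eq_zero_iff)
      then have g2: "good v2" unfolding good_def
        using drift_angle_moved[OF A B p xy G(3) _ _ rel(2)[OF xy] zc v12(2)] expo xy by simp
      have PC: "avg ?C (drift D w) = drift D (avg ?C w)"
        if D: "subgroup D G" "finite D" "D \<subseteq> A \<union> B" and w: "w \<in> carrier H" for D w
      proof -
        have Dc: "D \<subseteq> carrier G" using D A.subset B.subset by auto
        have "avg ?C (avg D w) = avg D (avg ?C w)"
        proof (rule avg_avg_commute)
          fix c g assume "c \<in> ?C" and g: "g \<in> D"
          then have "g \<otimes>\<^bsub>G\<^esub> c = c \<otimes>\<^bsub>G\<^esub> g" using Ccomm[of g c] zc[of g] D Dc by auto
          then show "\<pi> c (\<pi> g w) = \<pi> g (\<pi> c w)" using w g \<open>c \<in> ?C\<close> Cs Dc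
            by (metis rep_mult subsetD)
        qed (use genC Cs D Dc w in auto)
        then show ?thesis unfolding drift_def using orth_proj_minus[OF EC w avg_closed[OF Dc w]] by simp
      qed
      have EC1: "avg ?C v1 = v1" using orth_proj_idem[OF EC v] by (simp add: v1_def)
      have cross: "ip (drift D v1) (drift D' v2) = 0"
        if D: "subgroup D G" "finite D" "D \<subseteq> A \<union> B" and D': "subgroup D' G" "finite D'" "D' \<subseteq> A \<union> B" for D D'
      proof -
        note cl = drift_closed[OF D(1,2) v12(1)] drift_closed[OF D'(1,2) v12(2)]
        have "ip (drift D v1) (drift D' v2) = ip (avg ?C (drift D v1)) (drift D' v2)"
          using PC[OF D v12(1)] EC1 by simp
        also have "\<dots> = ip (drift D v1) (avg ?C (drift D' v2))" using orth_proj_sym[OF EC] cl by simp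
        also have "avg ?C (drift D' v2) = drift D' \<zero>" using PC[OF D' v12(2)] \<open>avg ?C v2 = \<zero>\<close> by simp
        also have "drift D' \<zero> = \<zero>"
          by (rule orth_proj_zero[OF orth_proj_drift[OF D'(1,2)]])
        finally show ?thesis using cl by simp
      qed
      have add: "ip (drift D v) (drift D' v) = ip (drift D v1) (drift D' v1) + ip (drift D v2) (drift D' v2)"
        if D: "subgroup D G" "finite D" "D \<subseteq> A \<union> B" and D': "subgroup D' G" "finite D'" "D' \<subseteq> A \<union> B" for D D'
      proof -
        note cl = drift_closed[OF D(1,2) v12(1)] drift_closed[OF D(1,2) v12(2)]
          drift_closed[OF D'(1,2) v12(1)] drift_closed[OF D'(1,2) v12(2)]
        show ?thesis
          unfolding vsum orth_proj_add[OF orth_proj_drift[OF D(1,2)] v12] orth_proj_add[OF orth_proj_drift[OF D'(1,2)] v12]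
          using cl cross[OF D D'] cross[OF D' D] ip_commute[OF cl(2,3)] by (simp add: ip_simps)
      qed
      note addA = add[OF A Un_upper1 A Un_upper1] and addB = add[OF B Un_upper2 B Un_upper2]
        and addAB = add[OF A Un_upper1 B Un_upper2]
      show "good v" using g1 g2 unfolding good_def addA addB addAB by (simp add: algebra_simps)
    qed
  qed
  from this[of "A \<times> B"] have "good v" using A B v by auto
  then show ?thesis by (simp add: good_def)
qed

end

context unitary_representation
begin

lemma drift_norm_le:
  assumes A: "subgroup A G" "finite A" and v: "v \<in> carrier H"
    and small: "\<And>x. x \<in> A \<Longrightarrow> hnorm H (\<pi> x v \<ominus> v) \<le> \<kappa> * hnorm H v"
  shows "ip (drift A v) (drift A v) \<le> \<kappa>\<^sup>2 * ip v v"
proof -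
  interpret A: subgroup A G by fact
  have ne: "A \<noteq> {}" using A.one_closed by blast
  have cA: "real (card A) > 0" using A(2) A.one_closed card_gt_0_iff[of A] by (simp only: of_nat_0_less_iff) blast
  have each: "ip v v - ip (\<pi> x v) v \<le> \<kappa>\<^sup>2 * ip v v" if x: "x \<in> A" for x
  proof -
    have xG: "x \<in> carrier G" using x by auto
    have "2 * (ip v v - ip (\<pi> x v) v) = (hnorm H (\<pi> x v \<ominus> v))\<^sup>2"
      using xG v ip_commute[OF v rep_closed[OF xG v]] hnorm_square[of "\<pi> x v \<ominus> v"] by (simp add: ip_simps ip_rep)
    also have "\<dots> \<le> (\<kappa> * hnorm H v)\<^sup>2"
      using small[OF x] hnorm_nonneg[of "\<pi> x v \<ominus> v"] xG v by (intro power_mono) auto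
    also have "\<dots> = \<kappa>\<^sup>2 * ip v v" using v by (simp add: power_mult_distrib hnorm_square)
    also have "\<dots> \<le> 2 * (\<kappa>\<^sup>2 * ip v v)" using v by simp
    finally show ?thesis by simp
  qed
  have "ip (drift A v) (drift A v) = ip v v - ip (avg A v) v"
    using orth_proj_self[OF orth_proj_drift[OF A] v] A.subset v by (simp add: drift_def ip_minus_left)
  also have "\<dots> = (\<Sum>x\<in>A. ip v v - ip (\<pi> x v) v) / real (card A)"
    using cA ne A A.subset v by (simp add: ip_avg sum_subtractf diff_divide_distrib)
  also have "\<dots> \<le> (\<Sum>x\<in>A. \<kappa>\<^sup>2 * ip v v) / real (card A)"
    using cA each by (intro divide_right_mono sum_mono) auto
  also have "\<dots> = \<kappa>\<^sup>2 * ip v v" using cA by simp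
  finally show ?thesis .
qed

lemma drift_zero_fixed:
  assumes A: "subgroup A G" "finite A" and u: "u \<in> carrier H" "drift A u = \<zero>" and x: "x \<in> A"
  shows "\<pi> x u = u"
proof -
  have "u = avg A u" using u subgroup.subset[OF A(1)] by (simp add: drift_def minus_eq_zero_iff)
  then show ?thesis using rep_avg[OF A x u(1)] by simp
qed

lemma fixed_by_generators:
  assumes S: "S \<subseteq> carrier G" "generate G S = carrier G" and u: "u \<in> carrier H"
    and fixed: "\<And>s. s \<in> S \<Longrightarrow> \<pi> s u = u" and g: "g \<in> carrier G"
  shows "\<pi> g u = u"
proof -
  have "g \<in> generate G S" using g S by simp
  then show ?thesis
  proof (induction rule: generate.induct)
    case (inv s)
    then have "s \<in> carrier G" "\<pi> s u = u" using S fixed by auto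
    then show ?case using rep_mult[of "inv\<^bsub>G\<^esub> s" s u] u by simp
  next
    case (eng g h)
    then show ?case using u G.generate_in_carrier[OF S(1)] by (simp add: rep_mult)
  qed (use u fixed in auto)
qed

end

text \<open>
  A vector that every \<open>A i\<close> moves by at most \<open>\<kappa>\<close> times its norm has small drifts, hence lies close to a
  vector with zero drifts by \<open>projections_gap\<close>. The latter is fixed by the generators of \<open>G\<close>, so it vanishes. The
  constant \<open>\<kappa>\<close> is chosen to make the distance at most half of the norm.
\<close>

theorem property_T_from_small_angles:
  fixes G :: "'g monoid" and A :: "'i \<Rightarrow> 'g set" and p :: nat
  assumes I: "finite I" "I \<noteq> {}" and p: "Factorial_Ring.prime p" "(real (card I) - 1)\<^sup>2 < real p"
    and A: "\<And>i. i \<in> I \<Longrightarrow> subgroup (A i) G" "\<And>i. i \<in> I \<Longrightarrow> finite (A i)"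
    and gen: "generate G (\<Union>i\<in>I. A i) = carrier G"
    and expo: "\<And>i g. \<lbrakk>i \<in> I; g \<in> A i\<rbrakk> \<Longrightarrow> g [^]\<^bsub>G\<^esub> p = \<one>\<^bsub>G\<^esub>"
    and rel: "\<And>i j x y. \<lbrakk>i \<in> I; j \<in> I; i \<noteq> j; x \<in> A i; y \<in> A j\<rbrakk> \<Longrightarrow> z x y \<in> carrier G"
      "\<And>i j x y. \<lbrakk>i \<in> I; j \<in> I; i \<noteq> j; x \<in> A i; y \<in> A j\<rbrakk> \<Longrightarrow> inv\<^bsub>G\<^esub> x \<otimes>\<^bsub>G\<^esub> y \<otimes>\<^bsub>G\<^esub> x = y \<otimes>\<^bsub>G\<^esub> z x y"
    and comm: "\<And>i j x y g. \<lbrakk>i \<in> I; j \<in> I; i \<noteq> j; x \<in> A i; y \<in> A j; g \<in> A i \<union> A j\<rbrakk> \<Longrightarrow>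
      g \<otimes>\<^bsub>G\<^esub> z x y = z x y \<otimes>\<^bsub>G\<^esub> g"
  shows "property_T G"
proof -
  define \<epsilon> where "\<epsilon> = 1 / sqrt (real p)"
  define \<rho> where "\<rho> = sqrt (1 - (1 - (real (card I) - 1) * \<epsilon>) / real (card I))"
  define \<kappa> where "\<kappa> = (1 - \<rho>) / (2 * sqrt (real (card I)))"
  have p0: "p > 0" using p prime_gt_0_nat by auto
  have m: "real (card I) \<ge> 1" using I by (simp add: Suc_le_eq card_gt_0_iff)
  have "real (card I) - 1 < sqrt (real p)" using p(2) m by (intro real_less_rsqrt)
  then have \<epsilon>: "0 \<le> \<epsilon>" "(real (card I) - 1) * \<epsilon> < 1" using p0 by (auto simp: \<epsilon>_def field_simps)
  then have \<rho>: "\<rho> < 1" using m by (simp add: \<rho>_def)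
  then have \<kappa>: "\<kappa> > 0" using m by (auto simp: \<kappa>_def)
  let ?S = "\<Union>i\<in>I. A i"
  have SG: "?S \<subseteq> carrier G" using A subgroup.subset by blast
  have "kazhdan_pair TYPE(nat \<Rightarrow> ('g \<times> complex) list) G ?S \<kappa>"
    unfolding kazhdan_pair_def
  proof (intro allI impI ballI, elim conjE)
    fix H :: "(nat \<Rightarrow> ('g \<times> complex) list) inner_module" and \<pi> v
    assume U: "unitary_rep G H \<pi>"
      and noinv: "\<forall>v\<in>carrier H. (\<forall>g\<in>carrier G. \<pi> g v = v) \<longrightarrow> v = \<zero>\<^bsub>H\<^esub>"
      and v: "v \<in> carrier H" and v0: "v \<noteq> \<zero>\<^bsub>H\<^esub>"
    interpret unitary_representation G H \<pi> by unfold_locales (rule U)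
    show "\<exists>s\<in>?S. \<kappa> * hnorm H v < hnorm H (\<pi> s v \<ominus>\<^bsub>H\<^esub> v)"
    proof (rule ccontr)
      assume "\<not> ?thesis"
      then have small: "hnorm H (\<pi> x v \<ominus>\<^bsub>H\<^esub> v) \<le> \<kappa> * hnorm H v" if "i \<in> I" "x \<in> A i" for i x
        using that by force
      have pair: "- \<epsilon> * (ip (drift (A i) w) (drift (A i) w) + ip (drift (A j) w) (drift (A j) w)) \<le> 2 * ip (drift (A i) w) (drift (A j) w)"
        if ij: "i \<in> I" "j \<in> I" "i \<noteq> j" and w: "w \<in> carrier H" for i j w
        unfolding \<epsilon>_def
      proof (rule drift_angle[where z = z])
        show "g [^]\<^bsub>G\<^esub> p = \<one>\<^bsub>G\<^esub>" if "g \<in> A i \<union> A j" for g using that expo ij by blast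
        show "z x y \<in> carrier G" "inv\<^bsub>G\<^esub> x \<otimes>\<^bsub>G\<^esub> y \<otimes>\<^bsub>G\<^esub> x = y \<otimes>\<^bsub>G\<^esub> z x y" if "x \<in> A i" "y \<in> A j" for x y
          using rel[OF ij that] .
        show "g \<otimes>\<^bsub>G\<^esub> z x y = z x y \<otimes>\<^bsub>G\<^esub> g" if "x \<in> A i" "y \<in> A j" "g \<in> A i \<union> A j" for x y g
          using comm[OF ij that] .
      qed (use A ij p w in auto)
      have proj: "orth_proj (drift (A i))" if "i \<in> I" for i using orth_proj_drift A that by blast
      obtain u where u: "u \<in> carrier H" "\<And>i. i \<in> I \<Longrightarrow> drift (A i) u = \<zero>\<^bsub>H\<^esub>"
        and le: "hnorm H (v \<ominus>\<^bsub>H\<^esub> u) \<le> sqrt (\<Sum>i\<in>I. ip (drift (A i) v) (drift (A i) v)) / (1 - \<rho>)"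
        using projections_gap[where P = "\<lambda>i. drift (A i)", OF I proj \<epsilon> pair v, folded \<rho>_def] by blast
      have "\<pi> g u = u" if "g \<in> carrier G" for g
        using fixed_by_generators[OF SG gen u(1) _ that] drift_zero_fixed[OF A u(1) u(2)] by blast
      then have "u = \<zero>\<^bsub>H\<^esub>" using noinv u by blast
      then have "v \<ominus>\<^bsub>H\<^esub> u = v" using v by (intro ip_eqI) (auto simp: ip_minus_left)
      moreover have "(\<Sum>i\<in>I. ip (drift (A i) v) (drift (A i) v)) \<le> real (card I) * (\<kappa>\<^sup>2 * ip v v)"
        using drift_norm_le[OF A v small] by (intro sum_bounded_above) auto
      then have "sqrt (\<Sum>i\<in>I. ip (drift (A i) v) (drift (A i) v)) \<le> sqrt (real (card I)) * (\<kappa> * hnorm H v)"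
        using \<kappa> real_sqrt_le_mono by (fastforce simp: real_sqrt_mult hnorm_eq_sqrt_ip)
      ultimately have "hnorm H v * (1 - \<rho>) \<le> sqrt (real (card I)) * (\<kappa> * hnorm H v)"
        using le \<rho> by (simp add: pos_le_divide_eq)
      also have "\<dots> = (1 - \<rho>) / 2 * hnorm H v" using m by (simp add: \<kappa>_def)
      finally have "hnorm H v * (1 - \<rho>) \<le> 0" by simp
      then show False using \<rho> v v0 hnorm_nonneg[OF v] hnorm_eq_0[OF v]
        by (simp add: mult_le_0_iff)
    qed
  qed
  then show ?thesis unfolding property_T_def using I A SG \<kappa> by (intro exI[of _ ?S] exI[of _ \<kappa>]) auto
qed

section \<open>Free groups and presentations\<close>

text \<open>
  The target is a monoid rather than a group, so that the Magnus map into the multiplicative monoid of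
  power series is an instance.
\<close>

definition word_eval :: "('k, 'm) monoid_scheme \<Rightarrow> ('x letter \<Rightarrow> 'k) \<Rightarrow> 'x letter list \<Rightarrow> 'k" where
  "word_eval K L w = foldr (\<lambda>a k. L a \<otimes>\<^bsub>K\<^esub> k) w \<one>\<^bsub>K\<^esub>"

context monoid
begin

context
  fixes A :: "'x set" and L :: "'x letter \<Rightarrow> 'a"
  assumes L: "\<And>a. fst a \<in> A \<Longrightarrow> L a \<in> carrier G"
    and L_inv: "\<And>a. fst a \<in> A \<Longrightarrow> L a \<otimes> L (inv_letter a) = \<one>"
begin

lemma word_eval_closed: "set w \<subseteq> A \<times> UNIV \<Longrightarrow> word_eval G L w \<in> carrier G"
  by (induction w) (auto simp: word_eval_def L mem_Times_iff)

lemma word_eval_cons_reduce: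
  assumes w: "set w \<subseteq> A \<times> UNIV" and a: "fst a \<in> A"
  shows "word_eval G L (cons_reduce a w) = L a \<otimes> word_eval G L w"
proof (cases w)
  case (Cons b v)
  have v: "set v \<subseteq> A \<times> UNIV" using w Cons by auto
  show ?thesis
  proof (cases "b = inv_letter a")
    case True
    have ia: "fst (inv_letter a) \<in> A" using a by (simp add: inv_letter_def)
    have "L a \<otimes> word_eval G L w = (L a \<otimes> L (inv_letter a)) \<otimes> word_eval G L v"
      using L[OF a] L[OF ia] word_eval_closed[OF v] Cons True by (simp add: word_eval_def m_assoc)
    then show ?thesis using L_inv[OF a] word_eval_closed[OF v] Cons True by simp
  qed (simp add: Cons word_eval_def)
qed (simp add: word_eval_def)

lemma word_eval_hom: "word_eval G L \<in> hom (free_group A) G"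
proof (rule homI)
  show "word_eval G L w \<in> carrier G" if "w \<in> carrier (free_group A)" for w
    using that word_eval_closed by (simp add: free_group_def)
  fix u v assume uv: "u \<in> carrier (free_group A)" "v \<in> carrier (free_group A)"
  have "word_eval G L (foldr cons_reduce u v) = word_eval G L u \<otimes> word_eval G L v"
    if "set u \<subseteq> A \<times> UNIV" for u
    using that
  proof (induction u)
    case Nil
    then show ?case using word_eval_closed[of v] uv by (simp add: free_group_def) (simp add: word_eval_def)
  next
    case (Cons a u)
    have sub: "set (foldr cons_reduce u v) \<subseteq> A \<times> UNIV"
      using set_foldr[of u v] Cons(2) uv by (auto simp: free_group_def)
    have "word_eval G L (foldr cons_reduce (a # u) v) = L a \<otimes> (word_eval G L u \<otimes> word_eval G L v)"
      using word_eval_cons_reduce[OF sub, of a] Cons by auto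
    also have "\<dots> = word_eval G L (a # u) \<otimes> word_eval G L v"
      using Cons(2) uv L[of a] word_eval_closed[of u] word_eval_closed[of v]
      by (auto simp: free_group_def m_assoc word_eval_def)
    finally show ?case .
  qed
  then show "word_eval G L (u \<otimes>\<^bsub>free_group A\<^esub> v) = word_eval G L u \<otimes> word_eval G L v"
    using uv by (simp add: free_group_def)
qed

end

end

abbreviation free_gen :: "'x \<Rightarrow> 'x letter list" where "free_gen x \<equiv> [(x, True)]"

lemma free_gen_closed: "x \<in> A \<Longrightarrow> free_gen x \<in> carrier (free_group A)"
  by (simp add: free_group_def reduced_word_def)

lemma generate_free_gens: "generate (free_group A) (free_gen ` A) = carrier (free_group A)"
proof
  interpret F: group "free_group A" by (rule group_free_group)
  have gens: "free_gen ` A \<subseteq> carrier (free_group A)" using free_gen_closed by auto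
  show "generate (free_group A) (free_gen ` A) \<subseteq> carrier (free_group A)"
    by (rule F.generate_incl[OF gens])
  show "carrier (free_group A) \<subseteq> generate (free_group A) (free_gen ` A)"
  proof
    fix w assume "w \<in> carrier (free_group A)"
    then show "w \<in> generate (free_group A) (free_gen ` A)"
    proof (induction w)
      case Nil
      show ?case using generate.one[of "free_group A"] by (simp add: free_group_def)
    next
      case (Cons a w)
      have red: "reduced_word (a # w)" and aw: "fst a \<in> A" "w \<in> carrier (free_group A)"
        using Cons.prems by (auto simp: free_group_def reduced_Cons mem_Times_iff)
      have a: "[a] \<in> generate (free_group A) (free_gen ` A)"
      proof (cases "snd a")
        case True
        then have "[a] = free_gen (fst a)" by (cases a) simp
        then show ?thesis using aw by (auto intro: generate.incl)
      next
        case False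
        then have a: "a = (fst a, False)" by (cases a) simp
        have "[a] \<otimes>\<^bsub>free_group A\<^esub> free_gen (fst a) = \<one>\<^bsub>free_group A\<^esub>"
          by (subst a) (simp add: free_group_def inv_letter_def)
        moreover have "[a] \<in> carrier (free_group A)" using aw by (subst a) (simp add: free_group_def reduced_word_def)
        ultimately have "[a] = inv\<^bsub>free_group A\<^esub> (free_gen (fst a))"
          using F.inv_equality free_gen_closed aw by metis
        then show ?thesis using aw by (simp add: generate.inv)
      qed
      have "a # w = [a] \<otimes>\<^bsub>free_group A\<^esub> w"
        using cons_reduce_reduced[OF red] by (simp add: free_group_def)
      then show ?case using generate.eng[OF a Cons.IH[OF aw(2)]] by simp
    qed
  qed
qed

lemma (in group) normal_hull:
  assumes R: "R \<subseteq> carrier G"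
  shows "((\<lambda>N. N \<lhd> G) hull R) \<lhd> G"
proof (rule normal_invI)
  have car: "carrier G \<lhd> G" by (intro normal_invI subgroup_self) auto
  show "subgroup ((\<lambda>N. N \<lhd> G) hull R) G"
    unfolding hull_def using car R by (intro subgroups_Inter) (auto simp: normal_def)
  fix x h assume "x \<in> carrier G" "h \<in> ((\<lambda>N. N \<lhd> G) hull R)"
  then show "x \<otimes> h \<otimes> inv x \<in> ((\<lambda>N. N \<lhd> G) hull R)"
    unfolding hull_def using normal.inv_op_closed2 by fastforce
qed

text \<open>
  The quotient of the free group is countable, so its elements can be renamed to natural numbers. The last clause
  is the universal property of the presentation.
\<close>

lemma presented_group:
  fixes A :: "nat set"
  assumes R: "R \<subseteq> carrier (free_group A)"
  obtains G :: "nat monoid" and h where "group G" "presents A R G" "h \<in> hom (free_group A) G"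
    "h ` carrier (free_group A) = carrier G" "\<And>r. r \<in> R \<Longrightarrow> h r = \<one>\<^bsub>G\<^esub>"
    "\<And>(K :: 'k monoid) \<phi>. \<lbrakk>group K; \<phi> \<in> hom (free_group A) K; \<And>r. r \<in> R \<Longrightarrow> \<phi> r = \<one>\<^bsub>K\<^esub>\<rbrakk> \<Longrightarrow>
       \<exists>\<psi>\<in>hom G K. \<forall>w\<in>carrier (free_group A). \<psi> (h w) = \<phi> w"
proof -
  define F where "F = free_group A"
  define N where "N = (\<lambda>N. N \<lhd> F) hull R"
  interpret F: group F unfolding F_def by (rule group_free_group)
  interpret N: normal N F unfolding N_def using R by (intro F.normal_hull) (simp add: F_def)
  interpret Q: group "F Mod N" by (rule N.factorgroup_is_group)
  have cnt: "countable (carrier (F Mod N))"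
    unfolding FactGroup_def RCOSETS_def by (auto simp: F_def intro!: countable_subset[of _ "range (r_coset F N)"])
  define e where "e = to_nat_on (carrier (F Mod N))"
  have inj: "inj_on e (carrier (F Mod N))" unfolding e_def by (rule inj_on_to_nat_on[OF cnt])
  define G where "G = image_group e (F Mod N)"
  have iso: "e \<in> iso (F Mod N) G"
    unfolding G_def iso_def bij_betw_def using inj by (auto simp: hom_def image_group_def)
  have grp: "group G" using Q.iso_imp_img_group[OF iso] by (simp add: G_def image_group_def)
  have pres: "presents A R G"
    unfolding presents_def using R Q.iso_set_sym[OF iso] by (auto simp: is_iso_def F_def N_def)
  define h where "h = e \<circ> (\<lambda>w. N #>\<^bsub>F\<^esub> w)"
  have "(\<lambda>w. N #>\<^bsub>F\<^esub> w) \<in> hom F (F Mod N)" by (rule N.r_coset_hom_Mod)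
  then have h: "h \<in> hom F G" unfolding h_def using iso by (auto simp: iso_def intro: hom_compose)
  have surj: "h ` carrier F = carrier G"
    unfolding h_def G_def image_comp[symmetric] by (auto simp: image_group_def FactGroup_def RCOSETS_def)
  have hN: "h w = \<one>\<^bsub>G\<^esub>" if "w \<in> N" for w
    using N.rcos_const[OF F.is_group that] by (simp add: h_def G_def image_group_def)
  have hR: "h r = \<one>\<^bsub>G\<^esub>" if "r \<in> R" for r using hN hull_subset[of R "\<lambda>N. N \<lhd> F"] that by (auto simp: N_def)
  have heq: "u \<otimes>\<^bsub>F\<^esub> inv\<^bsub>F\<^esub> v \<in> N" if "h u = h v" "u \<in> carrier F" "v \<in> carrier F" for u v
  proof -
    have "N #>\<^bsub>F\<^esub> u = N #>\<^bsub>F\<^esub> v"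
      using that inj by (auto simp: h_def FactGroup_def RCOSETS_def dest!: inj_onD)
    then have "u \<in> N #>\<^bsub>F\<^esub> v" using F.rcos_self[OF that(2) N.is_subgroup] by simp
    then show ?thesis using that(3) by (auto simp: r_coset_def F.m_assoc N.mem_carrier)
  qed
  have univ: "\<exists>\<psi>\<in>hom G K. \<forall>w\<in>carrier F. \<psi> (h w) = \<phi> w"
    if K: "group K" and \<phi>: "\<phi> \<in> hom F K" and kill: "\<And>r. r \<in> R \<Longrightarrow> \<phi> r = \<one>\<^bsub>K\<^esub>"
    for K :: "'k monoid" and \<phi>
  proof -
    interpret K: group K by fact
    interpret \<phi>: group_hom F K \<phi> using \<phi> by unfold_locales
    have "kernel F K \<phi> \<lhd> F" by (rule \<phi>.normal_kernel)
    then have Nk: "N \<subseteq> kernel F K \<phi>"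
      unfolding N_def using kill R by (intro hull_minimal) (auto simp: kernel_def F_def)
    define \<psi> where "\<psi> g = \<phi> (SOME w. w \<in> carrier F \<and> h w = g)" for g
    have \<psi>: "\<psi> (h w) = \<phi> w" if w: "w \<in> carrier F" for w
    proof -
      define u where "u = (SOME u. u \<in> carrier F \<and> h u = h w)"
      have u: "u \<in> carrier F" "h u = h w" unfolding u_def using someI[of "\<lambda>u. u \<in> carrier F \<and> h u = h w" w] w by auto
      have "\<phi> (u \<otimes>\<^bsub>F\<^esub> inv\<^bsub>F\<^esub> w) = \<one>\<^bsub>K\<^esub>" using heq[OF u(2,1) w] Nk by (auto simp: kernel_def)
      then have "\<phi> u \<otimes>\<^bsub>K\<^esub> inv\<^bsub>K\<^esub> \<phi> w = \<one>\<^bsub>K\<^esub>" using u w by simp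
      then have "\<phi> u = \<phi> w" using u w by (metis K.inv_equality K.inv_inv K.inv_closed \<phi>.hom_closed)
      then show ?thesis by (simp add: \<psi>_def u_def)
    qed
    have "\<psi> \<in> hom G K"
    proof (rule homI)
      fix g assume "g \<in> carrier G"
      then obtain w where w: "w \<in> carrier F" "g = h w" using surj by auto
      then show "\<psi> g \<in> carrier K" by (simp add: \<psi>)
      fix g' assume "g' \<in> carrier G"
      then obtain w' where w': "w' \<in> carrier F" "g' = h w'" using surj by auto
      then show "\<psi> (g \<otimes>\<^bsub>G\<^esub> g') = \<psi> g \<otimes>\<^bsub>K\<^esub> \<psi> g'"
        using w hom_mult[OF h w(1) w'(1)] by (metis \<psi> F.m_closed \<phi>.hom_mult)
    qed
    then show ?thesis using \<psi> by blast
  qed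
  show ?thesis
    using that[of G h] grp pres h surj hR univ unfolding F_def by blast
qed

section \<open>Commutators and generated subgroups\<close>

definition comm :: "('g, 'm) monoid_scheme \<Rightarrow> 'g \<Rightarrow> 'g \<Rightarrow> 'g" where
  "comm G a b = inv\<^bsub>G\<^esub> a \<otimes>\<^bsub>G\<^esub> inv\<^bsub>G\<^esub> b \<otimes>\<^bsub>G\<^esub> a \<otimes>\<^bsub>G\<^esub> b"

context group
begin

lemma comm_closed [simp]: "\<lbrakk>a \<in> carrier G; b \<in> carrier G\<rbrakk> \<Longrightarrow> comm G a b \<in> carrier G"
  by (simp add: comm_def)

lemma cancel_left [simp]:
  assumes "a \<in> carrier G" "b \<in> carrier G"
  shows "a \<otimes> (inv a \<otimes> b) = b" "inv a \<otimes> (a \<otimes> b) = b"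
  using assms by (simp_all add: m_assoc[symmetric])

lemma conj_eq_comm: "\<lbrakk>a \<in> carrier G; b \<in> carrier G\<rbrakk> \<Longrightarrow> inv b \<otimes> a \<otimes> b = a \<otimes> comm G a b"
  by (simp add: comm_def m_assoc)

lemma comm_inv: "\<lbrakk>a \<in> carrier G; b \<in> carrier G\<rbrakk> \<Longrightarrow> inv (comm G a b) = comm G b a"
  by (simp add: comm_def m_assoc inv_mult_group)

lemma comm_eq_one_iff:
  assumes ab: "a \<in> carrier G" "b \<in> carrier G"
  shows "comm G a b = \<one> \<longleftrightarrow> a \<otimes> b = b \<otimes> a"
proof
  assume "comm G a b = \<one>"
  then have "b \<otimes> (a \<otimes> comm G a b) = b \<otimes> a" using ab by simp
  then show "a \<otimes> b = b \<otimes> a" using ab by (simp add: comm_def m_assoc)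
next
  assume "a \<otimes> b = b \<otimes> a"
  then show "comm G a b = \<one>" using ab by (simp add: comm_def m_assoc)
qed

lemma generate_commute:
  assumes S: "S \<subseteq> carrier G" and T: "T \<subseteq> carrier G"
    and comm: "\<And>s t. \<lbrakk>s \<in> S; t \<in> T\<rbrakk> \<Longrightarrow> s \<otimes> t = t \<otimes> s"
    and g: "g \<in> generate G S" and h: "h \<in> generate G T"
  shows "g \<otimes> h = h \<otimes> g"
proof -
  have "t \<otimes> g = g \<otimes> t" if t: "t \<in> T" for t
  proof -
    have tG: "t \<in> carrier G" using t T by auto
    have "S \<subseteq> {x \<in> carrier G. x \<otimes> t = t \<otimes> x}" using S comm[OF _ t] by blast
    from generate_subgroup_incl[OF this subgroup_centralizer[OF tG]] g
    have "g \<in> {x \<in> carrier G. x \<otimes> t = t \<otimes> x}" by (rule subsetD)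
    then show ?thesis by simp
  qed
  then have "T \<subseteq> {x \<in> carrier G. x \<otimes> g = g \<otimes> x}" using T by blast
  from generate_subgroup_incl[OF this subgroup_centralizer[OF generate_in_carrier[OF S g]]] h
  have "h \<in> {x \<in> carrier G. x \<otimes> g = g \<otimes> x}" by (rule subsetD)
  then show ?thesis by simp
qed

lemma generate_abelian_exponent:
  assumes S: "S \<subseteq> carrier G" and comm: "\<And>s t. \<lbrakk>s \<in> S; t \<in> S\<rbrakk> \<Longrightarrow> s \<otimes> t = t \<otimes> s"
    and expo: "\<And>s. s \<in> S \<Longrightarrow> s [^] (p::nat) = \<one>" and g: "g \<in> generate G S"
  shows "g [^] p = \<one>"
  using g
proof (induction rule: generate.induct)
  case (inv s)
  then show ?case using S expo nat_pow_inv[of s p] by auto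
next
  case (eng g h)
  then show ?case
    using pow_mult_distrib[OF generate_commute[OF S S comm eng(1,2)]] generate_in_carrier[OF S] by simp
qed (use expo in auto)

lemma card_generate_abelian_exponent:
  assumes "finite S" "S \<subseteq> carrier G" and "\<And>s t. \<lbrakk>s \<in> S; t \<in> S\<rbrakk> \<Longrightarrow> s \<otimes> t = t \<otimes> s"
    and "\<And>s. s \<in> S \<Longrightarrow> s [^] (p::nat) = \<one>" and p: "p > 0"
  shows "finite (generate G S) \<and> card (generate G S) \<le> p ^ card S"
  using assms(1-4)
proof (induction S)
  case empty
  then show ?case by (simp add: generate_empty)
next
  case (insert s S)
  let ?T = "(\<lambda>(k, g). s [^] k \<otimes> g) ` ({..<p} \<times> generate G S)"
  have s: "s \<in> carrier G" and S: "S \<subseteq> carrier G" using insert by auto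
  note gc = generate_in_carrier[OF S]
  have IH: "finite (generate G S)" "card (generate G S) \<le> p ^ card S" using insert by auto
  have sp: "s [^] p = \<one>" using insert by auto
  have "s [^] k = s [^] (k mod p)" for k :: nat
  proof -
    have "s [^] k = (s [^] p) [^] (k div p) \<otimes> s [^] (k mod p)"
      unfolding nat_pow_pow[OF s] nat_pow_mult[OF s] by simp
    then show ?thesis using sp s by simp
  qed
  then have T: "s [^] k \<otimes> g \<in> ?T" if "g \<in> generate G S" for k :: nat and g
    using that p by (intro image_eqI[of _ _ "(k mod p, g)"]) auto
  have cs: "g \<otimes> s [^] k = s [^] k \<otimes> g" if "g \<in> generate G S" for g and k :: nat
  proof -
    have "s \<otimes> g = g \<otimes> s"
    proof (rule generate_commute[OF _ S _ _ that, of "{s}"])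
      show "s' \<otimes> t = t \<otimes> s'" if "s' \<in> {s}" "t \<in> S" for s' t
        using insert.prems(2)[of s' t] that by simp
    qed (use s in \<open>auto intro: generate.incl\<close>)
    then show ?thesis using group_commutes_pow[of s g k] s gc[OF that] by simp
  qed
  have "subgroup ?T G"
  proof (rule subgroupI)
    show "?T \<subseteq> carrier G" using s gc by auto
    show "?T \<noteq> {}" using T[OF generate.one, of 0] by blast
    fix a assume "a \<in> ?T"
    then obtain k :: nat and g where a: "g \<in> generate G S" "a = s [^] k \<otimes> g" "k < p" by auto
    have "s [^] (p - k) \<otimes> s [^] k = \<one>" using a(3) s sp by (simp add: nat_pow_mult)
    then have "inv (s [^] k) = s [^] (p - k)" using s by (intro inv_equality) auto
    then have "inv a = s [^] (p - k) \<otimes> inv g"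
      using a s gc cs[OF generate_m_inv_closed[OF S a(1)]] by (simp add: inv_mult_group)
    then show "inv a \<in> ?T" using T[OF generate_m_inv_closed[OF S a(1)]] by simp
    fix b assume "b \<in> ?T"
    then obtain l :: nat and h where b: "h \<in> generate G S" "b = s [^] l \<otimes> h" by auto
    have "a \<otimes> b = s [^] k \<otimes> (g \<otimes> s [^] l) \<otimes> h" using a b s gc by (simp add: m_assoc)
    also have "\<dots> = s [^] (k + l) \<otimes> (g \<otimes> h)" unfolding cs[OF a(1)] nat_pow_mult[OF s, symmetric]
      using a b s gc by (simp add: m_assoc)
    finally show "a \<otimes> b \<in> ?T" using T[OF generate.eng[OF a(1) b(1)]] by simp
  qed
  moreover have "insert s S \<subseteq> ?T"
  proof
    fix t assume t: "t \<in> insert s S"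
    have "s [^] (1::nat) \<otimes> \<one> = s" using s by simp
    then have "s \<in> ?T" using T[OF generate.one, of 1] by metis
    moreover have "t \<in> ?T" if "t \<in> S"
    proof -
      have "s [^] (0::nat) \<otimes> t = t" using that S by auto
      then show ?thesis using T[OF generate.incl[OF that], of 0] by metis
    qed
    ultimately show "t \<in> ?T" using t by blast
  qed
  ultimately have sub: "generate G (insert s S) \<subseteq> ?T" by (intro generate_subgroup_incl)
  have fT: "finite ?T" using IH by auto
  have "card ?T \<le> p * card (generate G S)"
    using card_image_le[of "{..<p} \<times> generate G S"] IH by fastforce
  also have "\<dots> \<le> p ^ card (insert s S)" using insert IH by simp
  finally show ?case using sub fT finite_subset card_mono[OF fT sub] by auto
qed

text \<open>
  As its values at the generators commute with \<open>S\<close>, the map \<open>comm G y\<close> is an antihomomorphism on the group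
  generated by \<open>S\<close>.
\<close>

lemma comm_generate_in_subgroup:
  assumes C: "subgroup C G" and S: "S \<subseteq> carrier G" and y: "y \<in> carrier G"
    and central: "\<And>c s. \<lbrakk>c \<in> C; s \<in> S\<rbrakk> \<Longrightarrow> c \<otimes> s = s \<otimes> c"
    and gens: "\<And>s. s \<in> S \<Longrightarrow> comm G y s \<in> C" and x: "x \<in> generate G S"
  shows "comm G y x \<in> C"
proof -
  interpret C: subgroup C G by fact
  note gc = generate_in_carrier[OF S]
  have cen: "c \<otimes> g = g \<otimes> c" if "c \<in> C" "g \<in> generate G S" for c g
    using generate_commute[of "C" S c g] C.subset S central that by (auto intro: generate.incl)
  have mult: "comm G y (g \<otimes> h) = comm G y h \<otimes> comm G y g"
    if g: "g \<in> generate G S" "comm G y g \<in> C" and h: "h \<in> generate G S" for g h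
  proof -
    have "comm G y (g \<otimes> h) = inv y \<otimes> inv h \<otimes> y \<otimes> (comm G y g \<otimes> h)"
      using y gc[OF g(1)] gc[OF h] by (simp add: comm_def m_assoc inv_mult_group)
    also have "\<dots> = comm G y h \<otimes> comm G y g"
      unfolding cen[OF g(2) h] using y gc[OF g(1)] gc[OF h] by (simp add: comm_def m_assoc)
    finally show ?thesis .
  qed
  show ?thesis using x
  proof (induction rule: generate.induct)
    case one
    then show ?case using y by (simp add: comm_def)
  next
    case (inv s)
    have s: "s \<in> carrier G" using S inv by auto
    have "inv s \<in> generate G S" using inv by (rule generate.inv)
    then have "inv (comm G y s) \<otimes> inv s = inv s \<otimes> inv (comm G y s)"
      using cen gens[OF inv] by (intro cen) auto
    have "comm G y (inv s) = s \<otimes> (inv (comm G y s) \<otimes> inv s)"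
      using y s by (simp add: comm_def m_assoc inv_mult_group)
    also have "\<dots> = inv (comm G y s)" unfolding \<open>inv (comm G y s) \<otimes> inv s = inv s \<otimes> inv (comm G y s)\<close> using y s by simp
    finally show ?case using gens[OF inv] by simp
  next
    case (eng g h)
    then show ?case using mult by simp
  qed (rule gens)
qed

end

lemma (in group_hom) hom_comm: "\<lbrakk>a \<in> carrier G; b \<in> carrier G\<rbrakk> \<Longrightarrow> h (comm G a b) = comm H (h a) (h b)"
  by (simp add: comm_def)

section \<open>The presentation\<close>

definition same_class_pairs :: "nat \<Rightarrow> (nat \<times> nat) set" where
  "same_class_pairs n = {(a, b). a < b \<and> b < n \<and> a mod 9 = b mod 9}"

definition mixed_triples :: "nat \<Rightarrow> (nat \<times> nat \<times> nat) set" where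
  "mixed_triples n = {(a, b, c). a < n \<and> b < n \<and> c < n \<and> a mod 9 \<noteq> b mod 9 \<and> c mod 9 = a mod 9}"

text \<open>
  The index \<open>c\<close> of a mixed triple ranges over the class of \<open>a\<close> only. As the two orders of \<open>a\<close> and \<open>b\<close> give mutually
  inverse commutators, the triples starting with \<open>(a, b)\<close> and \<open>(b, a)\<close> together make the commutator commute with
  both classes.
\<close>

definition relators :: "nat \<Rightarrow> nat \<Rightarrow> nat letter list set" where
  "relators p n = (let F = free_group {..<n} in
     (\<lambda>a. free_gen a [^]\<^bsub>F\<^esub> p) ` {..<n} \<union>
     (\<lambda>(a, b). comm F (free_gen a) (free_gen b)) ` same_class_pairs n \<union>
     (\<lambda>(a, b, c). comm F (comm F (free_gen a) (free_gen b)) (free_gen c)) ` mixed_triples n)"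

lemma relators_closed: "relators p n \<subseteq> carrier (free_group {..<n})"
proof -
  interpret F: group "free_group {..<n}" by (rule group_free_group)
  have g: "free_gen a \<in> carrier (free_group {..<n})" if "a < n" for a
    using that by (intro free_gen_closed) auto
  show ?thesis
    by (auto simp: relators_def Let_def same_class_pairs_def mixed_triples_def g)
qed

lemma hom_relators_trivial_iff:
  assumes "group H" and h: "h \<in> hom (free_group {..<n}) H"
  shows "(\<forall>r\<in>relators p n. h r = \<one>\<^bsub>H\<^esub>) \<longleftrightarrow>
    (\<forall>a<n. h (free_gen a) [^]\<^bsub>H\<^esub> p = \<one>\<^bsub>H\<^esub>) \<and>
    (\<forall>(a, b)\<in>same_class_pairs n. comm H (h (free_gen a)) (h (free_gen b)) = \<one>\<^bsub>H\<^esub>) \<and>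
    (\<forall>(a, b, c)\<in>mixed_triples n. comm H (comm H (h (free_gen a)) (h (free_gen b))) (h (free_gen c)) = \<one>\<^bsub>H\<^esub>)"
proof -
  define G where "G = free_group {..<n}"
  interpret H: group H by fact
  interpret G: group G unfolding G_def by (rule group_free_group)
  interpret group_hom G H h using h by unfold_locales (simp add: G_def)
  have g: "free_gen a \<in> carrier G" if "a < n" for a
    using that unfolding G_def by (intro free_gen_closed) auto
  have "h (free_gen a [^]\<^bsub>G\<^esub> p) = h (free_gen a) [^]\<^bsub>H\<^esub> p" if "a < n" for a
    using g[OF that] by (rule hom_nat_pow)
  moreover have "h (comm G (free_gen a) (free_gen b)) = comm H (h (free_gen a)) (h (free_gen b))"
    if "(a, b) \<in> same_class_pairs n" for a b
    using that g by (intro hom_comm) (auto simp: same_class_pairs_def)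
  moreover have "h (comm G (comm G (free_gen a) (free_gen b)) (free_gen c)) =
      comm H (comm H (h (free_gen a)) (h (free_gen b))) (h (free_gen c))"
    if "(a, b, c) \<in> mixed_triples n" for a b c
    using that g by (auto simp: mixed_triples_def hom_comm)
  ultimately show ?thesis
    unfolding relators_def Let_def G_def[symmetric] by (auto simp: ball_Un)
qed

text \<open>
  The relators speak about generators only. That the commutator of any \<open>y \<in> B i\<close> and \<open>g \<in> B j\<close> lies in the
  centralizer \<open>Z i j\<close> of both groups follows by extending one argument at a time from generators to the group they
  generate.
\<close>

lemma property_T_of_relations:
  fixes G :: "'g monoid" and x :: "nat \<Rightarrow> 'g" and p n :: nat
  assumes G: "group G" and x: "\<And>a. a < n \<Longrightarrow> x a \<in> carrier G"
    and gen: "generate G (x ` {..<n}) = carrier G"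
    and p: "Factorial_Ring.prime p" "p > 64"
    and power: "\<And>a. a < n \<Longrightarrow> x a [^]\<^bsub>G\<^esub> p = \<one>\<^bsub>G\<^esub>"
    and pairs: "\<And>a b. (a, b) \<in> same_class_pairs n \<Longrightarrow> comm G (x a) (x b) = \<one>\<^bsub>G\<^esub>"
    and triples: "\<And>a b c. (a, b, c) \<in> mixed_triples n \<Longrightarrow> comm G (comm G (x a) (x b)) (x c) = \<one>\<^bsub>G\<^esub>"
  shows "property_T G"
proof -
  interpret group G by (rule G)
  define S where "S i = x ` {a. a < n \<and> a mod 9 = i}" for i
  define B where "B i = generate G (S i)" for i
  have S: "S i \<subseteq> carrier G" "finite (S i)" for i using x by (auto simp: S_def)
  have Bc: "B i \<subseteq> carrier G" for i unfolding B_def using S(1) by (rule generate_incl)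
  have sub: "subgroup (B i) G" for i unfolding B_def using S(1) by (rule generate_is_subgroup)
  have pow: "s [^]\<^bsub>G\<^esub> p = \<one>\<^bsub>G\<^esub>" if "s \<in> S i" for s i using that power by (auto simp: S_def)
  have abel: "s \<otimes>\<^bsub>G\<^esub> t = t \<otimes>\<^bsub>G\<^esub> s" if st: "s \<in> S i" "t \<in> S i" for s t i
  proof -
    obtain a b where ab: "s = x a" "t = x b" "a < n" "b < n" "a mod 9 = b mod 9"
      using st by (auto simp: S_def)
    consider "a = b" | "a < b" | "b < a" by linarith
    then show ?thesis
    proof cases
      case 2
      then show ?thesis using pairs[of a b] comm_eq_one_iff[of "x a" "x b"] ab x by (simp add: same_class_pairs_def)
    next
      case 3
      then show ?thesis using pairs[of b a] comm_eq_one_iff[of "x b" "x a"] ab x by (simp add: same_class_pairs_def)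
    qed (use ab in simp)
  qed
  have p0: "p > 0" using p by simp
  have fin: "finite (B i)" for i
    unfolding B_def using card_generate_abelian_exponent[OF S(2,1) _ _ p0, of i] abel[of _ i] pow[of _ i] by blast
  have expo: "g [^]\<^bsub>G\<^esub> p = \<one>\<^bsub>G\<^esub>" if "g \<in> B i" for g i
    using generate_abelian_exponent[OF S(1), of i p g] abel[of _ i] pow[of _ i] that unfolding B_def by blast
  define Z where "Z i j = {z \<in> carrier G. \<forall>g\<in>S i \<union> S j. z \<otimes>\<^bsub>G\<^esub> g = g \<otimes>\<^bsub>G\<^esub> z}" for i j
  have subZ: "subgroup (Z i j) G" for i j
  proof -
    have "Z i j = \<Inter> (insert (carrier G) ((\<lambda>g. {z \<in> carrier G. z \<otimes>\<^bsub>G\<^esub> g = g \<otimes>\<^bsub>G\<^esub> z}) ` (S i \<union> S j)))"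
      by (auto simp: Z_def)
    also have "subgroup \<dots> G"
      using subgroup_centralizer S by (intro subgroups_Inter) (auto intro!: subgroup_self)
    finally show ?thesis .
  qed
  have Zc: "z \<otimes>\<^bsub>G\<^esub> g = g \<otimes>\<^bsub>G\<^esub> z" if z: "z \<in> Z i j" and g: "g \<in> B i \<union> B j" for z g i j
  proof -
    have "g \<in> generate G (S i \<union> S j)"
      using g mono_generate[of "S i" "S i \<union> S j"] mono_generate[of "S j" "S i \<union> S j"] by (auto simp: B_def)
    then show ?thesis
      using generate_commute[of "{z}" "S i \<union> S j" z g] z S by (auto simp: Z_def intro: generate.incl)
  qed
  have Z_sym: "Z i j = Z j i" for i j by (auto simp: Z_def)
  have comm1: "comm G s t \<in> Z i j" if s: "s \<in> S i" and t: "t \<in> S j" and ij: "i \<noteq> j" for s t i j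
  proof -
    obtain a b where ab: "s = x a" "t = x b" "a < n" "b < n" "a mod 9 = i" "b mod 9 = j"
      using s t by (auto simp: S_def)
    have st: "s \<in> carrier G" "t \<in> carrier G" using ab x by auto
    have "comm G s t \<otimes>\<^bsub>G\<^esub> x c = x c \<otimes>\<^bsub>G\<^esub> comm G s t" if c: "c < n" "c mod 9 = i" for c
      using triples[of a b c] comm_eq_one_iff[of "comm G s t" "x c"] st x[OF c(1)] ab c ij
      by (simp add: mixed_triples_def)
    moreover have "comm G s t \<otimes>\<^bsub>G\<^esub> x c = x c \<otimes>\<^bsub>G\<^esub> comm G s t" if c: "c < n" "c mod 9 = j" for c
    proof -
      have "comm G t s \<otimes>\<^bsub>G\<^esub> x c = x c \<otimes>\<^bsub>G\<^esub> comm G t s"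
        using triples[of b a c] comm_eq_one_iff[of "comm G t s" "x c"] st x[OF c(1)] ab c ij
        by (simp add: mixed_triples_def)
      then have "comm G t s \<in> {z \<in> carrier G. z \<otimes>\<^bsub>G\<^esub> x c = x c \<otimes>\<^bsub>G\<^esub> z}" using st by simp
      from subgroup.m_inv_closed[OF subgroup_centralizer[OF x[OF c(1)]] this]
      show ?thesis using comm_inv[OF st(2,1)] by simp
    qed
    ultimately show ?thesis using st by (auto simp: Z_def S_def)
  qed
  have comm2: "comm G y g \<in> Z i j" if y: "y \<in> S i" and g: "g \<in> B j" and ij: "i \<noteq> j" for y g i j
    using g unfolding B_def
  proof (rule comm_generate_in_subgroup[OF subZ S(1), rotated -1])
    show "c \<otimes>\<^bsub>G\<^esub> s = s \<otimes>\<^bsub>G\<^esub> c" if "c \<in> Z i j" "s \<in> S j" for c s using that by (simp add: Z_def)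
  qed (use y S comm1[OF y _ ij] in auto)
  have comm3: "comm G y g \<in> Z i j" if y: "y \<in> B i" and g: "g \<in> B j" and ij: "i \<noteq> j" for y g i j
  proof -
    have yg: "y \<in> carrier G" "g \<in> carrier G" using y g Bc by auto
    have "comm G g y \<in> Z i j"
      using y unfolding B_def
    proof (rule comm_generate_in_subgroup[OF subZ S(1), rotated -1])
      show "c \<otimes>\<^bsub>G\<^esub> s = s \<otimes>\<^bsub>G\<^esub> c" if "c \<in> Z i j" "s \<in> S i" for c s using that by (simp add: Z_def)
      fix s assume s: "s \<in> S i"
      have "inv\<^bsub>G\<^esub> (comm G s g) \<in> Z i j" using comm2[OF s g ij] subZ by (rule subgroup.m_inv_closed[rotated])
      then show "comm G g s \<in> Z i j" using comm_inv[of s g] subsetD[OF S(1) s] yg by simp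
    qed (use yg in auto)
    then have "inv\<^bsub>G\<^esub> (comm G g y) \<in> Z i j" using subZ by (rule subgroup.m_inv_closed[rotated])
    then show ?thesis using comm_inv[of g y] yg by simp
  qed
  show ?thesis
  proof (rule property_T_from_small_angles[where I = "{..<9::nat}" and A = B and z = "\<lambda>x y. comm G y x"])
    have "(real (card {..<9::nat}) - 1)\<^sup>2 = 64" by simp
    then show "(real (card {..<9::nat}) - 1)\<^sup>2 < real p" using p by simp
    show "{..<9::nat} \<noteq> {}" using lessThan_empty_iff[of "9::nat"] by simp
    have "x ` {..<n} \<subseteq> (\<Union>i<9. B i)"
    proof
      fix g assume "g \<in> x ` {..<n}"
      then obtain a where "a < n" "g = x a" by auto
      then have "g \<in> B (a mod 9)" unfolding B_def S_def by (auto intro: generate.incl)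
      then show "g \<in> (\<Union>i<9. B i)" by (auto intro: bexI[of _ "a mod 9"])
    qed
    then have "carrier G \<subseteq> generate G (\<Union>i<9. B i)" using gen mono_generate by metis
    then show "generate G (\<Union>i<9. B i) = carrier G" using generate_incl[of "\<Union>i<9. B i"] Bc by blast
    fix i j :: nat and u v
    assume ij: "i \<noteq> j" and u: "u \<in> B i" and v: "v \<in> B j"
    then show "inv\<^bsub>G\<^esub> u \<otimes>\<^bsub>G\<^esub> v \<otimes>\<^bsub>G\<^esub> u = v \<otimes>\<^bsub>G\<^esub> comm G v u" "comm G v u \<in> carrier G"
      using subsetD[OF Bc u] subsetD[OF Bc v] conj_eq_comm[of v u] by simp_all
    have "comm G v u \<in> Z i j" using comm3[OF v u] ij Z_sym by auto
    then show "g \<otimes>\<^bsub>G\<^esub> comm G v u = comm G v u \<otimes>\<^bsub>G\<^esub> g" if "g \<in> B i \<union> B j" for g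
      using Zc that by metis
  qed (use sub fin expo p in auto)
qed

section \<open>Noncommutative power series and the Magnus embedding\<close>

locale nc_power_series = R: cring R for R :: "('r, 'm) ring_scheme" (structure) +
  fixes A :: "'x set"
begin

abbreviation P where "P \<equiv> nc_series A R"

abbreviation coeffs :: "('x list \<Rightarrow> 'r) \<Rightarrow> bool" where
  "coeffs f \<equiv> \<forall>w. f w \<in> carrier R"

lemma carrier_P: "f \<in> carrier P \<longleftrightarrow> coeffs f \<and> (\<forall>w. \<not> set w \<subseteq> A \<longrightarrow> f w = \<zero>)"
  by (auto simp: nc_series_def)

lemma P_add: "(f \<oplus>\<^bsub>P\<^esub> g) w = f w \<oplus> g w"
  and P_zero: "\<zero>\<^bsub>P\<^esub> w = \<zero>"
  and P_one: "\<one>\<^bsub>P\<^esub> w = (if w = [] then \<one> else \<zero>)"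
  by (simp_all add: nc_series_def)

lemma P_mult: "(f \<otimes>\<^bsub>P\<^esub> g) w = (\<Oplus>k\<in>{..length w}. f (take k w) \<otimes> g (drop k w))"
  by (simp add: nc_series_def)

lemma mult_Nil: "\<lbrakk>coeffs f; coeffs g\<rbrakk> \<Longrightarrow> (f \<otimes>\<^bsub>P\<^esub> g) [] = f [] \<otimes> g []"
  by (simp add: P_mult)

text \<open>
  Splitting off the first letter turns the convolution into a recursion on words, so that the ring laws follow
  by induction without exchanging double sums.
\<close>

lemma mult_Cons:
  assumes "coeffs f" "coeffs g"
  shows "(f \<otimes>\<^bsub>P\<^esub> g) (x # w) = f [] \<otimes> g (x # w) \<oplus> ((\<lambda>v. f (x # v)) \<otimes>\<^bsub>P\<^esub> g) w"
proof -
  have "(f \<otimes>\<^bsub>P\<^esub> g) (x # w) = (\<Oplus>k\<in>{..Suc (length w)}. f (take k (x # w)) \<otimes> g (drop k (x # w)))"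
    by (simp add: P_mult)
  also have "\<dots> = (\<Oplus>k\<in>{..length w}. f (x # take k w) \<otimes> g (drop k w)) \<oplus> f [] \<otimes> g (x # w)"
    using assms by (subst R.finsum_Suc2) auto
  also have "\<dots> = f [] \<otimes> g (x # w) \<oplus> (\<Oplus>k\<in>{..length w}. f (x # take k w) \<otimes> g (drop k w))"
    using assms by (intro R.a_comm R.finsum_closed) auto
  finally show ?thesis by (simp add: P_mult)
qed

lemma coeffs_mult: "\<lbrakk>coeffs f; coeffs g\<rbrakk> \<Longrightarrow> (f \<otimes>\<^bsub>P\<^esub> g) w \<in> carrier R"
  by (auto simp: P_mult intro!: R.finsum_closed)

lemma mult_left_linear:
  assumes "coeffs f" "coeffs g" "coeffs h" "c \<in> carrier R"
  shows "((\<lambda>v. c \<otimes> f v \<oplus> g v) \<otimes>\<^bsub>P\<^esub> h) w = c \<otimes> (f \<otimes>\<^bsub>P\<^esub> h) w \<oplus> (g \<otimes>\<^bsub>P\<^esub> h) w"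
  using assms
proof (induction w arbitrary: f g)
  case Nil
  then show ?case by (simp add: mult_Nil R.l_distr R.m_assoc)
next
  case (Cons x w)
  have IH: "((\<lambda>v. c \<otimes> f (x # v) \<oplus> g (x # v)) \<otimes>\<^bsub>P\<^esub> h) w =
      c \<otimes> ((\<lambda>v. f (x # v)) \<otimes>\<^bsub>P\<^esub> h) w \<oplus> ((\<lambda>v. g (x # v)) \<otimes>\<^bsub>P\<^esub> h) w"
    using Cons.prems by (intro Cons.IH) auto
  have cl: "((\<lambda>v. f (x # v)) \<otimes>\<^bsub>P\<^esub> h) w \<in> carrier R" "((\<lambda>v. g (x # v)) \<otimes>\<^bsub>P\<^esub> h) w \<in> carrier R"
    using Cons.prems by (auto intro!: coeffs_mult)
  show ?case
    using Cons.prems cl by (simp add: mult_Cons IH R.l_distr R.r_distr R.m_assoc) (simp add: R.a_ac)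
qed

lemma mult_assoc:
  assumes "coeffs f" "coeffs g" "coeffs h"
  shows "((f \<otimes>\<^bsub>P\<^esub> g) \<otimes>\<^bsub>P\<^esub> h) w = (f \<otimes>\<^bsub>P\<^esub> (g \<otimes>\<^bsub>P\<^esub> h)) w"
  using assms
proof (induction w arbitrary: f g h)
  case Nil
  then show ?case by (simp add: mult_Nil coeffs_mult R.m_assoc)
next
  case (Cons x w)
  note cf = Cons.prems
  have cl: "((\<lambda>v. g (x # v)) \<otimes>\<^bsub>P\<^esub> h) w \<in> carrier R" "((\<lambda>v. f (x # v)) \<otimes>\<^bsub>P\<^esub> (g \<otimes>\<^bsub>P\<^esub> h)) w \<in> carrier R"
    using cf by (auto intro!: coeffs_mult)
  have "(\<lambda>v. (f \<otimes>\<^bsub>P\<^esub> g) (x # v)) = (\<lambda>v. f [] \<otimes> g (x # v) \<oplus> ((\<lambda>v. f (x # v)) \<otimes>\<^bsub>P\<^esub> g) v)"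
    using cf by (simp add: mult_Cons)
  then have "((\<lambda>v. (f \<otimes>\<^bsub>P\<^esub> g) (x # v)) \<otimes>\<^bsub>P\<^esub> h) w =
      f [] \<otimes> ((\<lambda>v. g (x # v)) \<otimes>\<^bsub>P\<^esub> h) w \<oplus> (((\<lambda>v. f (x # v)) \<otimes>\<^bsub>P\<^esub> g) \<otimes>\<^bsub>P\<^esub> h) w"
    using cf by (simp add: mult_left_linear coeffs_mult)
  also have "(((\<lambda>v. f (x # v)) \<otimes>\<^bsub>P\<^esub> g) \<otimes>\<^bsub>P\<^esub> h) w = ((\<lambda>v. f (x # v)) \<otimes>\<^bsub>P\<^esub> (g \<otimes>\<^bsub>P\<^esub> h)) w"
    using cf by (intro Cons.IH) auto
  finally show ?case
    using cf cl by (simp add: mult_Cons mult_Nil coeffs_mult R.m_assoc R.r_distr R.a_assoc)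
qed

lemma carrier_mult:
  assumes f: "f \<in> carrier P" and g: "g \<in> carrier P" shows "f \<otimes>\<^bsub>P\<^esub> g \<in> carrier P"
proof -
  have "(f \<otimes>\<^bsub>P\<^esub> g) w = \<zero>" if w: "\<not> set w \<subseteq> A" for w
  proof -
    have "f (take k w) \<otimes> g (drop k w) = \<zero>" for k
    proof -
      have "\<not> set (take k w) \<subseteq> A \<or> \<not> set (drop k w) \<subseteq> A"
        using w by (metis append_take_drop_id set_append Un_subset_iff)
      then show ?thesis using f g by (auto simp: carrier_P)
    qed
    then show ?thesis unfolding P_mult using R.finsum_zero by simp
  qed
  then show ?thesis using f g by (auto simp: carrier_P intro: coeffs_mult)
qed

lemma one_mult: "coeffs f \<Longrightarrow> (\<one>\<^bsub>P\<^esub> \<otimes>\<^bsub>P\<^esub> f) w = f w"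
proof (cases w)
  case (Cons x v)
  assume f: "coeffs f"
  have z: "(\<lambda>v. \<one>\<^bsub>P\<^esub> (x # v)) = (\<lambda>v. \<zero>)" by (simp add: P_one)
  have "((\<lambda>v. \<zero>) \<otimes>\<^bsub>P\<^esub> f) v = \<zero>" using f by (simp add: P_mult)
  then show ?thesis using f Cons by (simp add: mult_Cons P_one)
qed (simp add: mult_Nil P_one)

lemma mult_one: "coeffs f \<Longrightarrow> (f \<otimes>\<^bsub>P\<^esub> \<one>\<^bsub>P\<^esub>) w = f w"
proof (induction w arbitrary: f)
  case (Cons x w)
  then show ?case by (simp add: mult_Cons P_one)
qed (simp add: mult_Nil P_one)

lemma zero_mult: "coeffs f \<Longrightarrow> ((\<lambda>v. \<zero>) \<otimes>\<^bsub>P\<^esub> f) w = \<zero>"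
  by (simp add: P_mult)

lemma mult_right_distrib:
  assumes "coeffs f" "coeffs g" "coeffs h"
  shows "(f \<otimes>\<^bsub>P\<^esub> (g \<oplus>\<^bsub>P\<^esub> h)) w = (f \<otimes>\<^bsub>P\<^esub> g) w \<oplus> (f \<otimes>\<^bsub>P\<^esub> h) w"
  using assms
proof (induction w arbitrary: f)
  case (Cons x w)
  have "((\<lambda>v. f (x # v)) \<otimes>\<^bsub>P\<^esub> (g \<oplus>\<^bsub>P\<^esub> h)) w = ((\<lambda>v. f (x # v)) \<otimes>\<^bsub>P\<^esub> g) w \<oplus> ((\<lambda>v. f (x # v)) \<otimes>\<^bsub>P\<^esub> h) w"
    using Cons.prems by (intro Cons.IH) auto
  moreover have "((\<lambda>v. f (x # v)) \<otimes>\<^bsub>P\<^esub> g) w \<in> carrier R" "((\<lambda>v. f (x # v)) \<otimes>\<^bsub>P\<^esub> h) w \<in> carrier R"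
    using Cons.prems by (auto intro!: coeffs_mult)
  moreover have "coeffs (g \<oplus>\<^bsub>P\<^esub> h)" using assms by (simp add: P_add)
  ultimately show ?case using Cons.prems
    unfolding mult_Cons[OF Cons.prems(1) \<open>coeffs (g \<oplus>\<^bsub>P\<^esub> h)\<close>] mult_Cons[OF Cons.prems(1,2)] mult_Cons[OF Cons.prems(1,3)]
    by (simp only: P_add R.r_distr) (simp add: R.r_distr R.a_ac)
qed (simp add: mult_Nil P_add R.r_distr)

lemma ring_P: "ring P"
proof (rule ringI)
  show "abelian_group P"
  proof (rule abelian_groupI)
    fix f assume f: "f \<in> carrier P"
    show "\<exists>g\<in>carrier P. g \<oplus>\<^bsub>P\<^esub> f = \<zero>\<^bsub>P\<^esub>"
      using f by (intro bexI[of _ "\<lambda>w. \<ominus> f w"]) (auto simp: carrier_P P_add P_zero R.l_neg fun_eq_iff)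
  qed (auto simp: carrier_P P_add P_zero fun_eq_iff R.a_ac)
  show "monoid P"
  proof (rule monoidI)
    show "\<one>\<^bsub>P\<^esub> \<in> carrier P" by (auto simp: carrier_P P_one)
  qed (auto simp: carrier_mult fun_eq_iff mult_assoc one_mult mult_one carrier_P[THEN iffD1])
next
  fix f g h assume "f \<in> carrier P" "g \<in> carrier P" "h \<in> carrier P"
  then have c: "coeffs f" "coeffs g" "coeffs h" by (auto simp: carrier_P)
  show "h \<otimes>\<^bsub>P\<^esub> (f \<oplus>\<^bsub>P\<^esub> g) = h \<otimes>\<^bsub>P\<^esub> f \<oplus>\<^bsub>P\<^esub> h \<otimes>\<^bsub>P\<^esub> g"
    using mult_right_distrib[OF c(3,1,2)] by (simp add: fun_eq_iff P_add)
  have "f \<oplus>\<^bsub>P\<^esub> g = (\<lambda>v. \<one> \<otimes> f v \<oplus> g v)" using c by (simp add: fun_eq_iff P_add)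
  from mult_left_linear[OF c R.one_closed, folded this]
  show "(f \<oplus>\<^bsub>P\<^esub> g) \<otimes>\<^bsub>P\<^esub> h = f \<otimes>\<^bsub>P\<^esub> h \<oplus>\<^bsub>P\<^esub> g \<otimes>\<^bsub>P\<^esub> h"
    by (intro ext) (simp only: P_add R.l_one[OF coeffs_mult[OF c(1,3)]])
qed

sublocale P: ring P by (rule ring_P)

lemma P_uminus: assumes "f \<in> carrier P" shows "(\<ominus>\<^bsub>P\<^esub> f) w = \<ominus> f w"
proof -
  have "f w \<oplus> (\<ominus>\<^bsub>P\<^esub> f) w = (f \<oplus>\<^bsub>P\<^esub> \<ominus>\<^bsub>P\<^esub> f) w" by (simp add: P_add)
  also have "\<dots> = \<zero>" using assms by (simp only: P.r_neg P_zero)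
  finally show ?thesis
    using assms P.a_inv_closed[OF assms] by (metis R.minus_equality R.a_comm carrier_P)
qed

lemma P_minus: "\<lbrakk>f \<in> carrier P; g \<in> carrier P\<rbrakk> \<Longrightarrow> (f \<ominus>\<^bsub>P\<^esub> g) w = f w \<ominus> g w"
  by (simp add: a_minus_def P_add P_uminus)

definition order_ge :: "nat \<Rightarrow> ('x list \<Rightarrow> 'r) set" where
  "order_ge k = {f \<in> carrier P. \<forall>w. length w < k \<longrightarrow> f w = \<zero>}"

lemma order_ge_minus: "\<lbrakk>f \<in> order_ge k; g \<in> order_ge k\<rbrakk> \<Longrightarrow> f \<ominus>\<^bsub>P\<^esub> g \<in> order_ge k"
  by (auto simp: order_ge_def P_minus R.minus_eq)

lemma order_ge_mult:
  assumes f: "f \<in> order_ge k" and g: "g \<in> order_ge l" shows "f \<otimes>\<^bsub>P\<^esub> g \<in> order_ge (k + l)"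
proof -
  have c: "coeffs f" "coeffs g" "f \<in> carrier P" "g \<in> carrier P" using f g by (auto simp: order_ge_def carrier_P)
  have "(f \<otimes>\<^bsub>P\<^esub> g) w = \<zero>" if w: "length w < k + l" for w
  proof -
    have "f (take i w) \<otimes> g (drop i w) = \<zero>" if "i \<le> length w" for i
    proof (cases "i < k")
      case True
      then have "f (take i w) = \<zero>" using f that by (simp add: order_ge_def)
      then show ?thesis using c by simp
    next
      case False
      then have "length (drop i w) < l" using w that by simp
      then have "g (drop i w) = \<zero>" using g by (simp add: order_ge_def)
      then show ?thesis using c by simp
    qed
    then have "(f \<otimes>\<^bsub>P\<^esub> g) w = (\<Oplus>i\<in>{..length w}. \<zero>)"
      unfolding P_mult by (intro R.finsum_cong') auto
    then show ?thesis by simp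
  qed
  then show ?thesis using carrier_mult[OF c(3,4)] by (simp add: order_ge_def)
qed

abbreviation one_plus :: "'x \<Rightarrow> 'x list \<Rightarrow> 'r" where
  "one_plus x \<equiv> \<one>\<^bsub>P\<^esub> \<oplus>\<^bsub>P\<^esub> nc_var R x"

lemma one_plus_closed: "x \<in> A \<Longrightarrow> one_plus x \<in> carrier P"
  by (auto simp: carrier_P P_add P_one nc_var_def)

lemma coeffs_one_plus: "coeffs (one_plus x)" by (auto simp: P_add P_one nc_var_def)

lemma one_plus_mult:
  assumes g: "coeffs g"
  shows "(one_plus x \<otimes>\<^bsub>P\<^esub> g) w = g w \<oplus> (case w of [] \<Rightarrow> \<zero> | y # v \<Rightarrow> if y = x then g v else \<zero>)"
proof (cases w)
  case Nil
  then show ?thesis using g by (simp add: mult_Nil coeffs_one_plus) (simp add: P_add P_one nc_var_def)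
next
  case (Cons y v)
  have "(\<lambda>v. one_plus x (y # v)) = (if y = x then \<one>\<^bsub>P\<^esub> else (\<lambda>v. \<zero>))"
    by (auto simp: fun_eq_iff P_add P_one nc_var_def)
  moreover have "one_plus x [] = \<one>" by (simp add: P_add P_one nc_var_def)
  ultimately show ?thesis
    using g Cons by (simp add: mult_Cons coeffs_one_plus one_mult zero_mult)
qed

text \<open>
  The inverse of \<open>1 + x\<close>, that is the series \<open>1 - x + x\<^sup>2 - \<dots>\<close>.
\<close>

definition geometric :: "'x \<Rightarrow> 'x list \<Rightarrow> 'r" where
  "geometric x w = (if set w \<subseteq> {x} then (\<ominus> \<one>) [^] length w else \<zero>)"

lemma coeffs_geometric: "coeffs (geometric x)" by (auto simp: geometric_def)

lemma geometric_closed: "x \<in> A \<Longrightarrow> geometric x \<in> carrier P"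
  by (auto simp: carrier_P geometric_def)

lemma geometric_Cons: "geometric x (y # w) = (if y = x then \<ominus> geometric x w else \<zero>)"
  by (auto simp: geometric_def R.r_minus R.l_minus R.m_comm)

lemma one_plus_geometric: "one_plus x \<otimes>\<^bsub>P\<^esub> geometric x = \<one>\<^bsub>P\<^esub>"
proof
  fix w show "(one_plus x \<otimes>\<^bsub>P\<^esub> geometric x) w = \<one>\<^bsub>P\<^esub> w"
    using coeffs_geometric[of x] unfolding one_plus_mult[OF coeffs_geometric]
    by (cases w) (auto simp: geometric_Cons P_one R.l_neg, auto simp: geometric_def)
qed

lemma geometric_one_plus: "geometric x \<otimes>\<^bsub>P\<^esub> one_plus x = \<one>\<^bsub>P\<^esub>"
proof
  fix w show "(geometric x \<otimes>\<^bsub>P\<^esub> one_plus x) w = \<one>\<^bsub>P\<^esub> w"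
  proof (induction w)
    case Nil
    show ?case by (simp add: mult_Nil coeffs_geometric coeffs_one_plus) (simp add: geometric_def P_add P_one nc_var_def)
  next
    case (Cons y w)
    have "(\<lambda>v. geometric x (y # v)) = (if y = x then \<lambda>v. (\<ominus> \<one>) \<otimes> geometric x v \<oplus> \<zero> else (\<lambda>v. \<zero>))"
      using coeffs_geometric[of x] by (auto simp: fun_eq_iff geometric_Cons R.l_minus)
    then have "((\<lambda>v. geometric x (y # v)) \<otimes>\<^bsub>P\<^esub> one_plus x) w =
        (if y = x then \<ominus> (geometric x \<otimes>\<^bsub>P\<^esub> one_plus x) w else \<zero>)"
      using mult_left_linear[OF coeffs_geometric[of x] _ coeffs_one_plus[of x], of "\<lambda>v. \<zero>" "\<ominus> \<one>" w]
        coeffs_mult[OF coeffs_geometric[of x] coeffs_one_plus[of x], of w]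
      by (simp add: zero_mult coeffs_one_plus R.l_minus)
    then show ?case
      unfolding mult_Cons[OF coeffs_geometric coeffs_one_plus] Cons.IH
      by (auto simp: geometric_def P_add P_one nc_var_def R.r_neg)
  qed
qed

lemma magnus_letter_eq:
  assumes "fst a \<in> A"
  shows "magnus_letter A R a = (if snd a then one_plus (fst a) else geometric (fst a))"
proof -
  have "inv\<^bsub>P\<^esub> one_plus (fst a) = geometric (fst a)"
    using P.inv_unique' one_plus_closed geometric_closed assms one_plus_geometric geometric_one_plus by metis
  then show ?thesis by (simp add: magnus_letter_def)
qed

lemma magnus_hom: "magnus A R \<in> hom (free_group A) P"
proof -
  have "magnus A R = word_eval P (magnus_letter A R)" by (simp add: magnus_def word_eval_def fun_eq_iff)
  moreover have "word_eval P (magnus_letter A R) \<in> hom (free_group A) P"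
    by (rule P.word_eval_hom)
      (auto simp: magnus_letter_eq inv_letter_def one_plus_closed geometric_closed one_plus_geometric geometric_one_plus)
  ultimately show ?thesis by simp
qed

lemma magnus_gen: "x \<in> A \<Longrightarrow> magnus A R (free_gen x) = one_plus x"
  using one_plus_closed by (simp add: magnus_def magnus_letter_eq)

end

context nc_power_series
begin

lemma magnus_closed: "w \<in> carrier (free_group A) \<Longrightarrow> magnus A R w \<in> carrier P"
  using magnus_hom by (auto simp: hom_def)

lemma magnus_mult: "\<lbrakk>u \<in> carrier (free_group A); v \<in> carrier (free_group A)\<rbrakk> \<Longrightarrow>
    magnus A R (u \<otimes>\<^bsub>free_group A\<^esub> v) = magnus A R u \<otimes>\<^bsub>P\<^esub> magnus A R v"
  using magnus_hom by (auto simp: hom_def)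

lemma magnus_one: "magnus A R \<one>\<^bsub>free_group A\<^esub> = \<one>\<^bsub>P\<^esub>"
  by (simp add: magnus_def free_group_def)

text \<open>
  The reason is the identity \<open>a b - b a = (a - 1) (b - 1) - (b - 1) (a - 1)\<close>.
\<close>

lemma commutator_of_order_ge:
  assumes a: "a \<in> carrier P" "a \<ominus>\<^bsub>P\<^esub> \<one>\<^bsub>P\<^esub> \<in> order_ge k" and b: "b \<in> carrier P" "b \<ominus>\<^bsub>P\<^esub> \<one>\<^bsub>P\<^esub> \<in> order_ge l"
  shows "a \<otimes>\<^bsub>P\<^esub> b \<ominus>\<^bsub>P\<^esub> b \<otimes>\<^bsub>P\<^esub> a \<in> order_ge (k + l)"
proof -
  define c d where "c = a \<ominus>\<^bsub>P\<^esub> \<one>\<^bsub>P\<^esub>" and "d = b \<ominus>\<^bsub>P\<^esub> \<one>\<^bsub>P\<^esub>"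
  have cd: "c \<in> carrier P" "d \<in> carrier P" using a b by (simp_all add: c_def d_def)
  have ac: "a = \<one>\<^bsub>P\<^esub> \<oplus>\<^bsub>P\<^esub> c" and bd: "b = \<one>\<^bsub>P\<^esub> \<oplus>\<^bsub>P\<^esub> d"
    using a b by (simp_all add: c_def d_def a_minus_def P.a_lcomm[of "\<one>\<^bsub>P\<^esub>"] P.r_neg)
  define s where "s = \<one>\<^bsub>P\<^esub> \<oplus>\<^bsub>P\<^esub> c \<oplus>\<^bsub>P\<^esub> d"
  have s: "s \<in> carrier P" using cd by (simp add: s_def)
  have "a \<otimes>\<^bsub>P\<^esub> b = s \<oplus>\<^bsub>P\<^esub> c \<otimes>\<^bsub>P\<^esub> d" "b \<otimes>\<^bsub>P\<^esub> a = s \<oplus>\<^bsub>P\<^esub> d \<otimes>\<^bsub>P\<^esub> c"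
    unfolding ac bd s_def using cd by (simp_all add: P.l_distr P.r_distr P.a_ac)
  then have "a \<otimes>\<^bsub>P\<^esub> b \<ominus>\<^bsub>P\<^esub> b \<otimes>\<^bsub>P\<^esub> a = (s \<oplus>\<^bsub>P\<^esub> \<ominus>\<^bsub>P\<^esub> s) \<oplus>\<^bsub>P\<^esub> (c \<otimes>\<^bsub>P\<^esub> d \<ominus>\<^bsub>P\<^esub> d \<otimes>\<^bsub>P\<^esub> c)"
    using s cd by (simp only: a_minus_def P.minus_add P.m_closed P.a_ac P.a_inv_closed P.a_closed)
  also have "\<dots> = c \<otimes>\<^bsub>P\<^esub> d \<ominus>\<^bsub>P\<^esub> d \<otimes>\<^bsub>P\<^esub> c" using s cd by (simp add: P.r_neg)
  also have "\<dots> \<in> order_ge (k + l)"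
    using order_ge_mult[of c k d l] order_ge_mult[of d l c k] a(2) b(2)
    by (intro order_ge_minus) (auto simp: c_def d_def add.commute)
  finally show ?thesis .
qed

text \<open>
  With \<open>q = u\<^sup>-\<^sup>1 v\<^sup>-\<^sup>1\<close> the commutator satisfies \<open>[u, v] - 1 = q (u v - v u)\<close>.
\<close>

lemma magnus_comm_order:
  assumes u: "u \<in> carrier (free_group A)" "magnus A R u \<ominus>\<^bsub>P\<^esub> \<one>\<^bsub>P\<^esub> \<in> order_ge k"
    and v: "v \<in> carrier (free_group A)" "magnus A R v \<ominus>\<^bsub>P\<^esub> \<one>\<^bsub>P\<^esub> \<in> order_ge l"
  shows "magnus A R (comm (free_group A) u v) \<ominus>\<^bsub>P\<^esub> \<one>\<^bsub>P\<^esub> \<in> order_ge (k + l)"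
proof -
  interpret F: group "free_group A" by (rule group_free_group)
  let ?M = "magnus A R"
  define q where "q = inv\<^bsub>free_group A\<^esub> u \<otimes>\<^bsub>free_group A\<^esub> inv\<^bsub>free_group A\<^esub> v"
  have q: "q \<in> carrier (free_group A)" using u v by (simp add: q_def)
  note cl = magnus_closed[OF u(1)] magnus_closed[OF v(1)] magnus_closed[OF q]
  have "comm (free_group A) u v = q \<otimes>\<^bsub>free_group A\<^esub> (u \<otimes>\<^bsub>free_group A\<^esub> v)"
    using u v by (simp add: comm_def q_def F.m_assoc)
  then have 1: "?M (comm (free_group A) u v) = ?M q \<otimes>\<^bsub>P\<^esub> (?M u \<otimes>\<^bsub>P\<^esub> ?M v)"
    using q u v by (simp add: magnus_mult)
  have "q \<otimes>\<^bsub>free_group A\<^esub> (v \<otimes>\<^bsub>free_group A\<^esub> u) = \<one>\<^bsub>free_group A\<^esub>"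
    using u v by (simp add: q_def F.m_assoc)
  then have 2: "\<one>\<^bsub>P\<^esub> = ?M q \<otimes>\<^bsub>P\<^esub> (?M v \<otimes>\<^bsub>P\<^esub> ?M u)"
    using magnus_mult[OF q, of "v \<otimes>\<^bsub>free_group A\<^esub> u"] u v by (simp add: magnus_mult magnus_one)
  have "?M (comm (free_group A) u v) \<ominus>\<^bsub>P\<^esub> \<one>\<^bsub>P\<^esub> = ?M q \<otimes>\<^bsub>P\<^esub> (?M u \<otimes>\<^bsub>P\<^esub> ?M v \<ominus>\<^bsub>P\<^esub> ?M v \<otimes>\<^bsub>P\<^esub> ?M u)"
    unfolding 1 by (subst 2) (use cl in \<open>simp add: a_minus_def P.r_distr P.r_minus\<close>)
  also have "\<dots> \<in> order_ge (0 + (k + l))"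
    using cl commutator_of_order_ge[OF cl(1) u(2) cl(2) v(2)] by (intro order_ge_mult) (auto simp: order_ge_def)
  finally show ?thesis by simp
qed

lemma minus_one_order_ge:
  assumes "f \<in> carrier P" "\<And>w. length w < k \<Longrightarrow> f w = \<one>\<^bsub>P\<^esub> w"
  shows "f \<ominus>\<^bsub>P\<^esub> \<one>\<^bsub>P\<^esub> \<in> order_ge k"
  using assms by (auto simp: order_ge_def P_minus P_one R.minus_eq R.r_neg)

lemma magnus_gen_order: "x \<in> A \<Longrightarrow> magnus A R (free_gen x) \<ominus>\<^bsub>P\<^esub> \<one>\<^bsub>P\<^esub> \<in> order_ge 1"
  using one_plus_closed[of x] by (auto simp: magnus_gen P_add P_one nc_var_def intro!: minus_one_order_ge)

end

lemma zassenhaus_degree_ge: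
  assumes "p > 1" and f: "f \<in> carrier (free_group A)"
    and ord: "magnus A (residue_ring (int p)) f \<ominus>\<^bsub>nc_series A (residue_ring (int p))\<^esub> \<one>\<^bsub>nc_series A (residue_ring (int p))\<^esub>
      \<in> nc_power_series.order_ge (residue_ring (int p)) A k"
  shows "enat k \<le> zassenhaus_degree p A f"
proof -
  interpret residues "int p" "residue_ring (int p)" using assms by unfold_locales auto
  interpret nc_power_series "residue_ring (int p)" A by (intro nc_power_series.intro cring)
  show ?thesis unfolding zassenhaus_degree_def Let_def
  proof (rule INF_greatest)
    fix m assume "m \<in> {m. (magnus A (residue_ring (int p)) f \<ominus>\<^bsub>P\<^esub> \<one>\<^bsub>P\<^esub>) m \<noteq> \<zero>\<^bsub>residue_ring (int p)\<^esub>}"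
    then have "\<not> length m < k" using ord by (auto simp: order_ge_def)
    then show "enat k \<le> enat (length m)" by simp
  qed
qed

text \<open>
  The coefficient of \<open>x\<^sup>j\<close> in \<open>(1 + x)\<^sup>p\<close> is a binomial coefficient, which \<open>p\<close> divides for \<open>0 < j < p\<close>.
\<close>

lemma zassenhaus_degree_power:
  assumes p: "Factorial_Ring.prime p" and x: "x \<in> A"
  shows "enat p \<le> zassenhaus_degree p A (free_gen x [^]\<^bsub>free_group A\<^esub> p)"
proof -
  have p1: "p > 1" using p prime_gt_1_nat by auto
  interpret residues "int p" "residue_ring (int p)" using p1 by unfold_locales auto
  interpret nc_power_series "residue_ring (int p)" A by (intro nc_power_series.intro cring)
  interpret F: group "free_group A" by (rule group_free_group)
  note x' = free_gen_closed[OF x]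
  have res: "a \<oplus>\<^bsub>residue_ring (int p)\<^esub> b = (a + b) mod int p" "\<zero>\<^bsub>residue_ring (int p)\<^esub> = 0" "\<one>\<^bsub>residue_ring (int p)\<^esub> = 1" for a b
    by (simp_all add: residue_ring_def)
  have coef: "magnus A (residue_ring (int p)) (free_gen x [^]\<^bsub>free_group A\<^esub> k) w =
      (if set w \<subseteq> {x} then int (k choose length w) mod int p else 0)" for k w
  proof (induction k arbitrary: w)
    case 0
    show ?case using p1 by (cases w) (auto simp: magnus_one P_one res)
  next
    case (Suc k)
    let ?f = "magnus A (residue_ring (int p)) (free_gen x [^]\<^bsub>free_group A\<^esub> k)"
    have "magnus A (residue_ring (int p)) (free_gen x [^]\<^bsub>free_group A\<^esub> Suc k) = one_plus x \<otimes>\<^bsub>P\<^esub> ?f"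
      unfolding F.nat_pow_Suc2[OF x'] using x x' by (simp add: magnus_mult magnus_gen)
    moreover have "coeffs ?f" using magnus_closed[of "free_gen x [^]\<^bsub>free_group A\<^esub> k"] x' by (simp add: carrier_P)
    ultimately show ?case
      by (cases w) (auto simp: one_plus_mult Suc res mod_add_eq add.commute)
  qed
  have "magnus A (residue_ring (int p)) (free_gen x [^]\<^bsub>free_group A\<^esub> p) \<ominus>\<^bsub>P\<^esub> \<one>\<^bsub>P\<^esub> \<in> order_ge p"
  proof -
    have "magnus A (residue_ring (int p)) (free_gen x [^]\<^bsub>free_group A\<^esub> p) w = \<one>\<^bsub>P\<^esub> w" if "length w < p" for w
    proof (cases "w = []")
      case False
      then have "int p dvd int (p choose length w)"
        using dvd_choose_prime[of "length w" p] p that by (simp add: int_dvd_int_iff)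
      then show ?thesis using False by (simp add: coef P_one res)
    qed (use p1 in \<open>simp add: coef P_one res\<close>)
    then show ?thesis using magnus_closed[of "free_gen x [^]\<^bsub>free_group A\<^esub> p"] x'
      by (intro minus_one_order_ge) auto
  qed
  then show ?thesis using x' by (intro zassenhaus_degree_ge[OF p1]) auto
qed

lemma zassenhaus_degree_commutators:
  assumes p: "p > 1" and abc: "a \<in> A" "b \<in> A" "c \<in> A"
  shows "2 \<le> zassenhaus_degree p A (comm (free_group A) (free_gen a) (free_gen b))"
    and "3 \<le> zassenhaus_degree p A (comm (free_group A) (comm (free_group A) (free_gen a) (free_gen b)) (free_gen c))"
proof -
  interpret residues "int p" "residue_ring (int p)" using p by unfold_locales auto
  interpret nc_power_series "residue_ring (int p)" A by (intro nc_power_series.intro cring)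
  interpret F: group "free_group A" by (rule group_free_group)
  note cl = abc[THEN free_gen_closed]
  note two = magnus_comm_order[OF cl(1) magnus_gen_order[OF abc(1)] cl(2) magnus_gen_order[OF abc(2)]]
  have c2: "comm (free_group A) (free_gen a) (free_gen b) \<in> carrier (free_group A)" using cl by simp
  note three = magnus_comm_order[OF c2 two cl(3) magnus_gen_order[OF abc(3)]]
  show "2 \<le> zassenhaus_degree p A (comm (free_group A) (free_gen a) (free_gen b))"
    using zassenhaus_degree_ge[OF p c2 two] by (simp add: numeral_eq_enat eval_nat_numeral)
  show "3 \<le> zassenhaus_degree p A (comm (free_group A) (comm (free_group A) (free_gen a) (free_gen b)) (free_gen c))"
    using zassenhaus_degree_ge[OF p _ three] c2 cl by (simp add: numeral_eq_enat eval_nat_numeral)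
qed

section \<open>The Golod-Shafarevich inequality\<close>

text \<open>
  Exchanging the sum over degrees with the sum over relators, each relator contributes a single power of \<open>t\<close>, or nothing
  if its degree is infinite or zero; as \<open>t < 1\<close>, a lower bound on the degree suffices.
\<close>

lemma degree_series_bound:
  fixes t :: real and lb :: "'x letter list \<Rightarrow> nat"
  assumes R: "finite R" and t: "0 < t" "t < 1"
    and lb: "\<And>r. r \<in> R \<Longrightarrow> enat (lb r) \<le> zassenhaus_degree p A r"
  defines "c \<equiv> \<lambda>i. real (card (relators_of_degree p A R (Suc i))) * t ^ Suc i"
  shows "summable c" and "suminf c \<le> (\<Sum>r\<in>R. t ^ lb r)"
proof -
  define s where "s r = (if \<exists>i. zassenhaus_degree p A r = enat (Suc i)
      then t ^ (the_enat (zassenhaus_degree p A r)) else 0)" for r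
  have sums: "(\<lambda>i. if zassenhaus_degree p A r = enat (Suc i) then t ^ Suc i else 0) sums s r" for r
  proof (cases "\<exists>i. zassenhaus_degree p A r = enat (Suc i)")
    case True
    then obtain d where d: "zassenhaus_degree p A r = enat (Suc d)" by blast
    have "(\<lambda>i. if i = d then t ^ Suc i else 0) sums (t ^ Suc d)" by (rule sums_single)
    moreover have "(\<lambda>i. if zassenhaus_degree p A r = enat (Suc i) then t ^ Suc i else 0) = (\<lambda>i. if i = d then t ^ Suc i else 0)"
      by (auto simp: d)
    ultimately show ?thesis by (simp add: s_def d)
  next
    case False
    then have "(\<lambda>i. if zassenhaus_degree p A r = enat (Suc i) then t ^ Suc i else 0) = (\<lambda>i. 0)" by auto
    then show ?thesis using False by (simp add: s_def)
  qed
  have c: "c = (\<lambda>i. \<Sum>r\<in>R. if zassenhaus_degree p A r = enat (Suc i) then t ^ Suc i else 0)"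
    using R by (auto simp: c_def relators_of_degree_def sum.If_cases Int_def)
  have cs: "c sums (\<Sum>r\<in>R. s r)" unfolding c by (intro sums_sum sums)
  show "summable c" using cs by (rule sums_summable)
  have "s r \<le> t ^ lb r" if r: "r \<in> R" for r
  proof (cases "\<exists>i. zassenhaus_degree p A r = enat (Suc i)")
    case True
    then obtain d where d: "zassenhaus_degree p A r = enat (Suc d)" by blast
    then have "lb r \<le> Suc d" using lb[OF r] by simp
    then have "t ^ Suc d \<le> t ^ lb r" using t by (intro power_decreasing) auto
    then show ?thesis by (simp add: s_def d)
  qed (use t in \<open>simp add: s_def\<close>)
  then show "suminf c \<le> (\<Sum>r\<in>R. t ^ lb r)"
    using cs by (simp add: sums_iff sum_mono)
qed

definition class_size :: "nat \<Rightarrow> nat \<Rightarrow> nat" where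
  "class_size n a = card {b. b < n \<and> b mod 9 = a mod 9}"

lemma class_size_le: "9 * class_size n a \<le> n + 8"
proof -
  have inj: "inj_on (\<lambda>b. b div 9) {b. b < n \<and> b mod 9 = a mod 9}"
    by (auto simp: inj_on_def) (metis div_mult_mod_eq)
  have "(\<lambda>b. b div 9) ` {b. b < n \<and> b mod 9 = a mod 9} \<subseteq> {..<(n + 8) div 9}"
    by auto
  from card_mono[OF _ this] have "class_size n a \<le> (n + 8) div 9"
    unfolding class_size_def using card_image[OF inj] by simp
  then show ?thesis by linarith
qed

lemma finite_index_sets: "finite (same_class_pairs n)" "finite (mixed_triples n)"
proof -
  have "same_class_pairs n \<subseteq> {..<n} \<times> {..<n}" by (auto simp: same_class_pairs_def)
  then show "finite (same_class_pairs n)" by (rule finite_subset) auto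
  have "mixed_triples n \<subseteq> {..<n} \<times> {..<n} \<times> {..<n}" by (auto simp: mixed_triples_def)
  then show "finite (mixed_triples n)" by (rule finite_subset) auto
qed

text \<open>
  Together with their mirror images, these pairs run over all \<open>a < n\<close> and all other elements of the class of \<open>a\<close>.
\<close>

lemma card_same_class_pairs: "18 * card (same_class_pairs n) \<le> n * (n - 1)"
proof -
  let ?swap = "(\<lambda>(a, b). (b, a)) ` same_class_pairs n"
  have swap: "card ?swap = card (same_class_pairs n)" by (intro card_image) (auto simp: inj_on_def)
  have "same_class_pairs n \<inter> ?swap = {}" by (auto simp: same_class_pairs_def)
  then have "2 * card (same_class_pairs n) = card (same_class_pairs n \<union> ?swap)"
    using swap finite_index_sets by (simp add: card_Un_disjoint)
  also have "same_class_pairs n \<union> ?swap = Sigma {..<n} (\<lambda>a. {b. b < n \<and> b mod 9 = a mod 9} - {a})"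
    by (auto simp: same_class_pairs_def image_iff)
  also have "card \<dots> = (\<Sum>a<n. class_size n a - 1)"
    by (simp add: class_size_def card_Diff_singleton)
  also have "9 * \<dots> = (\<Sum>a<n. 9 * (class_size n a - 1))" by (rule sum_distrib_left)
  also have "\<dots> \<le> (\<Sum>a<n. n - 1)"
  proof (rule sum_mono)
    fix a show "9 * (class_size n a - 1) \<le> n - 1" using class_size_le[of n a] by linarith
  qed
  finally show ?thesis by simp
qed

text \<open>
  An index \<open>a\<close> in a class of size \<open>k\<close> occurs in \<open>k (n - k)\<close> triples. This is increasing in \<open>k \<le> n / 2\<close>, so it is at most
  its value at \<open>k = (n + 8) / 9\<close>, which is \<open>8 (n + 8) (n - 1) / 81\<close>.
\<close>

lemma card_mixed_triples:
  assumes "n \<ge> 3"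
  shows "81 * real (card (mixed_triples n)) \<le> 8 * real n * (real n + 8) * (real n - 1)"
proof -
  let ?C = "\<lambda>a. {b. b < n \<and> b mod 9 = a mod 9}"
  have fC: "finite (?C a)" for a by auto
  have "mixed_triples n = Sigma {..<n} (\<lambda>a. ({..<n} - ?C a) \<times> ?C a)"
    by (auto simp: mixed_triples_def)
  then have "card (mixed_triples n) = (\<Sum>a<n. card (({..<n} - ?C a) \<times> ?C a))"
    using fC by simp
  also have "\<dots> = (\<Sum>a<n. (n - class_size n a) * class_size n a)"
  proof (intro sum.cong refl)
    fix a
    have "card ({..<n} - ?C a) = n - class_size n a"
      unfolding class_size_def by (subst card_Diff_subset) auto
    then show "card (({..<n} - ?C a) \<times> ?C a) = (n - class_size n a) * class_size n a"
      by (simp add: card_cartesian_product class_size_def)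
  qed
  finally have "81 * real (card (mixed_triples n)) = (\<Sum>a<n. 81 * real ((n - class_size n a) * class_size n a))"
    by (simp add: sum_distrib_left)
  also have "\<dots> \<le> (\<Sum>a<n. 8 * (real n + 8) * (real n - 1))"
  proof (rule sum_mono)
    fix a
    define k where "k = real (class_size n a)"
    have le: "class_size n a \<le> n" unfolding class_size_def using card_mono[of "{..<n}" "?C a"] by auto
    have "9 * k \<le> real n + 8" using class_size_le[of n a] by (simp add: k_def)
    moreover have "0 \<le> 8 * (real n) - 8 - 9 * k" using \<open>9 * k \<le> real n + 8\<close> assms by simp
    ultimately have "0 \<le> (real n + 8 - 9 * k) * (8 * real n - 8 - 9 * k)" by (intro mult_nonneg_nonneg) auto
    then show "81 * real ((n - class_size n a) * class_size n a) \<le> 8 * (real n + 8) * (real n - 1)"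
      using le by (simp add: of_nat_diff k_def algebra_simps)
  qed
  finally show ?thesis by (simp add: algebra_simps)
qed

text \<open>
  With \<open>s = n t\<close>, the left-hand side is close to \<open>1 - s + s\<^sup>2 / 18 + 8 s\<^sup>3 / 81\<close>, whose minimum is about \<open>- 0.055\<close>,
  near \<open>s = 1.66\<close>. The errors, of relative size \<open>7 / n\<close> in the cubic term, still leave a negative value at
  \<open>s = 1.62\<close> when \<open>n = 99\<close>.
\<close>

lemma golod_shafarevich_inequality:
  fixes n :: nat
  assumes n: "n \<ge> 99" and P2: "18 * P2 \<le> real n * (real n - 1)" and p: "p \<ge> 3"
    and P3: "81 * P3 \<le> 8 * real n * (real n + 8) * (real n - 1)"
  defines "t \<equiv> 81 / (50 * real n)"
  shows "1 - real n * t + (real n * t ^ p + P2 * t ^ 2 + P3 * t ^ 3) < 0"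
proof -
  define N where "N = real n"
  have N: "N \<ge> 99" using n by (simp add: N_def)
  have t: "0 < t" "t < 1" "N * t = 81 / 50" using N by (auto simp: t_def N_def)
  have "P2 * t ^ 2 \<le> N\<^sup>2 / 18 * t ^ 2"
  proof (intro mult_right_mono)
    have "N * (N - 1) \<le> N\<^sup>2" using N by (simp add: power2_eq_square algebra_simps)
    then show "P2 \<le> N\<^sup>2 / 18" using P2 by (simp add: N_def)
  qed simp
  also have "N\<^sup>2 / 18 * t ^ 2 = (N * t) ^ 2 / 18" by (simp add: power_mult_distrib)
  finally have b2: "P2 * t ^ 2 \<le> (81 / 50) ^ 2 / 18" unfolding t(3) .
  have "P3 * t ^ 3 \<le> (848 / 8019) * N ^ 3 * t ^ 3"
  proof (intro mult_right_mono)
    have "0 \<le> (N - 99) * (7 * N) + 792" using N by (intro add_nonneg_nonneg mult_nonneg_nonneg) auto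
    then have "99 * ((N + 8) * (N - 1)) \<le> 106 * N\<^sup>2" by (simp add: algebra_simps power2_eq_square)
    from mult_left_mono[OF this, of "8 * N"]
    have "99 * (81 * P3) \<le> 8 * N * (106 * N\<^sup>2)" using P3 N by (simp add: N_def algebra_simps)
    then show "P3 \<le> (848 / 8019) * N ^ 3" by (simp add: power3_eq_cube power2_eq_square)
  qed (use t in simp)
  also have "\<dots> = (848 / 8019) * (N * t) ^ 3" by (simp add: power_mult_distrib)
  finally have b3: "P3 * t ^ 3 \<le> (848 / 8019) * (81 / 50) ^ 3" unfolding t(3) .
  have "t \<le> 81 / (50 * 99)" unfolding t_def N_def[symmetric] using N by (intro frac_le) auto
  then have "t\<^sup>2 \<le> (81 / (50 * 99))\<^sup>2" using t by (intro power_mono) auto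
  have "N * t ^ p \<le> N * t ^ 3" using N t p by (intro mult_left_mono power_decreasing) auto
  also have "\<dots> = (N * t) * t\<^sup>2" by (simp add: power3_eq_cube power2_eq_square)
  also have "\<dots> \<le> (81 / 50) * (81 / (50 * 99))\<^sup>2"
    unfolding t(3) using \<open>t\<^sup>2 \<le> (81 / (50 * 99))\<^sup>2\<close> by (intro mult_left_mono) auto
  finally have bp: "N * t ^ p \<le> (81 / 50) * (81 / (50 * 99))\<^sup>2" .
  have "1 - 81 / 50 + ((81 / 50) * (81 / (50 * 99))\<^sup>2 + (81 / 50) ^ 2 / 18 + (848 / 8019) * (81 / 50) ^ 3) < (0::real)"
    by (simp add: power2_eq_square power3_eq_cube)
  then show ?thesis using b2 b3 bp t(3) unfolding N_def[symmetric] by linarith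
qed

lemma golod_shafarevich_condition_relators:
  assumes n: "n \<ge> 99" and p: "Factorial_Ring.prime p" "p \<ge> 3"
  shows "golod_shafarevich_condition p {..<n} (relators p n)"
proof -
  define F where "F = free_group {..<n}"
  define R1 where "R1 = (\<lambda>a. free_gen a [^]\<^bsub>F\<^esub> p) ` {..<n}"
  define R2 where "R2 = (\<lambda>(a, b). comm F (free_gen a) (free_gen b)) ` same_class_pairs n"
  define R3 where "R3 = (\<lambda>(a, b, c). comm F (comm F (free_gen a) (free_gen b)) (free_gen c)) ` mixed_triples n"
  have R: "relators p n = R1 \<union> R2 \<union> R3" by (simp add: relators_def Let_def F_def R1_def R2_def R3_def)
  have fin: "finite R1" "finite R2" "finite R3" using finite_index_sets by (auto simp: R1_def R2_def R3_def)
  have card: "card R1 \<le> n" "card R2 \<le> card (same_class_pairs n)" "card R3 \<le> card (mixed_triples n)"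
    unfolding R1_def R2_def R3_def using card_image_le finite_index_sets by (force intro: card_image_le)+
  define t where "t = 81 / (50 * real n)"
  have t: "0 < t" "t < 1" using n by (auto simp: t_def)
  define lb where "lb r = (if r \<in> R3 then 3 else if r \<in> R2 then 2 else p)" for r
  have p1: "p > 1" using p by simp
  have lb: "enat (lb r) \<le> zassenhaus_degree p {..<n} r" if "r \<in> relators p n" for r
  proof -
    have "enat p \<le> zassenhaus_degree p {..<n} r" if "r \<in> R1"
      using that zassenhaus_degree_power[OF p(1), of _ "{..<n}"] by (auto simp: R1_def F_def)
    moreover have "enat 2 \<le> zassenhaus_degree p {..<n} r" if "r \<in> R2"
      using that zassenhaus_degree_commutators(1)[OF p1, of _ "{..<n}"]
      by (auto simp: R2_def F_def same_class_pairs_def numeral_eq_enat)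
    moreover have "enat 3 \<le> zassenhaus_degree p {..<n} r" if "r \<in> R3"
      using that zassenhaus_degree_commutators(2)[OF p1, of _ "{..<n}"]
      by (auto simp: R3_def F_def mixed_triples_def numeral_eq_enat)
    ultimately show ?thesis using that by (auto simp: lb_def R)
  qed
  define c where "c i = real (card (relators_of_degree p {..<n} (relators p n) (Suc i))) * t ^ Suc i" for i
  have finR: "finite (relators p n)" using fin by (simp add: R)
  note bound = degree_series_bound[OF finR t lb, folded c_def]
  have "(\<Sum>r\<in>relators p n. t ^ lb r) \<le> (\<Sum>r\<in>R1. t ^ p) + (\<Sum>r\<in>R2. t ^ 2) + (\<Sum>r\<in>R3. t ^ 3)"
  proof -
    have "(\<Sum>r\<in>relators p n. t ^ lb r) = (\<Sum>r\<in>R1 - R2 - R3. t ^ p) + (\<Sum>r\<in>R2 - R3. t ^ 2) + (\<Sum>r\<in>R3. t ^ 3)"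
    proof -
      have "relators p n = ((R1 - R2 - R3) \<union> (R2 - R3)) \<union> R3" by (auto simp: R)
      moreover have "(\<Sum>r\<in>((R1 - R2 - R3) \<union> (R2 - R3)) \<union> R3. t ^ lb r) =
          (\<Sum>r\<in>R1 - R2 - R3. t ^ lb r) + (\<Sum>r\<in>R2 - R3. t ^ lb r) + (\<Sum>r\<in>R3. t ^ lb r)"
        using fin by (subst sum.union_disjoint; (subst sum.union_disjoint)?; auto)+
      ultimately show ?thesis by (simp add: lb_def)
    qed
    also have "\<dots> \<le> (\<Sum>r\<in>R1. t ^ p) + (\<Sum>r\<in>R2. t ^ 2) + (\<Sum>r\<in>R3. t ^ 3)"
      using fin t by (intro add_mono sum_mono2) auto
    finally show ?thesis .
  qed
  also have "\<dots> = real (card R1) * t ^ p + real (card R2) * t ^ 2 + real (card R3) * t ^ 3" by simp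
  also have "\<dots> \<le> real n * t ^ p + real (card (same_class_pairs n)) * t ^ 2 + real (card (mixed_triples n)) * t ^ 3"
    using card t by (intro add_mono mult_right_mono) auto
  finally have "suminf c \<le> real n * t ^ p + real (card (same_class_pairs n)) * t ^ 2 + real (card (mixed_triples n)) * t ^ 3"
    using bound(2) by linarith
  moreover have "18 * real (card (same_class_pairs n)) \<le> real n * (real n - 1)"
  proof -
    have "real (18 * card (same_class_pairs n)) \<le> real (n * (n - 1))"
      using card_same_class_pairs[of n] by (intro of_nat_mono)
    then show ?thesis using n by (simp add: of_nat_diff)
  qed
  ultimately have "1 - real n * t + suminf c < 0"
    using golod_shafarevich_inequality[OF n _ p(2) card_mixed_triples, of "real (card (same_class_pairs n))"] n
    unfolding t_def[symmetric] by simp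
  moreover have "finite (relators_of_degree p {..<n} (relators p n) i)" for i
    using finR by (auto simp: relators_of_degree_def)
  ultimately show ?thesis
    unfolding golod_shafarevich_condition_def using t bound(1)
    by (intro exI[of _ t]) (simp add: c_def[symmetric] del: power_Suc)
qed

section \<open>Generators of the pro-\<open>p\<close> completion\<close>

lemma (in group_hom) card_rcosets_kernel:
  "card (rcosets\<^bsub>G\<^esub> (kernel G H h)) = card (h ` carrier G)"
proof -
  have eq: "the_elem (h ` (kernel G H h #> g)) = h g" if g: "g \<in> carrier G" for g
  proof -
    have "h ` (kernel G H h #> g) = {h g}"
      using g G.rcos_self[OF g subgroup_kernel] by (auto simp: r_coset_def kernel_def)
    then show ?thesis by simp
  qed
  have "(\<lambda>K. the_elem (h ` K)) ` carrier (G Mod kernel G H h) = h ` carrier G"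
    unfolding carrier_FactGroup image_image using eq by (intro image_cong) auto
  then have "card (h ` carrier G) = card (carrier (G Mod kernel G H h))"
    using card_image[OF FactGroup_inj_on] by simp
  then show ?thesis by (simp add: FactGroup_def)
qed

locale pro_p = group G for G :: "'g monoid" (structure) +
  fixes p :: nat
  assumes prime_p: "Factorial_Ring.prime p"
begin

abbreviation p_normals where "p_normals \<equiv> p_power_index_normal p G"
abbreviation pro_p_group where "pro_p_group \<equiv> pro_p_completion p G"

lemma p_normals_D: "N \<in> p_normals \<Longrightarrow> N \<lhd> G" by (simp add: p_power_index_normal_def)

lemma p_normals_finite: "N \<in> p_normals \<Longrightarrow> finite (carrier (G Mod N)) \<and> (\<exists>k. card (carrier (G Mod N)) = p ^ k)"
proof -
  assume "N \<in> p_normals"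
  then obtain k where k: "card (carrier (G Mod N)) = p ^ k"
    by (auto simp: p_power_index_normal_def FactGroup_def)
  then have "finite (carrier (G Mod N))"
    using prime_gt_0_nat[OF prime_p] by (intro card_ge_0_finite) simp
  with k show ?thesis by blast
qed

lemma p_normals_group: "N \<in> p_normals \<Longrightarrow> group (G Mod N)"
  using p_normals_D normal.factorgroup_is_group by blast

lemma carrier_p_normals: "carrier G \<in> p_normals"
proof -
  have n: "carrier G \<lhd> G" by (intro normal_invI subgroup_self) auto
  have "rcosets (carrier G) = {carrier G}"
    using coset_join2[OF _ subgroup_self] by (auto simp: RCOSETS_def)
  then show ?thesis using n by (auto simp: p_power_index_normal_def intro: exI[of _ 0])
qed

lemma kernel_p_normals:
  assumes h: "group_hom G K h" and K: "finite (carrier K)" "order K = p ^ k"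
  shows "kernel G K h \<in> p_normals"
proof -
  interpret group_hom G K h by (rule h)
  have "card (h ` carrier G) dvd p ^ k"
    using K H.lagrange[OF img_is_subgroup] by (metis dvd_triv_right)
  then obtain j where "card (h ` carrier G) = p ^ j"
    using divides_primepow_nat[OF prime_p] by blast
  then show ?thesis using normal_kernel card_rcosets_kernel by (auto simp: p_power_index_normal_def)
qed

lemma coset_hom: "N \<in> p_normals \<Longrightarrow> group_hom G (G Mod N) (\<lambda>g. N #> g)"
  using p_normals_group p_normals_D normal.r_coset_hom_Mod is_group
  by (auto simp: group_hom_def group_hom_axioms_def)

lemma coset_eq_iff:
  assumes "N \<in> p_normals" "g \<in> carrier G" "h \<in> carrier G" shows "N #> g = N #> h \<longleftrightarrow> g \<in> N #> h"
  using assms p_normals_D rcos_self repr_independence normal_imp_subgroup by metis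

text \<open>
  The intersection is the kernel of the map into the product of the two quotients.
\<close>

lemma Int_p_normals:
  assumes N: "N \<in> p_normals" and M: "M \<in> p_normals" shows "N \<inter> M \<in> p_normals"
proof -
  interpret N: group_hom G "G Mod N" "\<lambda>g. N #> g" by (rule coset_hom[OF N])
  interpret M: group_hom G "G Mod M" "\<lambda>g. M #> g" by (rule coset_hom[OF M])
  interpret P: group "(G Mod N) \<times>\<times> (G Mod M)" by (intro DirProd_group N.H.is_group M.H.is_group)
  let ?h = "\<lambda>g. (N #> g, M #> g)"
  have h: "group_hom G ((G Mod N) \<times>\<times> (G Mod M)) ?h"
    using N.hom_closed M.hom_closed by unfold_locales (auto simp: hom_def)
  obtain k l where kl: "card (carrier (G Mod N)) = p ^ k" "card (carrier (G Mod M)) = p ^ l"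
    using p_normals_finite N M by blast
  have "kernel G ((G Mod N) \<times>\<times> (G Mod M)) ?h \<in> p_normals"
  proof (rule kernel_p_normals[OF h])
    show "finite (carrier ((G Mod N) \<times>\<times> (G Mod M)))" using p_normals_finite N M by auto
    show "order ((G Mod N) \<times>\<times> (G Mod M)) = p ^ (k + l)"
      using kl by (simp add: order_def card_cartesian_product power_add)
  qed
  moreover have "kernel G ((G Mod N) \<times>\<times> (G Mod M)) ?h = N \<inter> M"
  proof -
    have "N #> g = N \<longleftrightarrow> g \<in> N" if "N \<in> p_normals" "g \<in> carrier G" for N g
      using coset_join2[OF that(2) normal_imp_subgroup[OF p_normals_D[OF that(1)]]]
        rcos_self[OF that(2) normal_imp_subgroup[OF p_normals_D[OF that(1)]]] by auto
    moreover have "N \<subseteq> carrier G" using p_normals_D[OF N] normal_imp_subgroup subgroup.subset by blast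
    ultimately show ?thesis using N M by (auto simp: kernel_def)
  qed
  ultimately show ?thesis by simp
qed

lemma finite_Int_p_normals: "\<lbrakk>finite J; J \<subseteq> p_normals\<rbrakk> \<Longrightarrow> \<exists>N\<in>p_normals. \<forall>M\<in>J. N \<subseteq> M"
proof (induction J rule: finite_induct)
  case empty
  then show ?case using carrier_p_normals by blast
next
  case (insert M J)
  then obtain N where N: "N \<in> p_normals" "\<forall>M\<in>J. N \<subseteq> M" by auto
  have "N \<inter> M \<in> p_normals" using Int_p_normals[OF N(1)] insert.prems by simp
  then show ?case using N(2) by (intro bexI[of _ "N \<inter> M"]) auto
qed

lemma pro_p_group_simps:
  "carrier pro_p_group = {x \<in> (\<Pi>\<^sub>E N\<in>p_normals. carrier (G Mod N)). \<forall>N\<in>p_normals. \<forall>M\<in>p_normals. N \<subseteq> M \<longrightarrow> x N \<subseteq> x M}"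
  "pro_p_group = (product_group p_normals (\<lambda>N. G Mod N))\<lparr>carrier := carrier pro_p_group\<rparr>"
  by (simp_all add: pro_p_completion_def Let_def)

lemma pro_p_group_mem: "\<lbrakk>x \<in> carrier pro_p_group; N \<in> p_normals\<rbrakk> \<Longrightarrow> x N \<in> carrier (G Mod N)"
  and pro_p_group_mono: "\<lbrakk>x \<in> carrier pro_p_group; N \<in> p_normals; M \<in> p_normals; N \<subseteq> M\<rbrakk> \<Longrightarrow> x N \<subseteq> x M"
  unfolding pro_p_group_simps(1) by (blast dest: PiE_mem)+

lemma group_pro_p_group: "group pro_p_group"
proof -
  interpret P: group "product_group p_normals (\<lambda>N. G Mod N)" using p_normals_group by simp
  have "subgroup (carrier pro_p_group) (product_group p_normals (\<lambda>N. G Mod N))"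
  proof (rule P.subgroupI)
    show "carrier pro_p_group \<subseteq> carrier (product_group p_normals (\<lambda>N. G Mod N))" by (auto simp: pro_p_group_simps(1))
    have "(\<lambda>N\<in>p_normals. N) \<in> carrier pro_p_group"
      using p_normals_group group.is_monoid monoid.one_closed[of "G Mod _"] by (fastforce simp: pro_p_group_simps(1) FactGroup_def)
    then show "carrier pro_p_group \<noteq> {}" by blast
    fix x assume x: "x \<in> carrier pro_p_group"
    have ix: "inv\<^bsub>G Mod N\<^esub> x N = set_inv (x N)" if "N \<in> p_normals" for N
      using x that p_normals_D by (intro normal.inv_FactGroup) (auto simp: pro_p_group_simps(1))
    have cl: "set_inv (x N) \<in> carrier (G Mod N)" if "N \<in> p_normals" for N
      using group.inv_closed[OF p_normals_group[OF that], of "x N"] x that ix[OF that] by (auto simp: pro_p_group_simps(1))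
    have "set_inv (x N) \<subseteq> set_inv (x M)" if "N \<in> p_normals" "M \<in> p_normals" "N \<subseteq> M" for N M
      using x that by (fastforce simp: pro_p_group_simps(1) SET_INV_def)
    then show "inv\<^bsub>product_group p_normals (\<lambda>N. G Mod N)\<^esub> x \<in> carrier pro_p_group"
      using x p_normals_group ix cl by (auto simp: pro_p_group_simps(1) PiE_iff)
    fix y assume y: "y \<in> carrier pro_p_group"
    have cl': "x N <#> y N \<in> carrier (G Mod N)" if "N \<in> p_normals" for N
      using monoid.m_closed[OF group.is_monoid[OF p_normals_group[OF that]] pro_p_group_mem[OF x that] pro_p_group_mem[OF y that]] by simp
    have "x N <#> y N \<subseteq> x M <#> y M" if "N \<in> p_normals" "M \<in> p_normals" "N \<subseteq> M" for N M
      using x y that by (intro mono_set_mult) (auto simp: pro_p_group_simps(1))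
    then show "x \<otimes>\<^bsub>product_group p_normals (\<lambda>N. G Mod N)\<^esub> y \<in> carrier pro_p_group"
      using x y cl' by (auto simp: pro_p_group_simps(1) PiE_iff)
  qed
  then show ?thesis using P.subgroup_imp_group pro_p_group_simps(2) by metis
qed

lemma pro_p_group_mult: "\<lbrakk>x \<in> carrier pro_p_group; y \<in> carrier pro_p_group; N \<in> p_normals\<rbrakk> \<Longrightarrow> (x \<otimes>\<^bsub>pro_p_group\<^esub> y) N = x N \<otimes>\<^bsub>G Mod N\<^esub> y N"
  by (subst pro_p_group_simps(2)) simp

lemma eval_hom: "N \<in> p_normals \<Longrightarrow> group_hom pro_p_group (G Mod N) (\<lambda>x. x N)"
  using group_pro_p_group p_normals_group pro_p_group_mult
  by (auto simp: group_hom_def group_hom_axioms_def hom_def pro_p_group_simps(1))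

text \<open>
  The canonical map from \<open>G\<close> to its pro-\<open>p\<close> completion.
\<close>

definition \<iota> :: "'g \<Rightarrow> 'g set \<Rightarrow> 'g set" where "\<iota> g = (\<lambda>N\<in>p_normals. N #> g)"

lemma \<iota>_closed: "g \<in> carrier G \<Longrightarrow> \<iota> g \<in> carrier pro_p_group"
  by (auto simp: \<iota>_def pro_p_group_simps(1) carrier_FactGroup r_coset_def)

lemma \<iota>_hom: "group_hom G pro_p_group \<iota>"
proof -
  have "\<iota> (g \<otimes> h) = \<iota> g \<otimes>\<^bsub>pro_p_group\<^esub> \<iota> h" if gh: "g \<in> carrier G" "h \<in> carrier G" for g h
  proof -
    have "\<iota> (g \<otimes> h) = (\<lambda>N\<in>p_normals. \<iota> g N \<otimes>\<^bsub>G Mod N\<^esub> \<iota> h N)"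
      using gh p_normals_D normal.rcos_sum by (fastforce simp: \<iota>_def)
    then show ?thesis by (subst pro_p_group_simps(2)) simp
  qed
  then show ?thesis using is_group group_pro_p_group \<iota>_closed
    by (auto simp: group_hom_def group_hom_axioms_def hom_def)
qed

lemma topspace_pro_p: "topspace (pro_p_topology p G) = carrier pro_p_group"
  by (auto simp: pro_p_topology_def pro_p_group_simps(1))

text \<open>
  A basic open set constrains finitely many coordinates. Those are all determined by the coordinate at a common
  subgroup \<open>N0\<close> of \<open>p\<close>-power index, and every coset of \<open>N0\<close> comes from an element of \<open>G\<close>.
\<close>

lemma dense_image:
  assumes S: "S \<subseteq> carrier G" "generate G S = carrier G"
  shows "pro_p_topology p G closure_of generate pro_p_group (\<iota> ` S) = carrier pro_p_group"
proof
  show "pro_p_topology p G closure_of generate pro_p_group (\<iota> ` S) \<subseteq> carrier pro_p_group"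
    using closure_of_subset_topspace topspace_pro_p by metis
  interpret \<iota>: group_hom G pro_p_group \<iota> by (rule \<iota>_hom)
  have gen: "generate pro_p_group (\<iota> ` S) = \<iota> ` carrier G" using \<iota>.generate_img[OF S(1)] S(2) by simp
  show "carrier pro_p_group \<subseteq> pro_p_topology p G closure_of generate pro_p_group (\<iota> ` S)"
  proof
    fix x assume x: "x \<in> carrier pro_p_group"
    have "\<exists>y. y \<in> \<iota> ` carrier G \<and> y \<in> T" if xT: "x \<in> T" and oT: "openin (pro_p_topology p G) T" for T
    proof -
      obtain U where U: "openin (product_topology (\<lambda>N. discrete_topology (carrier (G Mod N))) p_normals) U"
        and T: "T = U \<inter> carrier pro_p_group"
        using oT by (auto simp: pro_p_topology_def openin_subtopology)
      obtain V where V: "finite {N \<in> p_normals. V N \<noteq> carrier (G Mod N)}" "x \<in> Pi\<^sub>E p_normals V" "Pi\<^sub>E p_normals V \<subseteq> U"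
        using U xT unfolding T openin_product_topology_alt by auto
      let ?J = "{N \<in> p_normals. V N \<noteq> carrier (G Mod N)}"
      obtain N0 where N0: "N0 \<in> p_normals" "\<forall>N\<in>?J. N0 \<subseteq> N" using finite_Int_p_normals[OF V(1)] by blast
      obtain g where g: "g \<in> carrier G" "x N0 = N0 #> g"
        using pro_p_group_mem[OF x N0(1)] by (auto simp: carrier_FactGroup)
      have "N #> g = x N" if N: "N \<in> ?J" for N
      proof -
        have "N0 #> g \<subseteq> x N" using pro_p_group_mono[OF x N0(1), of N] N N0(2) g by auto
        then have gx: "g \<in> x N"
          using rcos_self[OF g(1) normal_imp_subgroup[OF p_normals_D[OF N0(1)]]] by auto
        obtain k where k: "k \<in> carrier G" "x N = N #> k"
          using pro_p_group_mem[OF x, of N] N by (auto simp: carrier_FactGroup)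
        then show ?thesis using coset_eq_iff[of N g k] N g gx by auto
      qed
      then have "\<iota> g \<in> Pi\<^sub>E p_normals V"
        using V(2) g(1) by (fastforce simp: \<iota>_def carrier_FactGroup)
      then show ?thesis using V(3) T g(1) \<iota>_closed by blast
    qed
    then show "x \<in> pro_p_topology p G closure_of generate pro_p_group (\<iota> ` S)"
      unfolding in_closure_of topspace_pro_p gen using x by blast
  qed
qed

text \<open>
  The points of the completion with a given coordinate at \<open>N\<close> form a nonempty open set.
\<close>

lemma dense_subset_meets_coset:
  assumes D: "pro_p_topology p G closure_of D = carrier pro_p_group" and N: "N \<in> p_normals" and c: "c \<in> carrier (G Mod N)"
  shows "\<exists>t\<in>D. t \<in> carrier pro_p_group \<and> t N = c"
proof -
  obtain g where g: "g \<in> carrier G" "c = N #> g" using c by (auto simp: carrier_FactGroup)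
  let ?T = "{y \<in> topspace (pro_p_topology p G). y N \<in> {c}}"
  have "continuous_map (pro_p_topology p G) (discrete_topology (carrier (G Mod N))) (\<lambda>x. x N)"
    unfolding pro_p_topology_def
    by (intro continuous_map_from_subtopology continuous_map_product_projection N)
  then have op: "openin (pro_p_topology p G) ?T" using c by (intro openin_continuous_map_preimage) auto
  have \<iota>T: "\<iota> g \<in> ?T" using g N \<iota>_closed by (simp add: topspace_pro_p) (simp add: \<iota>_def)
  have "\<iota> g \<in> pro_p_topology p G closure_of D" using D \<iota>_closed g by simp
  then have "\<forall>T. \<iota> g \<in> T \<and> openin (pro_p_topology p G) T \<longrightarrow> (\<exists>y. y \<in> D \<and> y \<in> T)"
    unfolding in_closure_of by simp
  from this[rule_format, OF conjI, OF \<iota>T op] obtain t where "t \<in> D" "t \<in> ?T" by (elim exE conjE)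
  then show ?thesis by (auto simp: topspace_pro_p)
qed

text \<open>
  The upper bound is the density of the image of \<open>S\<close>. For the lower bound, a topological generating set maps onto
  generators of the quotient of \<open>G\<close> by the kernel \<open>M\<close> of \<open>\<psi>\<close>; this quotient is elementary abelian of order \<open>p ^ n\<close>, and
  \<open>k\<close> elements generate at most \<open>p ^ k\<close> elements of it.
\<close>

theorem d_p_eq:
  assumes S: "S \<subseteq> carrier G" "generate G S = carrier G" "finite S" "card S \<le> n"
    and K: "comm_group K" "order K = p ^ n" "\<And>k. k \<in> carrier K \<Longrightarrow> k [^]\<^bsub>K\<^esub> p = \<one>\<^bsub>K\<^esub>"
    and \<psi>: "\<psi> \<in> hom G K" "\<psi> ` carrier G = carrier K"
  shows "d_p p G = enat n"
proof (rule antisym)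
  have p0: "p > 0" using prime_p prime_gt_0_nat by blast
  have "d_p p G \<le> enat (card (\<iota> ` S))"
    unfolding d_p_def using S dense_image[OF S(1,2)] \<iota>_closed by (intro INF_lower) auto
  also have "\<dots> \<le> enat n" using card_image_le[OF S(3), of \<iota>] S(4) by simp
  finally show "d_p p G \<le> enat n" .
  interpret K: comm_group K by (rule K)
  interpret \<psi>: group_hom G K \<psi> using \<psi> by unfold_locales
  have fK: "finite (carrier K)" using K(2) p0 by (metis K.order_gt_0_iff_finite zero_less_power)
  define M where "M = kernel G K \<psi>"
  have M: "M \<in> p_normals" unfolding M_def using \<psi>.group_hom_axioms fK K(2) by (rule kernel_p_normals)
  interpret M: normal M G using p_normals_D[OF M] .
  interpret Q: group "G Mod M" by (rule p_normals_group[OF M])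
  interpret e: group_hom pro_p_group "G Mod M" "\<lambda>x. x M" by (rule eval_hom[OF M])
  have cardQ: "card (carrier (G Mod M)) = p ^ n"
    using \<psi>.card_rcosets_kernel \<psi>(2) K(2) by (simp add: M_def FactGroup_def order_def)
  have commQ: "a \<otimes>\<^bsub>G Mod M\<^esub> b = b \<otimes>\<^bsub>G Mod M\<^esub> a" if "a \<in> carrier (G Mod M)" "b \<in> carrier (G Mod M)" for a b
  proof -
    obtain g h where gh: "g \<in> carrier G" "a = M #> g" "h \<in> carrier G" "b = M #> h"
      using \<open>a \<in> carrier (G Mod M)\<close> \<open>b \<in> carrier (G Mod M)\<close> by (auto simp: carrier_FactGroup)
    define a' b' where "a' = g \<otimes> h" and "b' = h \<otimes> g"
    have ab': "a' \<in> carrier G" "b' \<in> carrier G" using gh by (simp_all add: a'_def b'_def)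
    have "\<psi> a' = \<psi> b'" using gh K.m_comm[of "\<psi> g" "\<psi> h"] by (simp add: a'_def b'_def)
    then have "\<psi> (a' \<otimes> inv b') = \<psi> b' \<otimes>\<^bsub>K\<^esub> inv\<^bsub>K\<^esub> \<psi> b'"
      using \<psi>.hom_mult[OF ab'(1) inv_closed[OF ab'(2)]] \<psi>.hom_inv[OF ab'(2)] by metis
    also have "\<dots> = \<one>\<^bsub>K\<^esub>" by (rule K.r_inv) (rule \<psi>.hom_closed[OF ab'(2)])
    finally have "a' \<otimes> inv b' \<in> M" unfolding M_def kernel_def using ab' by blast
    then have "a' \<otimes> inv b' \<otimes> b' \<in> M #> b'" using M.subset ab'(2) by (rule rcosI)
    moreover have "a' \<otimes> inv b' \<otimes> b' = a'" using ab' by (simp add: m_assoc)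
    ultimately have "g \<otimes> h \<in> M #> (h \<otimes> g)" by (simp add: a'_def b'_def)
    then have "M #> (g \<otimes> h) = M #> (h \<otimes> g)" using coset_eq_iff[OF M] gh by simp
    then show ?thesis using gh by (simp add: M.rcos_sum)
  qed
  have powQ: "a [^]\<^bsub>G Mod M\<^esub> p = \<one>\<^bsub>G Mod M\<^esub>" if a: "a \<in> carrier (G Mod M)" for a
  proof -
    obtain g where g: "g \<in> carrier G" "a = M #> g" using a by (auto simp: carrier_FactGroup)
    have "\<psi> (g [^] p) = \<one>\<^bsub>K\<^esub>"
      using \<psi>.hom_nat_pow[OF g(1), of p] K(3)[OF \<psi>.hom_closed[OF g(1)]] by metis
    then have "g [^] p \<in> M" unfolding M_def kernel_def using g by blast
    then have "M #> (g [^] p) = M" using g(1) by (intro coset_join2 M.subgroup_axioms) auto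
    then show ?thesis unfolding g(2) M.FactGroup_pow[OF g(1)] one_FactGroup .
  qed
  show "enat n \<le> d_p p G"
    unfolding d_p_def
  proof (rule INF_greatest)
    fix T assume "T \<in> {S. finite S \<and> S \<subseteq> carrier pro_p_group \<and> pro_p_topology p G closure_of generate pro_p_group S = carrier pro_p_group}"
    then have T: "finite T" "T \<subseteq> carrier pro_p_group" "pro_p_topology p G closure_of generate pro_p_group T = carrier pro_p_group" by auto
    let ?T = "(\<lambda>x. x M) ` T"
    have Tc: "?T \<subseteq> carrier (G Mod M)" using T(2) e.hom_closed by auto
    have "carrier (G Mod M) \<subseteq> (\<lambda>x. x M) ` generate pro_p_group T"
      using dense_subset_meets_coset[OF T(3) M] by blast
    then have "carrier (G Mod M) \<subseteq> generate (G Mod M) ?T" using e.generate_img[OF T(2)] by simp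
    moreover have "finite (generate (G Mod M) ?T) \<and> card (generate (G Mod M) ?T) \<le> p ^ card ?T"
      using commQ[OF subsetD[OF Tc] subsetD[OF Tc]] powQ[OF subsetD[OF Tc]]
      by (rule Q.card_generate_abelian_exponent[OF finite_imageI[OF T(1)] Tc _ _ p0])
    ultimately have "p ^ n \<le> p ^ card ?T" using card_mono cardQ order_trans by metis
    also have "\<dots> \<le> p ^ card T" using T(1) p0 card_image_le by (intro power_increasing) auto
    finally have "p ^ n \<le> p ^ card T" .
    then have "n \<le> card T" by (rule power_le_imp_le_exp[OF prime_gt_1_nat[OF prime_p]])
    then show "enat n \<le> enat (card T)" by simp
  qed
qed

end

section \<open>The theorem\<close>

lemma nat_pow_product_group:
  assumes "f \<in> carrier (product_group I K)" "\<And>i. i \<in> I \<Longrightarrow> group (K i)" "i \<in> I"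
  shows "(f [^]\<^bsub>product_group I K\<^esub> (k::nat)) i = f i [^]\<^bsub>K i\<^esub> k"
  using assms(3) by (induction k) auto

text \<open>
  Surjectivity is proved by clearing the coordinates of a vector from the last one down.
\<close>

lemma elementary_abelian_image:
  fixes n p :: nat
  assumes p: "Factorial_Ring.prime p"
  defines "K \<equiv> product_group {..<n} (\<lambda>_. integer_mod_group p)"
  shows "comm_group K" and "order K = p ^ n"
    and "\<And>k. k \<in> carrier K \<Longrightarrow> k [^]\<^bsub>K\<^esub> p = \<one>\<^bsub>K\<^esub>"
    and "\<exists>\<phi>\<in>hom (free_group {..<n}) K. \<phi> ` carrier (free_group {..<n}) = carrier K"
proof -
  have p1: "p > 1" using p prime_gt_1_nat by blast
  have carK: "carrier K = {..<n} \<rightarrow>\<^sub>E {0..<int p}" using p1 by (simp add: K_def carrier_integer_mod_group)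
  interpret group K unfolding K_def by simp
  show "comm_group K"
    by (rule group_comm_groupI) (auto simp: K_def add.commute)
  show "order K = p ^ n" by (simp add: order_def carK card_PiE)
  have pow: "k [^]\<^bsub>K\<^esub> m = (\<lambda>i\<in>{..<n}. (int m * k i) mod int p)" if k: "k \<in> carrier K" for k and m :: nat
  proof (rule extensionalityI[where A = "{..<n}"])
    show "k [^]\<^bsub>K\<^esub> m \<in> extensional {..<n}"
      using nat_pow_closed[OF k, of m] unfolding carK PiE_def by (rule IntD2)
    show "(k [^]\<^bsub>K\<^esub> m) i = (\<lambda>i\<in>{..<n}. (int m * k i) mod int p) i" if i: "i \<in> {..<n}" for i
    proof -
      have "k i \<in> {0..<int p}" using k i unfolding carK by (rule PiE_mem)
      moreover have "(k [^]\<^bsub>K\<^esub> m) i = k i [^]\<^bsub>integer_mod_group p\<^esub> m"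
        unfolding K_def using k i by (intro nat_pow_product_group) (simp_all add: K_def)
      ultimately show ?thesis using i by simp
    qed
  qed simp
  show "k [^]\<^bsub>K\<^esub> p = \<one>\<^bsub>K\<^esub>" if "k \<in> carrier K" for k
    unfolding pow[OF that] by (simp add: K_def)
  define e where "e a = (\<lambda>i\<in>{..<n}. if i = a then 1 else 0 :: int)" for a :: nat
  have eK: "e a \<in> carrier K" for a using p1 by (auto simp: e_def carK)
  define L where "L l = (if snd l then e (fst l) else inv\<^bsub>K\<^esub> (e (fst l)))" for l :: "nat letter"
  define \<phi> where "\<phi> = word_eval K L"
  have hom: "\<phi> \<in> hom (free_group {..<n}) K"
    unfolding \<phi>_def by (rule word_eval_hom) (auto simp: L_def eK inv_letter_def)
  interpret F: group "free_group {..<n}" by (rule group_free_group)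
  interpret \<phi>: group_hom "free_group {..<n}" K \<phi> using hom by unfold_locales
  interpret I: subgroup "\<phi> ` carrier (free_group {..<n})" K by (rule \<phi>.img_is_subgroup)
  have e_image: "e a \<in> \<phi> ` carrier (free_group {..<n})" if "a < n" for a
  proof -
    have "\<phi> (free_gen a) = e a" using eK[of a] by (simp add: \<phi>_def word_eval_def L_def)
    then show ?thesis using free_gen_closed[of a "{..<n}"] that by (metis image_eqI lessThan_iff)
  qed
  have "f \<in> \<phi> ` carrier (free_group {..<n})"
    if "f \<in> carrier K" "\<And>i. m \<le> i \<Longrightarrow> i < n \<Longrightarrow> f i = 0" for f m
    using that
  proof (induction m arbitrary: f)
    case 0
    have "f \<in> extensional {..<n}" using 0(1) unfolding carK PiE_def by (rule IntD2)
    then have "f = \<one>\<^bsub>K\<^esub>" using 0(2) by (intro extensionalityI[of f "{..<n}"]) (auto simp: K_def)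
    then show ?case using I.one_closed by simp
  next
    case (Suc m)
    show ?case
    proof (cases "m < n")
      case True
      define g where "g = f(m := 0)"
      have g: "g \<in> carrier K" using Suc.prems(1) p1 True by (auto simp: g_def carK PiE_iff extensional_def)
      have "g \<in> \<phi> ` carrier (free_group {..<n})"
        using Suc.prems(2) by (intro Suc.IH[OF g]) (auto simp: g_def)
      moreover have "e m [^]\<^bsub>K\<^esub> k \<in> \<phi> ` carrier (free_group {..<n})" for k :: nat
        using e_image[OF True] by (induction k) auto
      moreover have "f = g \<otimes>\<^bsub>K\<^esub> e m [^]\<^bsub>K\<^esub> nat (f m)"
      proof (rule extensionalityI[where A = "{..<n}"])
        show "f \<in> extensional {..<n}" using Suc.prems(1) unfolding carK PiE_def by (rule IntD2)
        show "g \<otimes>\<^bsub>K\<^esub> e m [^]\<^bsub>K\<^esub> nat (f m) \<in> extensional {..<n}" by (simp add: K_def)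
        fix i assume i: "i \<in> {..<n}"
        have "f i \<in> {0..<int p}" "f m \<in> {0..<int p}"
          using PiE_mem[OF Suc.prems(1)[unfolded carK]] i True by simp_all
        then show "f i = (g \<otimes>\<^bsub>K\<^esub> e m [^]\<^bsub>K\<^esub> nat (f m)) i"
          unfolding pow[OF eK] using i True by (auto simp: K_def g_def e_def)
      qed
      ultimately show ?thesis using I.m_closed by metis
    next
      case False
      then show ?thesis using Suc.prems(1) by (intro Suc.IH) auto
    qed
  qed
  from this[of _ n] have "carrier K \<subseteq> \<phi> ` carrier (free_group {..<n})" by auto
  then show "\<exists>\<phi>\<in>hom (free_group {..<n}) K. \<phi> ` carrier (free_group {..<n}) = carrier K"
    using hom \<phi>.img_is_subgroup subgroup.subset by blast
qed

theorem proposition7p5: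
  fixes n p :: nat
  assumes "n \<ge> 99" and "Factorial_Ring.prime p" and "p > 64"
  shows "\<exists>G :: nat monoid. group G \<and> property_T G \<and>
    golod_shafarevich p G \<and> d_p p G = enat n"
proof -
  let ?F = "free_group {..<n}"
  let ?K = "product_group {..<n} (\<lambda>_. integer_mod_group p)"
  interpret F: group ?F by (rule group_free_group)
  obtain G :: "nat monoid" and h where G: "group G" and pres: "presents {..<n} (relators p n) G"
    and h: "h \<in> hom ?F G" "h ` carrier ?F = carrier G"
    and kill: "\<And>r. r \<in> relators p n \<Longrightarrow> h r = \<one>\<^bsub>G\<^esub>"
    and univ: "\<And>(K :: (nat \<Rightarrow> int) monoid) \<phi>. \<lbrakk>group K; \<phi> \<in> hom ?F K; \<And>r. r \<in> relators p n \<Longrightarrow> \<phi> r = \<one>\<^bsub>K\<^esub>\<rbrakk> \<Longrightarrow>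
       \<exists>\<psi>\<in>hom G K. \<forall>w\<in>carrier ?F. \<psi> (h w) = \<phi> w"
    using presented_group[OF relators_closed] by metis
  interpret G: group G by (rule G)
  interpret h: group_hom ?F G h using h by unfold_locales
  define x where "x a = h (free_gen a)" for a
  have x: "x a \<in> carrier G" if "a < n" for a
    using free_gen_closed[of a "{..<n}"] that by (simp add: x_def)
  have "free_gen ` {..<n} \<subseteq> carrier ?F" using free_gen_closed by (rule image_subsetI)
  then have "generate G (h ` free_gen ` {..<n}) = h ` generate ?F (free_gen ` {..<n})"
    by (rule h.generate_img)
  then have gen: "generate G (x ` {..<n}) = carrier G"
    by (simp add: generate_free_gens h(2) image_image x_def)
  have rel: "(\<forall>a<n. x a [^]\<^bsub>G\<^esub> p = \<one>\<^bsub>G\<^esub>) \<and> (\<forall>(a, b)\<in>same_class_pairs n. comm G (x a) (x b) = \<one>\<^bsub>G\<^esub>) \<and>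
      (\<forall>(a, b, c)\<in>mixed_triples n. comm G (comm G (x a) (x b)) (x c) = \<one>\<^bsub>G\<^esub>)"
    using hom_relators_trivial_iff[OF G h(1), of p] kill unfolding x_def by blast
  have T: "property_T G"
    using rel by (intro property_T_of_relations[OF G x gen assms(2,3)]) auto
  have "golod_shafarevich_condition p {..<n} (relators p n)"
    using assms by (intro golod_shafarevich_condition_relators) auto
  then have GS: "golod_shafarevich p G"
    unfolding golod_shafarevich_def using pres by blast
  note K = elementary_abelian_image[where n = n, OF assms(2)]
  interpret K: comm_group ?K by (rule K(1))
  obtain \<phi> where \<phi>: "\<phi> \<in> hom ?F ?K" "\<phi> ` carrier ?F = carrier ?K" using K(4) by blast
  have cl: "\<phi> w \<in> carrier ?K" if "w \<in> carrier ?F" for w using \<phi> that by blast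
  have comm1: "comm ?K u v = \<one>\<^bsub>?K\<^esub>" if "u \<in> carrier ?K" "v \<in> carrier ?K" for u v
    using K.comm_eq_one_iff[OF that] K.m_comm[OF that] by simp
  have g: "\<phi> (free_gen a) \<in> carrier ?K" if "a < n" for a
    using cl free_gen_closed[of a "{..<n}"] that by blast
  have "\<forall>r\<in>relators p n. \<phi> r = \<one>\<^bsub>?K\<^esub>"
    unfolding hom_relators_trivial_iff[OF K.is_group \<phi>(1)]
  proof (intro conjI allI impI ballI; clarify?)
    show "\<phi> (free_gen a) [^]\<^bsub>?K\<^esub> p = \<one>\<^bsub>?K\<^esub>" if "a < n" for a by (rule K(3)[OF g[OF that]])
    show "comm ?K (\<phi> (free_gen a)) (\<phi> (free_gen b)) = \<one>\<^bsub>?K\<^esub>" if "(a, b) \<in> same_class_pairs n" for a b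
      using that by (intro comm1 g) (auto simp: same_class_pairs_def)
    show "comm ?K (comm ?K (\<phi> (free_gen a)) (\<phi> (free_gen b))) (\<phi> (free_gen c)) = \<one>\<^bsub>?K\<^esub>"
      if "(a, b, c) \<in> mixed_triples n" for a b c
      using that by (intro comm1 K.comm_closed g) (auto simp: mixed_triples_def)
  qed
  then obtain \<psi> where \<psi>: "\<psi> \<in> hom G ?K" "\<And>w. w \<in> carrier ?F \<Longrightarrow> \<psi> (h w) = \<phi> w"
    using univ[OF K.is_group \<phi>(1)] by blast
  have \<psi>_surj: "\<psi> ` carrier G = carrier ?K"
    unfolding h(2)[symmetric] \<phi>(2)[symmetric] image_image using \<psi>(2) by (intro image_cong) auto
  interpret pro_p G p using assms(2) by unfold_locales
  have "card (x ` {..<n}) \<le> n" using card_image_le[of "{..<n}" x] by simp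
  then have "d_p p G = enat n"
    using x by (intro d_p_eq[OF _ gen _ _ K(1-3) \<psi>(1) \<psi>_surj]) auto
  then show ?thesis using G T GS by blast
qed

end
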